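(* Let $A$ be an associative algebra over a field $\mathbb{K}$, let $(r,s)$ be an associative Yang-Baxter pair on $A$, and let $(A,\delta_r,\delta_s,\Delta)$ be the associated quasitriangular covariant bialgebra. Then every right $A$-module $M$ is a right covariant $A$-module with the coaction $$\varrho^M:M\to M\otimes A,\qquad m\mapsto mr.$$ Similarly, every left $A$-module $N$ is a left covariant $A$-module with the coaction $$\varrho^N:N\to A\otimes N,\qquad n\mapsto -sn.$$
   Context: Algebras are associative, not necessarily unital; $\otimes=\otimes_{\mathbb{K}}$. $A\otimes A$ is an $A$-bimodule by $a\cdot(b\otimes c)\cdot d=ab\otimes cd$. For $r=\sum r^{[1]}\otimes r^{[2]}$, $s=\sum s^{[1]}\otimes s^{[2]}$: $mr=\sum mr^{[1]}\otimes r^{[2]}$ and $sn=\sum s^{[1]}\otimes s^{[2]}n$. For $r=\sum_i a_i\otimes b_i\in A\otimes A$ put $r_{12}=r\otimes 1$, $r_{13}=\sum_i a_i\otimes 1\otimes b_i$, $r_{23}=1\otimes r$, where $1$ is the identity of $A$ if $A$ is unital, or the identity of $\mathbb{K}\oplus A$ otherwise. An associative Yang-Baxter pair on $A$ is a pair $r,s\in A\otimes A$ with $$r_{13}r_{12}-r_{12}r_{23}+s_{23}r_{13}=0,\qquad s_{13}r_{12}-s_{12}s_{23}+s_{23}s_{13}=0.$$ The associated quasitriangular covariant bialgebra is $(A,\delta_r,\delta_s,\Delta)$ with $\delta_r(a)=ar-ra$, $\delta_s(a)=as-sa$, $\Delta(a)=ar-sa$; here $\delta_r,\delta_s$ are derivations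 $A\to A\otimes A$ and $\Delta$ is coassociative with $\Delta(ab)=\Delta(a)b+a\delta_r(b)=a\Delta(b)+\delta_s(a)b$. Let $(A,\delta_1,\delta_2,\Delta)$ be such a quadruple (a covariant bialgebra). A right covariant $A$-module is a right $A$-module $M$ that is also a right $A$-comodule, i.e. has a $\mathbb{K}$-linear coaction $\varrho^M:M\to M\otimes A$ with $(\varrho^M\otimes\mathrm{id})\circ\varrho^M=(\mathrm{id}\otimes\Delta)\circ\varrho^M$ (no counitality required), such that $\varrho^M(ma)=\varrho^M(m)a+m\delta_1(a)$ for all $m\in M$, $a\in A$. A left covariant $A$-module is a left $A$-module $N$ with a $\mathbb{K}$-linear coaction $\varrho^N:N\to A\otimes N$ with $(\mathrm{id}\otimes\varrho^N)\circ\varrho^N=(\Delta\otimes\mathrm{id})\circ\varrho^N$ (no counitality required), such that $\varrho^N(an)=a\varrho^N(n)+\delta_2(a)n$ for all $n\in N$, $a\in A$. Modules are not required to be unital. *)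

theory Defs
  imports "HOL-Algebra.Module" "HOL-Algebra.AbelCoset"
begin

text \<open>
  Vector spaces and algebras are records of type \<open>module\<close> over a field \<open>K\<close>. The fields \<open>mult\<close> and
  \<open>one\<close> of a plain vector space are irrelevant, and so is the field \<open>one\<close> of an algebra, since
  algebras need not be unital.
\<close>

definition linear_map ::
  "('k, 'x) ring_scheme \<Rightarrow> ('k, 'v, 'y) module_scheme \<Rightarrow> ('k, 'w, 'z) module_scheme \<Rightarrow> ('v \<Rightarrow> 'w) \<Rightarrow> bool"
  where "linear_map K V W f \<longleftrightarrow>
    f \<in> carrier V \<rightarrow> carrier W \<and>
    (\<forall>u\<in>carrier V. \<forall>v\<in>carrier V. f (u \<oplus>\<^bsub>V\<^esub> v) = f u \<oplus>\<^bsub>W\<^esub> f v) \<and>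
    (\<forall>c\<in>carrier K. \<forall>v\<in>carrier V. f (c \<odot>\<^bsub>V\<^esub> v) = c \<odot>\<^bsub>W\<^esub> f v)"


section \<open>Tensor products\<close>

definition free_module :: "('k, 'x) ring_scheme \<Rightarrow> 'b set \<Rightarrow> ('k, 'b \<Rightarrow> 'k) module"
  where "free_module K X =
    \<lparr>carrier = {p. (\<forall>x\<in>X. p x \<in> carrier K) \<and> (\<forall>x. x \<notin> X \<longrightarrow> p x = \<zero>\<^bsub>K\<^esub>) \<and> finite {x. p x \<noteq> \<zero>\<^bsub>K\<^esub>}},
     mult = undefined, one = undefined,
     zero = (\<lambda>_. \<zero>\<^bsub>K\<^esub>),
     add = (\<lambda>p q x. p x \<oplus>\<^bsub>K\<^esub> q x),
     smult = (\<lambda>c p x. c \<otimes>\<^bsub>K\<^esub> p x)\<rparr>"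

definition free_gen :: "('k, 'x) ring_scheme \<Rightarrow> 'b \<Rightarrow> 'b \<Rightarrow> 'k"
  where "free_gen K x = (\<lambda>y. if y = x then \<one>\<^bsub>K\<^esub> else \<zero>\<^bsub>K\<^esub>)"

definition tensor_gens ::
  "('k, 'x) ring_scheme \<Rightarrow> ('k, 'v, 'y) module_scheme \<Rightarrow> ('k, 'w, 'z) module_scheme \<Rightarrow> ('v \<times> 'w \<Rightarrow> 'k) set"
  where "tensor_gens K V W =
    (let F = free_module K (carrier V \<times> carrier W); g = (\<lambda>v w. free_gen K (v, w)) in
      {g (v \<oplus>\<^bsub>V\<^esub> v') w \<ominus>\<^bsub>F\<^esub> (g v w \<oplus>\<^bsub>F\<^esub> g v' w) | v v' w. v \<in> carrier V \<and> v' \<in> carrier V \<and> w \<in> carrier W} \<union>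
      {g v (w \<oplus>\<^bsub>W\<^esub> w') \<ominus>\<^bsub>F\<^esub> (g v w \<oplus>\<^bsub>F\<^esub> g v w') | v w w'. v \<in> carrier V \<and> w \<in> carrier W \<and> w' \<in> carrier W} \<union>
      {g (c \<odot>\<^bsub>V\<^esub> v) w \<ominus>\<^bsub>F\<^esub> c \<odot>\<^bsub>F\<^esub> g v w | c v w. c \<in> carrier K \<and> v \<in> carrier V \<and> w \<in> carrier W} \<union>
      {g v (c \<odot>\<^bsub>W\<^esub> w) \<ominus>\<^bsub>F\<^esub> c \<odot>\<^bsub>F\<^esub> g v w | c v w. c \<in> carrier K \<and> v \<in> carrier V \<and> w \<in> carrier W})"

definition tensor_rel ::
  "('k, 'x) ring_scheme \<Rightarrow> ('k, 'v, 'y) module_scheme \<Rightarrow> ('k, 'w, 'z) module_scheme \<Rightarrow> ('v \<times> 'w \<Rightarrow> 'k) set"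
  where "tensor_rel K V W =
    \<Inter> {H. submodule H K (free_module K (carrier V \<times> carrier W)) \<and> tensor_gens K V W \<subseteq> H}"

definition tensor ::
  "('k, 'x) ring_scheme \<Rightarrow> ('k, 'v, 'y) module_scheme \<Rightarrow> ('k, 'w, 'z) module_scheme
    \<Rightarrow> ('k, ('v \<times> 'w \<Rightarrow> 'k) set) module"
  where "tensor K V W =
    (let F = free_module K (carrier V \<times> carrier W); R = tensor_rel K V W in
    \<lparr>carrier = a_rcosets\<^bsub>F\<^esub> R, mult = undefined, one = undefined,
     zero = R, add = (\<lambda>X Y. X <+>\<^bsub>F\<^esub> Y), smult = (\<lambda>c X. \<Union>p\<in>X. R +>\<^bsub>F\<^esub> (c \<odot>\<^bsub>F\<^esub> p))\<rparr>)"

definition pure_tensor ::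
  "('k, 'x) ring_scheme \<Rightarrow> ('k, 'v, 'y) module_scheme \<Rightarrow> ('k, 'w, 'z) module_scheme
    \<Rightarrow> 'v \<Rightarrow> 'w \<Rightarrow> ('v \<times> 'w \<Rightarrow> 'k) set"
  where "pure_tensor K V W v w =
    tensor_rel K V W +>\<^bsub>free_module K (carrier V \<times> carrier W)\<^esub> free_gen K (v, w)"

text \<open>
  The linear map \<open>V \<otimes> W \<rightarrow> U\<close> induced by a bilinear map \<open>f\<close>, sending \<open>\<Sum> v\<^sub>i \<otimes> w\<^sub>i\<close> to \<open>\<Sum> f v\<^sub>i w\<^sub>i\<close>.
  For bilinear \<open>f\<close> the value does not depend on the chosen representative \<open>p\<close>.
\<close>
definition tensor_lift ::
  "('k, 'x) ring_scheme \<Rightarrow> ('k, 'u, 'y) module_scheme \<Rightarrow> ('v \<Rightarrow> 'w \<Rightarrow> 'u)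
    \<Rightarrow> ('v \<times> 'w \<Rightarrow> 'k) set \<Rightarrow> 'u"
  where "tensor_lift K U f X =
    (let p = (SOME p. p \<in> X) in
      \<Oplus>\<^bsub>U\<^esub>z\<in>{z. p z \<noteq> \<zero>\<^bsub>K\<^esub>}. p z \<odot>\<^bsub>U\<^esub> f (fst z) (snd z))"

text \<open>\<open>f \<otimes> g\<close> for linear maps \<open>f\<close>, \<open>g\<close> with codomains \<open>V\<close>, \<open>W\<close>.\<close>
definition tensor_map ::
  "('k, 'x) ring_scheme \<Rightarrow> ('k, 'v, 'y) module_scheme \<Rightarrow> ('k, 'w, 'z) module_scheme
    \<Rightarrow> ('v0 \<Rightarrow> 'v) \<Rightarrow> ('w0 \<Rightarrow> 'w) \<Rightarrow> ('v0 \<times> 'w0 \<Rightarrow> 'k) set \<Rightarrow> ('v \<times> 'w \<Rightarrow> 'k) set"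
  where "tensor_map K V W f g =
    tensor_lift K (tensor K V W) (\<lambda>v w. pure_tensor K V W (f v) (g w))"

text \<open>The canonical map \<open>(U \<otimes> V) \<otimes> W \<rightarrow> U \<otimes> (V \<otimes> W)\<close>.\<close>
definition tensor_assoc ::
  "('k, 'x) ring_scheme \<Rightarrow> ('k, 'u, 'y) module_scheme \<Rightarrow> ('k, 'v, 'z) module_scheme \<Rightarrow> ('k, 'w, 't) module_scheme
    \<Rightarrow> (('u \<times> 'v \<Rightarrow> 'k) set \<times> 'w \<Rightarrow> 'k) set \<Rightarrow> ('u \<times> ('v \<times> 'w \<Rightarrow> 'k) set \<Rightarrow> 'k) set"
  where "tensor_assoc K U V W =
    (let VW = tensor K V W; T = tensor K U VW in
      tensor_lift K T (\<lambda>x w.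
        tensor_lift K T (\<lambda>u v. pure_tensor K U VW u (pure_tensor K V W v w)) x))"


section \<open>Algebras and modules\<close>

locale assoc_algebra = K?: field K + A?: module K A
  for K :: "('k, 'x) ring_scheme" (structure) and A :: "('k, 'a, 'y) module_scheme" (structure) +
  assumes mult_closed: "\<lbrakk>a \<in> carrier A; b \<in> carrier A\<rbrakk> \<Longrightarrow> a \<otimes>\<^bsub>A\<^esub> b \<in> carrier A"
    and mult_assoc: "\<lbrakk>a \<in> carrier A; b \<in> carrier A; c \<in> carrier A\<rbrakk>
      \<Longrightarrow> (a \<otimes>\<^bsub>A\<^esub> b) \<otimes>\<^bsub>A\<^esub> c = a \<otimes>\<^bsub>A\<^esub> (b \<otimes>\<^bsub>A\<^esub> c)"
    and mult_add_left: "\<lbrakk>a \<in> carrier A; b \<in> carrier A; c \<in> carrier A\<rbrakk>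
      \<Longrightarrow> (a \<oplus>\<^bsub>A\<^esub> b) \<otimes>\<^bsub>A\<^esub> c = a \<otimes>\<^bsub>A\<^esub> c \<oplus>\<^bsub>A\<^esub> b \<otimes>\<^bsub>A\<^esub> c"
    and mult_add_right: "\<lbrakk>a \<in> carrier A; b \<in> carrier A; c \<in> carrier A\<rbrakk>
      \<Longrightarrow> a \<otimes>\<^bsub>A\<^esub> (b \<oplus>\<^bsub>A\<^esub> c) = a \<otimes>\<^bsub>A\<^esub> b \<oplus>\<^bsub>A\<^esub> a \<otimes>\<^bsub>A\<^esub> c"
    and mult_smult_left: "\<lbrakk>k \<in> carrier K; a \<in> carrier A; b \<in> carrier A\<rbrakk>
      \<Longrightarrow> (k \<odot>\<^bsub>A\<^esub> a) \<otimes>\<^bsub>A\<^esub> b = k \<odot>\<^bsub>A\<^esub> (a \<otimes>\<^bsub>A\<^esub> b)"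
    and mult_smult_right: "\<lbrakk>k \<in> carrier K; a \<in> carrier A; b \<in> carrier A\<rbrakk>
      \<Longrightarrow> a \<otimes>\<^bsub>A\<^esub> (k \<odot>\<^bsub>A\<^esub> b) = k \<odot>\<^bsub>A\<^esub> (a \<otimes>\<^bsub>A\<^esub> b)"

locale right_alg_module = assoc_algebra K A + M?: module K M
  for K :: "('k, 'x) ring_scheme" (structure) and A :: "('k, 'a, 'y) module_scheme" (structure)
    and M :: "('k, 'm, 'z) module_scheme" (structure) +
  fixes act :: "'m \<Rightarrow> 'a \<Rightarrow> 'm"
  assumes act_closed: "\<lbrakk>m \<in> carrier M; a \<in> carrier A\<rbrakk> \<Longrightarrow> act m a \<in> carrier M"
    and act_mult: "\<lbrakk>m \<in> carrier M; a \<in> carrier A; b \<in> carrier A\<rbrakk>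
      \<Longrightarrow> act m (a \<otimes>\<^bsub>A\<^esub> b) = act (act m a) b"
    and act_add_left: "\<lbrakk>m \<in> carrier M; n \<in> carrier M; a \<in> carrier A\<rbrakk>
      \<Longrightarrow> act (m \<oplus>\<^bsub>M\<^esub> n) a = act m a \<oplus>\<^bsub>M\<^esub> act n a"
    and act_add_right: "\<lbrakk>m \<in> carrier M; a \<in> carrier A; b \<in> carrier A\<rbrakk>
      \<Longrightarrow> act m (a \<oplus>\<^bsub>A\<^esub> b) = act m a \<oplus>\<^bsub>M\<^esub> act m b"
    and act_smult_left: "\<lbrakk>k \<in> carrier K; m \<in> carrier M; a \<in> carrier A\<rbrakk>
      \<Longrightarrow> act (k \<odot>\<^bsub>M\<^esub> m) a = k \<odot>\<^bsub>M\<^esub> act m a"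
    and act_smult_right: "\<lbrakk>k \<in> carrier K; m \<in> carrier M; a \<in> carrier A\<rbrakk>
      \<Longrightarrow> act m (k \<odot>\<^bsub>A\<^esub> a) = k \<odot>\<^bsub>M\<^esub> act m a"

locale left_alg_module = assoc_algebra K A + N?: module K N
  for K :: "('k, 'x) ring_scheme" (structure) and A :: "('k, 'a, 'y) module_scheme" (structure)
    and N :: "('k, 'n, 'z) module_scheme" (structure) +
  fixes act :: "'a \<Rightarrow> 'n \<Rightarrow> 'n"
  assumes act_closed: "\<lbrakk>a \<in> carrier A; n \<in> carrier N\<rbrakk> \<Longrightarrow> act a n \<in> carrier N"
    and act_mult: "\<lbrakk>a \<in> carrier A; b \<in> carrier A; n \<in> carrier N\<rbrakk>
      \<Longrightarrow> act (a \<otimes>\<^bsub>A\<^esub> b) n = act a (act b n)"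
    and act_add_left: "\<lbrakk>a \<in> carrier A; b \<in> carrier A; n \<in> carrier N\<rbrakk>
      \<Longrightarrow> act (a \<oplus>\<^bsub>A\<^esub> b) n = act a n \<oplus>\<^bsub>N\<^esub> act b n"
    and act_add_right: "\<lbrakk>a \<in> carrier A; m \<in> carrier N; n \<in> carrier N\<rbrakk>
      \<Longrightarrow> act a (m \<oplus>\<^bsub>N\<^esub> n) = act a m \<oplus>\<^bsub>N\<^esub> act a n"
    and act_smult_left: "\<lbrakk>k \<in> carrier K; a \<in> carrier A; n \<in> carrier N\<rbrakk>
      \<Longrightarrow> act (k \<odot>\<^bsub>A\<^esub> a) n = k \<odot>\<^bsub>N\<^esub> act a n"
    and act_smult_right: "\<lbrakk>k \<in> carrier K; a \<in> carrier A; n \<in> carrier N\<rbrakk>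
      \<Longrightarrow> act a (k \<odot>\<^bsub>N\<^esub> n) = k \<odot>\<^bsub>N\<^esub> act a n"

definition tensor_algebra ::
  "('k, 'x) ring_scheme \<Rightarrow> ('k, 'a, 'y) module_scheme \<Rightarrow> ('k, 'b, 'z) module_scheme
    \<Rightarrow> ('k, ('a \<times> 'b \<Rightarrow> 'k) set) module"
  where "tensor_algebra K A B =
    (let T = tensor K A B in
      T\<lparr>mult := (\<lambda>x y.
        tensor_lift K T (\<lambda>a b.
          tensor_lift K T (\<lambda>a' b'. pure_tensor K A B (a \<otimes>\<^bsub>A\<^esub> a') (b \<otimes>\<^bsub>B\<^esub> b')) y) x)\<rparr>)"

definition is_identity :: "('k, 'a, 'y) module_scheme \<Rightarrow> 'a \<Rightarrow> bool"
  where "is_identity A e \<longleftrightarrow>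
    e \<in> carrier A \<and> (\<forall>a\<in>carrier A. e \<otimes>\<^bsub>A\<^esub> a = a \<and> a \<otimes>\<^bsub>A\<^esub> e = a)"

text \<open>The algebra \<open>K \<oplus> A\<close> with identity \<open>(1, 0)\<close>.\<close>
definition unitization ::
  "('k, 'x) ring_scheme \<Rightarrow> ('k, 'a, 'y) module_scheme \<Rightarrow> ('k, 'k \<times> 'a) module"
  where "unitization K A =
    \<lparr>carrier = carrier K \<times> carrier A,
     mult = (\<lambda>(c, a) (d, b). (c \<otimes>\<^bsub>K\<^esub> d, c \<odot>\<^bsub>A\<^esub> b \<oplus>\<^bsub>A\<^esub> d \<odot>\<^bsub>A\<^esub> a \<oplus>\<^bsub>A\<^esub> a \<otimes>\<^bsub>A\<^esub> b)),
     one = (\<one>\<^bsub>K\<^esub>, \<zero>\<^bsub>A\<^esub>),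
     zero = (\<zero>\<^bsub>K\<^esub>, \<zero>\<^bsub>A\<^esub>),
     add = (\<lambda>(c, a) (d, b). (c \<oplus>\<^bsub>K\<^esub> d, a \<oplus>\<^bsub>A\<^esub> b)),
     smult = (\<lambda>k (c, a). (k \<otimes>\<^bsub>K\<^esub> c, k \<odot>\<^bsub>A\<^esub> a))\<rparr>"


section \<open>Associative Yang-Baxter pairs\<close>

text \<open>
  The two Yang-Baxter equations in \<open>B \<otimes> (B \<otimes> B)\<close>, for an algebra \<open>B\<close> with identity \<open>e\<close>.
\<close>
definition yang_baxter_eqs ::
  "('k, 'x) ring_scheme \<Rightarrow> ('k, 'b, 'y) module_scheme \<Rightarrow> 'b
    \<Rightarrow> ('b \<times> 'b \<Rightarrow> 'k) set \<Rightarrow> ('b \<times> 'b \<Rightarrow> 'k) set \<Rightarrow> bool"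
  where "yang_baxter_eqs K B e r s \<longleftrightarrow>
    (let BB = tensor_algebra K B B;
         T = tensor_algebra K B BB;
         t12 = tensor_lift K T (\<lambda>a b. pure_tensor K B BB a (pure_tensor K B B b e));
         t13 = tensor_lift K T (\<lambda>a b. pure_tensor K B BB a (pure_tensor K B B e b));
         t23 = pure_tensor K B BB e
     in (t13 r \<otimes>\<^bsub>T\<^esub> t12 r \<ominus>\<^bsub>T\<^esub> t12 r \<otimes>\<^bsub>T\<^esub> t23 r) \<oplus>\<^bsub>T\<^esub> t23 s \<otimes>\<^bsub>T\<^esub> t13 r = \<zero>\<^bsub>T\<^esub> \<and>
        (t13 s \<otimes>\<^bsub>T\<^esub> t12 r \<ominus>\<^bsub>T\<^esub> t12 s \<otimes>\<^bsub>T\<^esub> t23 s) \<oplus>\<^bsub>T\<^esub> t23 s \<otimes>\<^bsub>T\<^esub> t13 s = \<zero>\<^bsub>T\<^esub>)"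

definition yang_baxter_pair ::
  "('k, 'x) ring_scheme \<Rightarrow> ('k, 'a, 'y) module_scheme
    \<Rightarrow> ('a \<times> 'a \<Rightarrow> 'k) set \<Rightarrow> ('a \<times> 'a \<Rightarrow> 'k) set \<Rightarrow> bool"
  where "yang_baxter_pair K A r s \<longleftrightarrow>
    r \<in> carrier (tensor K A A) \<and> s \<in> carrier (tensor K A A) \<and>
    (if \<exists>e. is_identity A e
     then yang_baxter_eqs K A (THE e. is_identity A e) r s
     else (let B = unitization K A;
               \<iota> = (\<lambda>a. (\<zero>\<^bsub>K\<^esub>, a));
               j = tensor_map K B B \<iota> \<iota>
           in yang_baxter_eqs K B \<one>\<^bsub>B\<^esub> (j r) (j s)))"


section \<open>Covariant bialgebras and covariant modules\<close>

text \<open>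
  \<open>x \<cdot> t\<close> for \<open>t \<in> A \<otimes> W\<close>, where \<open>x\<close> acts on the first factor by \<open>a \<mapsto> f x a \<in> V\<close>, with values in \<open>V \<otimes> W\<close>;
  and \<open>t \<cdot> x\<close> for \<open>t \<in> V \<otimes> A\<close>, where \<open>x\<close> acts on the second factor by \<open>a \<mapsto> g a x \<in> W\<close>, with values in \<open>V \<otimes> W\<close>.
\<close>
definition lmul ::
  "('k, 'x) ring_scheme \<Rightarrow> ('k, 'v, 'y) module_scheme \<Rightarrow> ('k, 'w, 'z) module_scheme
    \<Rightarrow> ('e \<Rightarrow> 'a \<Rightarrow> 'v) \<Rightarrow> 'e \<Rightarrow> ('a \<times> 'w \<Rightarrow> 'k) set \<Rightarrow> ('v \<times> 'w \<Rightarrow> 'k) set"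
  where "lmul K V W f x t = tensor_map K V W (f x) (\<lambda>w. w) t"

definition rmul ::
  "('k, 'x) ring_scheme \<Rightarrow> ('k, 'v, 'y) module_scheme \<Rightarrow> ('k, 'w, 'z) module_scheme
    \<Rightarrow> ('a \<Rightarrow> 'e \<Rightarrow> 'w) \<Rightarrow> ('v \<times> 'a \<Rightarrow> 'k) set \<Rightarrow> 'e \<Rightarrow> ('v \<times> 'w \<Rightarrow> 'k) set"
  where "rmul K V W g t x = tensor_map K V W (\<lambda>v. v) (\<lambda>a. g a x) t"

definition derivation ::
  "('k, 'x) ring_scheme \<Rightarrow> ('k, 'a, 'y) module_scheme \<Rightarrow> ('a \<Rightarrow> ('a \<times> 'a \<Rightarrow> 'k) set) \<Rightarrow> bool"
  where "derivation K A \<delta> \<longleftrightarrow>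
    linear_map K A (tensor K A A) \<delta> \<and>
    (\<forall>a\<in>carrier A. \<forall>b\<in>carrier A. \<delta> (a \<otimes>\<^bsub>A\<^esub> b) =
      lmul K A A (\<otimes>\<^bsub>A\<^esub>) a (\<delta> b) \<oplus>\<^bsub>tensor K A A\<^esub> rmul K A A (\<otimes>\<^bsub>A\<^esub>) (\<delta> a) b)"

locale covariant_bialgebra = assoc_algebra K A
  for K :: "('k, 'x) ring_scheme" (structure) and A :: "('k, 'a, 'y) module_scheme" (structure) +
  fixes \<delta>\<^sub>1 \<delta>\<^sub>2 \<Delta> :: "'a \<Rightarrow> ('a \<times> 'a \<Rightarrow> 'k) set"
  assumes derivation_1: "derivation K A \<delta>\<^sub>1"
    and derivation_2: "derivation K A \<delta>\<^sub>2"
    and comult_linear: "linear_map K A (tensor K A A) \<Delta>"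
    and coassoc: "a \<in> carrier A \<Longrightarrow>
      tensor_assoc K A A A (tensor_map K (tensor K A A) A \<Delta> (\<lambda>x. x) (\<Delta> a)) =
      tensor_map K A (tensor K A A) (\<lambda>x. x) \<Delta> (\<Delta> a)"
    and comult_mult_1: "\<lbrakk>a \<in> carrier A; b \<in> carrier A\<rbrakk> \<Longrightarrow> \<Delta> (a \<otimes>\<^bsub>A\<^esub> b) =
      rmul K A A (\<otimes>\<^bsub>A\<^esub>) (\<Delta> a) b \<oplus>\<^bsub>tensor K A A\<^esub> lmul K A A (\<otimes>\<^bsub>A\<^esub>) a (\<delta>\<^sub>1 b)"
    and comult_mult_2: "\<lbrakk>a \<in> carrier A; b \<in> carrier A\<rbrakk> \<Longrightarrow> \<Delta> (a \<otimes>\<^bsub>A\<^esub> b) =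
      lmul K A A (\<otimes>\<^bsub>A\<^esub>) a (\<Delta> b) \<oplus>\<^bsub>tensor K A A\<^esub> rmul K A A (\<otimes>\<^bsub>A\<^esub>) (\<delta>\<^sub>2 a) b"

locale right_covariant_module =
  covariant_bialgebra K A \<delta>\<^sub>1 \<delta>\<^sub>2 \<Delta> + right_alg_module K A M act
  for K :: "('k, 'x) ring_scheme" (structure) and A :: "('k, 'a, 'y) module_scheme" (structure)
    and \<delta>\<^sub>1 \<delta>\<^sub>2 \<Delta> and M :: "('k, 'm, 'z) module_scheme" (structure) and act +
  fixes \<rho> :: "'m \<Rightarrow> ('m \<times> 'a \<Rightarrow> 'k) set"
  assumes coaction_linear: "linear_map K M (tensor K M A) \<rho>"
    and coaction_coassoc: "m \<in> carrier M \<Longrightarrow>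
      tensor_assoc K M A A (tensor_map K (tensor K M A) A \<rho> (\<lambda>x. x) (\<rho> m)) =
      tensor_map K M (tensor K A A) (\<lambda>x. x) \<Delta> (\<rho> m)"
    and coaction_act: "\<lbrakk>m \<in> carrier M; a \<in> carrier A\<rbrakk> \<Longrightarrow> \<rho> (act m a) =
      rmul K M A (\<otimes>\<^bsub>A\<^esub>) (\<rho> m) a \<oplus>\<^bsub>tensor K M A\<^esub> lmul K M A act m (\<delta>\<^sub>1 a)"

locale left_covariant_module =
  covariant_bialgebra K A \<delta>\<^sub>1 \<delta>\<^sub>2 \<Delta> + left_alg_module K A N act
  for K :: "('k, 'x) ring_scheme" (structure) and A :: "('k, 'a, 'y) module_scheme" (structure)
    and \<delta>\<^sub>1 \<delta>\<^sub>2 \<Delta> and N :: "('k, 'n, 'z) module_scheme" (structure) and act +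
  fixes \<rho> :: "'n \<Rightarrow> ('a \<times> 'n \<Rightarrow> 'k) set"
  assumes coaction_linear: "linear_map K N (tensor K A N) \<rho>"
    and coaction_coassoc: "n \<in> carrier N \<Longrightarrow>
      tensor_map K A (tensor K A N) (\<lambda>x. x) \<rho> (\<rho> n) =
      tensor_assoc K A A N (tensor_map K (tensor K A A) N \<Delta> (\<lambda>x. x) (\<rho> n))"
    and coaction_act: "\<lbrakk>a \<in> carrier A; n \<in> carrier N\<rbrakk> \<Longrightarrow> \<rho> (act a n) =
      lmul K A N (\<otimes>\<^bsub>A\<^esub>) a (\<rho> n) \<oplus>\<^bsub>tensor K A N\<^esub> rmul K A N act (\<delta>\<^sub>2 a) n"

definition inner_derivation ::
  "('k, 'x) ring_scheme \<Rightarrow> ('k, 'a, 'y) module_scheme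
    \<Rightarrow> ('a \<times> 'a \<Rightarrow> 'k) set \<Rightarrow> 'a \<Rightarrow> ('a \<times> 'a \<Rightarrow> 'k) set"
  where "inner_derivation K A r a =
    lmul K A A (\<otimes>\<^bsub>A\<^esub>) a r \<ominus>\<^bsub>tensor K A A\<^esub> rmul K A A (\<otimes>\<^bsub>A\<^esub>) r a"

definition quasitriangular_comult ::
  "('k, 'x) ring_scheme \<Rightarrow> ('k, 'a, 'y) module_scheme
    \<Rightarrow> ('a \<times> 'a \<Rightarrow> 'k) set \<Rightarrow> ('a \<times> 'a \<Rightarrow> 'k) set \<Rightarrow> 'a \<Rightarrow> ('a \<times> 'a \<Rightarrow> 'k) set"
  where "quasitriangular_comult K A r s a =
    lmul K A A (\<otimes>\<^bsub>A\<^esub>) a r \<ominus>\<^bsub>tensor K A A\<^esub> rmul K A A (\<otimes>\<^bsub>A\<^esub>) s a"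

end

theory Submission
  imports Defs
begin

text \<open>
  Write \<open>r = \<Sum> a\<^sub>i \<otimes> b\<^sub>i\<close> and \<open>s = \<Sum> c\<^sub>j \<otimes> d\<^sub>j\<close>. For the coaction \<open>m \<mapsto> mr\<close>, the two sides of
  coassociativity are \<open>m (r\<^sub>1\<^sub>3 r\<^sub>1\<^sub>2)\<close> and \<open>m (r\<^sub>1\<^sub>2 r\<^sub>2\<^sub>3 - s\<^sub>2\<^sub>3 r\<^sub>1\<^sub>3)\<close>, so they agree by the first
  Yang-Baxter equation; for \<open>n \<mapsto> -sn\<close> they are \<open>(s\<^sub>2\<^sub>3 s\<^sub>1\<^sub>3) n\<close> and \<open>(s\<^sub>1\<^sub>2 s\<^sub>2\<^sub>3 - s\<^sub>1\<^sub>3 r\<^sub>1\<^sub>2) n\<close>, which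
  agree by the second. Coassociativity of \<open>\<Delta> a = ar - sa\<close> uses both equations, acting with \<open>a\<close> on the
  first and on the last tensor factor; the mixed terms \<open>\<Sum> c\<^sub>j \<otimes> d\<^sub>j a a\<^sub>i \<otimes> b\<^sub>i\<close> occur on both sides. Every element
  of a tensor product is a finite sum of pure tensors, so all identities reduce to finite sums.
\<close>

section \<open>Linear and bilinear maps, finite sums\<close>

text \<open>The obstacle is the identity \<open>e\<close> in \<open>yang_baxter_eqs\<close>: the
  equations live over \<open>A\<close> or over its unitization, while modules over \<open>A\<close>
  need not be unital, so nothing acts by \<open>e\<close>. It disappears because in each of the
  products r13 r12, r12 r23, s23 r13 and their analogues every tensor leg contains at most one
  factor \<open>e\<close>. After multiplication all legs lie in the image of \<open>A\<close>, and a
  linear retraction onto \<open>A\<close> (the identity, or \<open>snd\<close> on K \<oplus> A)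
  yields an equation in \<open>A\<close> alone. To act by m is then to apply the linear map a
  \<mapsto> ma to the first leg of that equation, which carries it from A \<otimes> A \<otimes> A to
  M \<otimes> A \<otimes> A; to act by n is the same on the last leg. The bialgebra axioms are part
  of both covariant module notions and are proved as well; there the transported equations are used
  for \<open>A\<close> as a module over itself. Tensors are cosets and \<open>tensor_lift\<close>
  evaluates an arbitrarily chosen representative, so computations with it rest on the universal
  property.\<close>

lemma linear_mapI:
  assumes "\<And>v. v \<in> carrier V \<Longrightarrow> f v \<in> carrier W"
    and "\<And>u v. \<lbrakk>u \<in> carrier V; v \<in> carrier V\<rbrakk> \<Longrightarrow> f (u \<oplus>\<^bsub>V\<^esub> v) = f u \<oplus>\<^bsub>W\<^esub> f v"
    and "\<And>c v. \<lbrakk>c \<in> carrier K; v \<in> carrier V\<rbrakk> \<Longrightarrow> f (c \<odot>\<^bsub>V\<^esub> v) = c \<odot>\<^bsub>W\<^esub> f v"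
  shows "linear_map K V W f"
  using assms by (auto simp: linear_map_def)

lemma
  assumes "linear_map K V W f"
  shows linear_map_closed: "v \<in> carrier V \<Longrightarrow> f v \<in> carrier W"
    and linear_map_add: "\<lbrakk>u \<in> carrier V; v \<in> carrier V\<rbrakk> \<Longrightarrow> f (u \<oplus>\<^bsub>V\<^esub> v) = f u \<oplus>\<^bsub>W\<^esub> f v"
    and linear_map_smult: "\<lbrakk>c \<in> carrier K; v \<in> carrier V\<rbrakk> \<Longrightarrow> f (c \<odot>\<^bsub>V\<^esub> v) = c \<odot>\<^bsub>W\<^esub> f v"
  using assms by (auto simp: linear_map_def)

text \<open>\<open>linear_map\<close> has no clause for zero; preservation follows from homogeneity,
  zero being its own multiple by the zero scalar.\<close>

lemma linear_map_zero:
  assumes "linear_map K V W f" "module K V" "module K W"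
  shows "f \<zero>\<^bsub>V\<^esub> = \<zero>\<^bsub>W\<^esub>"
proof -
  interpret V: module K V by fact
  interpret W: module K W by fact
  have "f (\<zero>\<^bsub>K\<^esub> \<odot>\<^bsub>V\<^esub> \<zero>\<^bsub>V\<^esub>) = \<zero>\<^bsub>K\<^esub> \<odot>\<^bsub>W\<^esub> f \<zero>\<^bsub>V\<^esub>"
    by (rule linear_map_smult[OF assms(1)]) auto
  then show ?thesis
    using linear_map_closed[OF assms(1) V.zero_closed] by simp
qed

lemma linear_map_minus:
  assumes "linear_map K V W f" "module K V" "module K W" "u \<in> carrier V" "v \<in> carrier V"
  shows "f (u \<ominus>\<^bsub>V\<^esub> v) = f u \<ominus>\<^bsub>W\<^esub> f v"
proof -
  interpret V: module K V by fact
  interpret W: module K W by fact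
  have inv: "\<ominus>\<^bsub>K\<^esub> \<one>\<^bsub>K\<^esub> \<in> carrier K" by simp
  have "f (u \<ominus>\<^bsub>V\<^esub> v) = f (u \<oplus>\<^bsub>V\<^esub> (\<ominus>\<^bsub>K\<^esub> \<one>\<^bsub>K\<^esub>) \<odot>\<^bsub>V\<^esub> v)"
    using assms(4,5) V.smult_l_minus[OF V.R.one_closed] by (simp add: V.M.minus_eq)
  also have "\<dots> = f u \<oplus>\<^bsub>W\<^esub> (\<ominus>\<^bsub>K\<^esub> \<one>\<^bsub>K\<^esub>) \<odot>\<^bsub>W\<^esub> f v"
    using assms(4,5) linear_map_add[OF assms(1)] linear_map_smult[OF assms(1) inv] by simp
  also have "\<dots> = f u \<ominus>\<^bsub>W\<^esub> f v"
    using linear_map_closed[OF assms(1,5)] W.smult_l_minus[OF V.R.one_closed]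
    by (simp add: W.M.minus_eq)
  finally show ?thesis .
qed

lemma linear_map_id: "linear_map K V V (\<lambda>v. v)"
  by (simp add: linear_map_def)

lemma linear_map_comp:
  assumes "linear_map K U V f" "linear_map K V W g"
  shows "linear_map K U W (\<lambda>u. g (f u))"
  using assms by (auto simp: linear_map_def Pi_def)

lemma linear_map_diff:
  assumes "linear_map K V W f" "linear_map K V W g" "module K V" "module K W"
  shows "linear_map K V W (\<lambda>v. f v \<ominus>\<^bsub>W\<^esub> g v)"
proof -
  interpret V: module K V by fact
  interpret W: module K W by fact
  note cl = linear_map_closed[OF assms(1)] linear_map_closed[OF assms(2)]
  show ?thesis
    by (rule linear_mapI)
      (use cl in \<open>simp_all add: linear_map_add[OF assms(1)] linear_map_add[OF assms(2)]
        linear_map_smult[OF assms(1)] linear_map_smult[OF assms(2)]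
        W.M.minus_eq W.M.minus_add W.M.a_ac W.smult_r_distr W.smult_r_minus\<close>)
qed

lemma linear_map_uminus:
  assumes "linear_map K V W f" "module K V" "module K W"
  shows "linear_map K V W (\<lambda>v. \<ominus>\<^bsub>W\<^esub> f v)"
proof -
  interpret V: module K V by fact
  interpret W: module K W by fact
  note cl = linear_map_closed[OF assms(1)]
  show ?thesis
    by (rule linear_mapI)
      (use cl in \<open>simp_all add: linear_map_add[OF assms(1)]
        linear_map_smult[OF assms(1)] W.M.minus_add W.smult_r_minus\<close>)
qed

definition bilinear_map ::
  "('k, 'x) ring_scheme \<Rightarrow> ('k, 'v, 'y) module_scheme \<Rightarrow> ('k, 'w, 'z) module_scheme
    \<Rightarrow> ('k, 'u, 't) module_scheme \<Rightarrow> ('v \<Rightarrow> 'w \<Rightarrow> 'u) \<Rightarrow> bool"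
  where "bilinear_map K V W U f \<longleftrightarrow>
    (\<forall>w\<in>carrier W. linear_map K V U (\<lambda>v. f v w)) \<and> (\<forall>v\<in>carrier V. linear_map K W U (f v))"

lemma bilinear_mapI:
  assumes "\<And>w. w \<in> carrier W \<Longrightarrow> linear_map K V U (\<lambda>v. f v w)"
    and "\<And>v. v \<in> carrier V \<Longrightarrow> linear_map K W U (f v)"
  shows "bilinear_map K V W U f"
  using assms by (simp add: bilinear_map_def)

lemma
  assumes "bilinear_map K V W U f"
  shows bilinear_map_left: "w \<in> carrier W \<Longrightarrow> linear_map K V U (\<lambda>v. f v w)"
    and bilinear_map_right: "v \<in> carrier V \<Longrightarrow> linear_map K W U (f v)"
  using assms by (simp_all add: bilinear_map_def)

lemma bilinear_map_closed:
  assumes "bilinear_map K V W U f" "v \<in> carrier V" "w \<in> carrier W"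
  shows "f v w \<in> carrier U"
  using linear_map_closed[OF bilinear_map_right[OF assms(1,2)] assms(3)] .

text \<open>Most maps that are lifted later (tensor products of maps, the embeddings
  \<open>t12\<close> and \<open>t13\<close>, the inner map of the tensor algebra product) are
  \<open>pure_tensor\<close> with linear maps plugged in; their bilinearity comes from here.\<close>

lemma bilinear_map_comp:
  assumes "bilinear_map K V W U f" "linear_map K V' V g" "linear_map K W' W h" "linear_map K U U' l"
  shows "bilinear_map K V' W' U' (\<lambda>v w. l (f (g v) (h w)))"
proof (rule bilinear_mapI)
  fix w assume "w \<in> carrier W'"
  then show "linear_map K V' U' (\<lambda>v. l (f (g v) (h w)))"
    using linear_map_comp[OF linear_map_comp[OF assms(2) bilinear_map_left[OF assms(1)]] assms(4)]
      linear_map_closed[OF assms(3)] by simp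
next
  fix v assume "v \<in> carrier V'"
  then show "linear_map K W' U' (\<lambda>w. l (f (g v) (h w)))"
    using linear_map_comp[OF linear_map_comp[OF assms(3) bilinear_map_right[OF assms(1)]] assms(4)]
      linear_map_closed[OF assms(2)] by simp
qed

text \<open>Lists rather than finite sets index the sums: the same pure tensor may occur several
  times, and inductions need neither finiteness nor distinctness.\<close>

definition list_sum :: "('g, 'y) ring_scheme \<Rightarrow> ('b \<Rightarrow> 'g) \<Rightarrow> 'b list \<Rightarrow> 'g"
  where "list_sum G f xs = foldr (\<lambda>x s. f x \<oplus>\<^bsub>G\<^esub> s) xs \<zero>\<^bsub>G\<^esub>"

lemma list_sum_simps [simp]:
  "list_sum G f [] = \<zero>\<^bsub>G\<^esub>"
  "list_sum G f (x # xs) = f x \<oplus>\<^bsub>G\<^esub> list_sum G f xs"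
  by (simp_all add: list_sum_def)

lemma list_sum_cong:
  "xs = ys \<Longrightarrow> (\<And>x. x \<in> set ys \<Longrightarrow> f x = g x) \<Longrightarrow> list_sum G f xs = list_sum G g ys"
  by (induction xs arbitrary: ys) auto

context abelian_group
begin

lemma list_sum_closed:
  "(\<And>x. x \<in> set xs \<Longrightarrow> f x \<in> carrier G) \<Longrightarrow> list_sum G f xs \<in> carrier G"
  by (induction xs) auto

lemma list_sum_add:
  assumes "\<And>x. x \<in> set xs \<Longrightarrow> f x \<in> carrier G" "\<And>x. x \<in> set xs \<Longrightarrow> g x \<in> carrier G"
  shows "list_sum G (\<lambda>x. f x \<oplus> g x) xs = list_sum G f xs \<oplus> list_sum G g xs"
  using assms by (induction xs) (auto simp: list_sum_closed a_ac)

lemma list_sum_diff: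
  assumes "\<And>x. x \<in> set xs \<Longrightarrow> f x \<in> carrier G" "\<And>x. x \<in> set xs \<Longrightarrow> g x \<in> carrier G"
  shows "list_sum G (\<lambda>x. f x \<ominus> g x) xs = list_sum G f xs \<ominus> list_sum G g xs"
  using assms
proof (induction xs)
  case Nil
  have "\<zero> \<ominus> \<zero> = \<zero>"
    unfolding minus_eq by (rule r_neg) simp
  then show ?case by simp
next
  case (Cons x xs)
  then show ?case by (simp add: list_sum_closed minus_eq minus_add a_ac)
qed

lemma list_sum_zero: "list_sum G (\<lambda>x. \<zero>) xs = \<zero>"
  by (induction xs) auto

text \<open>Reconciles the order of summation: expanding a product such as s23 r13 puts the sum over
  s outside, whereas applying a comultiplication to a sum over r puts the sum over r
  outside.\<close>

lemma list_sum_swap: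
  assumes "\<And>x y. \<lbrakk>x \<in> set xs; y \<in> set ys\<rbrakk> \<Longrightarrow> f x y \<in> carrier G"
  shows "list_sum G (\<lambda>x. list_sum G (\<lambda>y. f x y) ys) xs = list_sum G (\<lambda>y. list_sum G (\<lambda>x. f x y) xs) ys"
  using assms by (induction xs) (auto simp: list_sum_zero list_sum_add list_sum_closed)

end

lemma linear_map_list_sum:
  assumes "linear_map K V W h" "module K V" "module K W" "\<And>x. x \<in> set xs \<Longrightarrow> f x \<in> carrier V"
  shows "h (list_sum V f xs) = list_sum W (\<lambda>x. h (f x)) xs"
proof -
  interpret V: module K V by fact
  show ?thesis
    using assms(4)
    by (induction xs)
      (simp_all add: linear_map_zero[OF assms(1-3)] linear_map_add[OF assms(1)] V.M.list_sum_closed)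
qed

text \<open>What makes lifts linear in a parameter: over a fixed sum of pure tensors a lift is a
  finite sum of maps, each linear in that parameter.\<close>

lemma linear_map_list_sum_fun:
  assumes "module K V" "module K W" "\<And>x. x \<in> set xs \<Longrightarrow> linear_map K V W (f x)"
  shows "linear_map K V W (\<lambda>v. list_sum W (\<lambda>x. f x v) xs)"
proof -
  interpret V: module K V by fact
  interpret W: module K W by fact
  have cl: "\<And>x v. x \<in> set xs \<Longrightarrow> v \<in> carrier V \<Longrightarrow> f x v \<in> carrier W"
    using linear_map_closed[OF assms(3)] .
  show ?thesis
  proof (rule linear_mapI)
    fix v assume "v \<in> carrier V"
    then show "list_sum W (\<lambda>x. f x v) xs \<in> carrier W"
      by (simp add: cl W.M.list_sum_closed)
  next
    fix u v assume "u \<in> carrier V" "v \<in> carrier V"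
    then show "list_sum W (\<lambda>x. f x (u \<oplus>\<^bsub>V\<^esub> v)) xs
        = list_sum W (\<lambda>x. f x u) xs \<oplus>\<^bsub>W\<^esub> list_sum W (\<lambda>x. f x v) xs"
      by (simp add: cl linear_map_add[OF assms(3)] flip: W.M.list_sum_add cong: list_sum_cong)
  next
    fix c v assume c: "c \<in> carrier K" and v: "v \<in> carrier V"
    \<comment> \<open>The induction runs over a list \<open>ys\<close> contained in
      \<open>xs\<close>, since linearity of \<open>f x\<close> is known for members of
      \<open>xs\<close> and must survive the passage to the tail.\<close>
    have *: "set ys \<subseteq> set xs \<Longrightarrow>
        list_sum W (\<lambda>x. f x (c \<odot>\<^bsub>V\<^esub> v)) ys = c \<odot>\<^bsub>W\<^esub> list_sum W (\<lambda>x. f x v) ys" for ys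
      by (induction ys)
        (use c v in \<open>auto simp: cl linear_map_smult[OF assms(3)] W.smult_r_distr
          W.M.list_sum_closed subset_iff\<close>)
    show "list_sum W (\<lambda>x. f x (c \<odot>\<^bsub>V\<^esub> v)) xs = c \<odot>\<^bsub>W\<^esub> list_sum W (\<lambda>x. f x v) xs"
      by (rule *) simp
  qed
qed

lemma linear_map_list_sum2:
  assumes "linear_map K V W h" "module K V" "module K W"
    and "\<And>x y. \<lbrakk>x \<in> set us; y \<in> set vs\<rbrakk> \<Longrightarrow> f x y \<in> carrier V"
  shows "h (list_sum V (\<lambda>x. list_sum V (f x) vs) us) = list_sum W (\<lambda>x. list_sum W (\<lambda>y. h (f x y)) vs) us"
proof -
  interpret V: module K V by fact
  have "h (list_sum V (\<lambda>x. list_sum V (f x) vs) us) = list_sum W (\<lambda>x. h (list_sum V (f x) vs)) us"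
    by (rule linear_map_list_sum[OF assms(1-3)]) (intro V.M.list_sum_closed assms(4))
  also have "\<dots> = list_sum W (\<lambda>x. list_sum W (\<lambda>y. h (f x y)) vs) us"
    by (intro list_sum_cong refl linear_map_list_sum[OF assms])
  finally show ?thesis .
qed

lemma linear_map_a_inv:
  assumes "linear_map K V W f" "module K V" "module K W" "v \<in> carrier V"
  shows "f (\<ominus>\<^bsub>V\<^esub> v) = \<ominus>\<^bsub>W\<^esub> f v"
proof -
  interpret V: module K V by fact
  interpret W: module K W by fact
  show ?thesis
    using linear_map_minus[OF assms(1-3) V.M.zero_closed assms(4)] linear_map_closed[OF assms(1,4)]
      linear_map_zero[OF assms(1-3)] assms(4) by (simp add: V.M.minus_eq W.M.minus_eq)
qed

text \<open>Both Yang-Baxter equations have the shape x - y + z = 0; solving for x before applying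
  the map gives the form in which coassociativity uses them.\<close>

lemma linear_map_solve:
  assumes "linear_map K V W f" "module K V" "module K W"
    and "x \<in> carrier V" "y \<in> carrier V" "z \<in> carrier V" "(x \<ominus>\<^bsub>V\<^esub> y) \<oplus>\<^bsub>V\<^esub> z = \<zero>\<^bsub>V\<^esub>"
  shows "f x = f y \<ominus>\<^bsub>W\<^esub> f z"
proof -
  interpret V: module K V by fact
  have "x = ((x \<ominus>\<^bsub>V\<^esub> y) \<oplus>\<^bsub>V\<^esub> z) \<oplus>\<^bsub>V\<^esub> (y \<ominus>\<^bsub>V\<^esub> z)"
    using assms(4-6) by (simp add: V.M.minus_eq V.M.a_ac V.M.r_neg1 V.M.r_neg2 V.M.r_neg)
  then have "x = y \<ominus>\<^bsub>V\<^esub> z"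
    using assms(4-7) by simp
  then show ?thesis
    by (simp add: linear_map_minus[OF assms(1-3,5,6)])
qed

section \<open>The universal property of the tensor product\<close>

definition supp :: "('k, 'x) ring_scheme \<Rightarrow> ('b \<Rightarrow> 'k) \<Rightarrow> 'b set"
  where "supp K p = {x. p x \<noteq> \<zero>\<^bsub>K\<^esub>}"

lemma free_module_carrier:
  "p \<in> carrier (free_module K X) \<longleftrightarrow>
    (\<forall>x\<in>X. p x \<in> carrier K) \<and> (\<forall>x. x \<notin> X \<longrightarrow> p x = \<zero>\<^bsub>K\<^esub>) \<and> finite (supp K p)"
  by (simp add: free_module_def supp_def)

lemma free_module_ops:
  "\<zero>\<^bsub>free_module K X\<^esub> = (\<lambda>_. \<zero>\<^bsub>K\<^esub>)"
  "p \<oplus>\<^bsub>free_module K X\<^esub> q = (\<lambda>x. p x \<oplus>\<^bsub>K\<^esub> q x)"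
  "c \<odot>\<^bsub>free_module K X\<^esub> p = (\<lambda>x. c \<otimes>\<^bsub>K\<^esub> p x)"
  by (simp_all add: free_module_def)

context cring
begin

text \<open>Holds at every point, since outside \<open>X\<close> the value is the zero
  scalar.\<close>

lemma free_module_apply_closed: "p \<in> carrier (free_module R X) \<Longrightarrow> p x \<in> carrier R"
  by (cases "x \<in> X") (auto simp: free_module_carrier)

lemma free_module_add_closed:
  assumes "p \<in> carrier (free_module R X)" "q \<in> carrier (free_module R X)"
  shows "(\<lambda>x. p x \<oplus> q x) \<in> carrier (free_module R X)"
proof -
  have "supp R (\<lambda>x. p x \<oplus> q x) \<subseteq> supp R p \<union> supp R q"
    by (auto simp: supp_def)
  then show ?thesis
    using assms by (auto simp: free_module_carrier intro: finite_subset)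
qed

lemma free_module_smult_closed:
  assumes "c \<in> carrier R" "p \<in> carrier (free_module R X)"
  shows "(\<lambda>x. c \<otimes> p x) \<in> carrier (free_module R X)"
proof -
  have "supp R (\<lambda>x. c \<otimes> p x) \<subseteq> supp R p"
    using assms(1) by (auto simp: supp_def)
  then show ?thesis
    using assms by (auto simp: free_module_carrier intro: finite_subset)
qed

lemma free_module: "module R (free_module R X)"
proof (rule moduleI)
  show "cring R" by (rule is_cring)
  note cl = free_module_apply_closed[where X = X]
  show "abelian_group (free_module R X)"
  proof (rule abelian_groupI)
    fix p q assume "p \<in> carrier (free_module R X)" "q \<in> carrier (free_module R X)"
    then show "p \<oplus>\<^bsub>free_module R X\<^esub> q \<in> carrier (free_module R X)"
      by (simp add: free_module_ops free_module_add_closed)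
    show "p \<oplus>\<^bsub>free_module R X\<^esub> q = q \<oplus>\<^bsub>free_module R X\<^esub> p"
      unfolding free_module_ops using cl[OF \<open>p \<in> _\<close>] cl[OF \<open>q \<in> _\<close>] by (intro ext a_comm)
  next
    fix p q t
    assume "p \<in> carrier (free_module R X)" "q \<in> carrier (free_module R X)" "t \<in> carrier (free_module R X)"
    then show "p \<oplus>\<^bsub>free_module R X\<^esub> q \<oplus>\<^bsub>free_module R X\<^esub> t
        = p \<oplus>\<^bsub>free_module R X\<^esub> (q \<oplus>\<^bsub>free_module R X\<^esub> t)"
      using cl by (auto simp: free_module_ops a_assoc)
  next
    fix p assume p: "p \<in> carrier (free_module R X)"
    then show "\<zero>\<^bsub>free_module R X\<^esub> \<oplus>\<^bsub>free_module R X\<^esub> p = p"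
      using cl by (auto simp: free_module_ops)
    \<comment> \<open>The negative of \<open>p\<close> is taken as its multiple by -1, so that
      finiteness of its support comes from closure under scalars.\<close>
    have "(\<lambda>x. \<ominus> \<one> \<otimes> p x) \<in> carrier (free_module R X)"
      by (rule free_module_smult_closed[OF _ p]) simp
    moreover have "(\<lambda>x. \<ominus> \<one> \<otimes> p x \<oplus> p x) = (\<lambda>x. \<zero>)"
      using cl[OF p] by (auto simp: l_minus l_neg)
    ultimately show "\<exists>q\<in>carrier (free_module R X). q \<oplus>\<^bsub>free_module R X\<^esub> p = \<zero>\<^bsub>free_module R X\<^esub>"
      by (intro bexI[of _ "\<lambda>x. \<ominus> \<one> \<otimes> p x"]) (auto simp: free_module_ops)
  qed (simp add: free_module_carrier free_module_ops supp_def)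
qed (auto simp: free_module_ops free_module_smult_closed free_module_apply_closed
    l_distr r_distr m_assoc)

lemma free_gen_closed: "x \<in> X \<Longrightarrow> free_gen R x \<in> carrier (free_module R X)"
  by (auto simp: free_module_carrier free_gen_def supp_def)

end

text \<open>The linear extension of \<open>g\<close> to formal combinations: the formula of
  \<open>tensor_lift\<close> for a given representative, before passing to the quotient.\<close>

definition free_eval ::
  "('k, 'x) ring_scheme \<Rightarrow> ('k, 'u, 'y) module_scheme \<Rightarrow> ('b \<Rightarrow> 'u) \<Rightarrow> ('b \<Rightarrow> 'k) \<Rightarrow> 'u"
  where "free_eval K U g p = (\<Oplus>\<^bsub>U\<^esub>z\<in>supp K p. p z \<odot>\<^bsub>U\<^esub> g z)"

text \<open>Supports of sums and multiples can shrink by cancellation. Linearity is therefore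
  checked on a common finite index set, where the additional terms vanish.\<close>

lemma free_eval_superset:
  assumes "module K U" "\<And>z. z \<in> X \<Longrightarrow> g z \<in> carrier U" "p \<in> carrier (free_module K X)"
    and "finite S" "supp K p \<subseteq> S" "S \<subseteq> X"
  shows "free_eval K U g p = (\<Oplus>\<^bsub>U\<^esub>z\<in>S. p z \<odot>\<^bsub>U\<^esub> g z)"
proof -
  interpret U: module K U by fact
  have "p z \<in> carrier K" for z
    using assms(3) by (rule U.R.free_module_apply_closed)
  then show ?thesis
    unfolding free_eval_def using assms
    by (intro U.M.add.finprod_mono_neutral_cong_left) (auto simp: supp_def)
qed

lemma free_eval_linear:
  assumes "module K U" "\<And>z. z \<in> X \<Longrightarrow> g z \<in> carrier U"
  shows "linear_map K (free_module K X) U (free_eval K U g)"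
proof -
  interpret U: module K U by fact
  have sub: "supp K p \<subseteq> X" if "p \<in> carrier (free_module K X)" for p
    using that by (auto simp: free_module_carrier supp_def)
  have fin: "finite (supp K p)" if "p \<in> carrier (free_module K X)" for p
    using that by (auto simp: free_module_carrier)
  note cl = U.R.free_module_apply_closed
  show ?thesis
  proof (rule linear_mapI)
    fix p assume p: "p \<in> carrier (free_module K X)"
    then show "free_eval K U g p \<in> carrier U"
      unfolding free_eval_def using sub[OF p] assms(2) cl[OF p]
      by (intro U.M.finsum_closed) auto
  next
    fix p q assume p: "p \<in> carrier (free_module K X)" and q: "q \<in> carrier (free_module K X)"
    let ?S = "supp K p \<union> supp K q"
    have pq: "(\<lambda>x. p x \<oplus>\<^bsub>K\<^esub> q x) \<in> carrier (free_module K X)"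
      using p q by (rule U.R.free_module_add_closed)
    have S: "finite ?S" "?S \<subseteq> X" "supp K (\<lambda>x. p x \<oplus>\<^bsub>K\<^esub> q x) \<subseteq> ?S"
      using sub[OF p] sub[OF q] fin[OF p] fin[OF q] by (auto simp: supp_def)
    have "free_eval K U g (\<lambda>x. p x \<oplus>\<^bsub>K\<^esub> q x) = (\<Oplus>\<^bsub>U\<^esub>z\<in>?S. (p z \<oplus>\<^bsub>K\<^esub> q z) \<odot>\<^bsub>U\<^esub> g z)"
      by (rule free_eval_superset[OF assms pq]) (use S in auto)
    also have "\<dots> = (\<Oplus>\<^bsub>U\<^esub>z\<in>?S. p z \<odot>\<^bsub>U\<^esub> g z \<oplus>\<^bsub>U\<^esub> q z \<odot>\<^bsub>U\<^esub> g z)"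
      using S assms(2) cl[OF p] cl[OF q]
      by (intro U.M.finsum_cong') (auto simp: U.smult_l_distr)
    also have "\<dots> = (\<Oplus>\<^bsub>U\<^esub>z\<in>?S. p z \<odot>\<^bsub>U\<^esub> g z) \<oplus>\<^bsub>U\<^esub> (\<Oplus>\<^bsub>U\<^esub>z\<in>?S. q z \<odot>\<^bsub>U\<^esub> g z)"
      using S assms(2) cl[OF p] cl[OF q] by (intro U.M.finsum_addf) auto
    also have "(\<Oplus>\<^bsub>U\<^esub>z\<in>?S. p z \<odot>\<^bsub>U\<^esub> g z) = free_eval K U g p"
      by (rule free_eval_superset[OF assms p, symmetric]) (use S in auto)
    also have "(\<Oplus>\<^bsub>U\<^esub>z\<in>?S. q z \<odot>\<^bsub>U\<^esub> g z) = free_eval K U g q"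
      by (rule free_eval_superset[OF assms q, symmetric]) (use S in auto)
    finally show "free_eval K U g (p \<oplus>\<^bsub>free_module K X\<^esub> q)
        = free_eval K U g p \<oplus>\<^bsub>U\<^esub> free_eval K U g q"
      by (simp add: free_module_ops)
  next
    fix c p assume c: "c \<in> carrier K" and p: "p \<in> carrier (free_module K X)"
    have cp: "(\<lambda>x. c \<otimes>\<^bsub>K\<^esub> p x) \<in> carrier (free_module K X)"
      using c p by (rule U.R.free_module_smult_closed)
    have "free_eval K U g (\<lambda>x. c \<otimes>\<^bsub>K\<^esub> p x) = (\<Oplus>\<^bsub>U\<^esub>z\<in>supp K p. (c \<otimes>\<^bsub>K\<^esub> p z) \<odot>\<^bsub>U\<^esub> g z)"
      by (rule free_eval_superset[OF assms cp])
        (use sub[OF p] fin[OF p] c in \<open>auto simp: supp_def\<close>)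
    also have "\<dots> = (\<Oplus>\<^bsub>U\<^esub>z\<in>supp K p. c \<odot>\<^bsub>U\<^esub> (p z \<odot>\<^bsub>U\<^esub> g z))"
      using sub[OF p] assms(2) cl[OF p] c
      by (intro U.M.finsum_cong') (auto simp: U.smult_assoc1)
    also have "\<dots> = c \<odot>\<^bsub>U\<^esub> free_eval K U g p"
      unfolding free_eval_def using sub[OF p] fin[OF p] assms(2) cl[OF p] c
      by (intro U.finsum_smult_ldistr[symmetric]) auto
    finally show "free_eval K U g (c \<odot>\<^bsub>free_module K X\<^esub> p) = c \<odot>\<^bsub>U\<^esub> free_eval K U g p"
      by (simp add: free_module_ops)
  qed
qed

lemma free_eval_gen:
  assumes "module K U" "\<And>z. z \<in> X \<Longrightarrow> g z \<in> carrier U" "x \<in> X"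
  shows "free_eval K U g (free_gen K x) = g x"
proof -
  interpret U: module K U by fact
  have "free_eval K U g (free_gen K x) = (\<Oplus>\<^bsub>U\<^esub>z\<in>{x}. free_gen K x z \<odot>\<^bsub>U\<^esub> g z)"
    by (rule free_eval_superset[OF assms(1,2) U.R.free_gen_closed])
      (use assms(3) in \<open>auto simp: supp_def free_gen_def\<close>)
  also have "\<dots> = g x"
    using assms(2,3) by (simp add: free_gen_def)
  finally show ?thesis .
qed

lemma free_module_induct:
  assumes "cring K" "p \<in> carrier (free_module K X)"
    and "P (\<lambda>_. \<zero>\<^bsub>K\<^esub>)"
    and step: "\<And>c x q. \<lbrakk>c \<in> carrier K; x \<in> X; q \<in> carrier (free_module K X); P q\<rbrakk>
      \<Longrightarrow> P (c \<odot>\<^bsub>free_module K X\<^esub> free_gen K x \<oplus>\<^bsub>free_module K X\<^esub> q)"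
  shows "P p"
proof -
  interpret K: cring K by fact
  have "finite (supp K p)"
    using assms(2) by (simp add: free_module_carrier)
  then show ?thesis
    using assms(2)
  proof (induction "supp K p" arbitrary: p rule: finite_induct)
    case empty
    then have "p = (\<lambda>_. \<zero>\<^bsub>K\<^esub>)" by (auto simp: supp_def)
    with assms(3) show ?case by simp
  next
    case (insert x S)
    \<comment> \<open>Deleting the value at \<open>x\<close> shrinks the support to
      \<open>S\<close>, and \<open>p\<close> is recovered by adding \<open>p x\<close> times the
      generator at \<open>x\<close>.\<close>
    define q where "q = p(x := \<zero>\<^bsub>K\<^esub>)"
    have x: "x \<in> X" and px: "\<And>z. p z \<in> carrier K"
      using insert.prems insert.hyps(4) K.free_module_apply_closed
      by (auto simp: free_module_carrier supp_def)
    have S: "S = supp K q"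
      using insert.hyps(2,4) by (auto simp: supp_def q_def)
    have q: "q \<in> carrier (free_module K X)"
      using insert.prems insert.hyps(1) S by (auto simp: free_module_carrier q_def)
    have "p = p x \<odot>\<^bsub>free_module K X\<^esub> free_gen K x \<oplus>\<^bsub>free_module K X\<^esub> q"
      using px by (auto simp: free_module_ops free_gen_def q_def)
    moreover have "P (p x \<odot>\<^bsub>free_module K X\<^esub> free_gen K x \<oplus>\<^bsub>free_module K X\<^esub> q)"
      by (rule step[OF px x q insert.hyps(3)[OF S q]])
    ultimately show ?case by simp
  qed
qed

section \<open>The tensor product as a quotient of the free module\<close>

locale module_pair = V: module K V + W: module K W
  for K :: "('k, 'x) ring_scheme" and V :: "('k, 'v, 'y) module_scheme" and W :: "('k, 'w, 'z) module_scheme"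
begin

abbreviation "F \<equiv> free_module K (carrier V \<times> carrier W)"
abbreviation "R \<equiv> tensor_rel K V W"
abbreviation "g v w \<equiv> free_gen K (v, w)"
abbreviation "T \<equiv> tensor K V W"

sublocale F: module K F
  by (rule V.R.free_module)

lemma tensor_gens_closed: "tensor_gens K V W \<subseteq> carrier F"
  by (auto simp: tensor_gens_def Let_def V.R.free_gen_closed)

text \<open>An intersection of submodules; the whole free module belongs to the family, which keeps
  the intersection inside the carrier.\<close>

lemma tensor_rel_submodule: "submodule R K F"
proof (rule F.submoduleI)
  have E: "H \<subseteq> carrier F" "\<zero>\<^bsub>F\<^esub> \<in> H" "\<And>a. a \<in> H \<Longrightarrow> \<ominus>\<^bsub>F\<^esub> a \<in> H"
    "\<And>a b. \<lbrakk>a \<in> carrier K; b \<in> H\<rbrakk> \<Longrightarrow> a \<odot>\<^bsub>F\<^esub> b \<in> H" "\<And>a b. \<lbrakk>a \<in> H; b \<in> H\<rbrakk> \<Longrightarrow> a \<oplus>\<^bsub>F\<^esub> b \<in> H"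
    if "submodule H K F" for H
    using F.submoduleE[OF that] subgroup.one_closed[OF submodule.axioms(1)[OF that]] by auto
  show "R \<subseteq> carrier F"
    unfolding tensor_rel_def using F.carrier_is_submodule tensor_gens_closed by blast
  show "\<zero>\<^bsub>F\<^esub> \<in> R" "\<And>a. a \<in> R \<Longrightarrow> \<ominus>\<^bsub>F\<^esub> a \<in> R"
    "\<And>a b. \<lbrakk>a \<in> carrier K; b \<in> R\<rbrakk> \<Longrightarrow> a \<odot>\<^bsub>F\<^esub> b \<in> R" "\<And>a b. \<lbrakk>a \<in> R; b \<in> R\<rbrakk> \<Longrightarrow> a \<oplus>\<^bsub>F\<^esub> b \<in> R"
    unfolding tensor_rel_def using E by auto
qed

lemma tensor_gens_rel: "tensor_gens K V W \<subseteq> R"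
  by (auto simp: tensor_rel_def)

sublocale R: abelian_subgroup R F
  using submodule.axioms(1)[OF tensor_rel_submodule] F.abelian_group_axioms
  by (intro abelian_subgroupI3 additive_subgroupI)

lemma coset_eq_iff:
  assumes "p \<in> carrier F" "q \<in> carrier F"
  shows "R +>\<^bsub>F\<^esub> p = R +>\<^bsub>F\<^esub> q \<longleftrightarrow> p \<ominus>\<^bsub>F\<^esub> q \<in> R"
proof
  assume "R +>\<^bsub>F\<^esub> p = R +>\<^bsub>F\<^esub> q"
  then have "R +>\<^bsub>F\<^esub> (p \<oplus>\<^bsub>F\<^esub> \<ominus>\<^bsub>F\<^esub> q) = R"
    by (rule F.a_coset_add_inv2) (use assms R.a_subset in auto)
  then show "p \<ominus>\<^bsub>F\<^esub> q \<in> R"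
    unfolding F.minus_eq by (rule F.a_coset_join1[OF _ _ R.a_subgroup]) (simp add: assms)
next
  assume "p \<ominus>\<^bsub>F\<^esub> q \<in> R"
  then have "p \<oplus>\<^bsub>F\<^esub> \<ominus>\<^bsub>F\<^esub> q \<in> R"
    by (simp only: F.minus_eq)
  then have "R +>\<^bsub>F\<^esub> (p \<oplus>\<^bsub>F\<^esub> \<ominus>\<^bsub>F\<^esub> q) = R"
    using assms by (intro F.a_coset_join2[OF _ R.a_subgroup]) simp_all
  then show "R +>\<^bsub>F\<^esub> p = R +>\<^bsub>F\<^esub> q"
    by (rule F.a_coset_add_inv1) (use assms R.a_subset in auto)
qed

lemma mem_coset: "q \<in> R +>\<^bsub>F\<^esub> p \<longleftrightarrow> (\<exists>h\<in>R. q = h \<oplus>\<^bsub>F\<^esub> p)"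
  by (auto simp: a_r_coset_def')

lemma tensor_carrier: "carrier T = (\<lambda>p. R +>\<^bsub>F\<^esub> p) ` carrier F"
  by (auto simp: tensor_def Let_def A_RCOSETS_def')

lemma tensor_zero: "\<zero>\<^bsub>T\<^esub> = R +>\<^bsub>F\<^esub> \<zero>\<^bsub>F\<^esub>"
  using F.a_coset_add_zero[OF R.a_subset] by (simp add: tensor_def Let_def)

lemma tensor_add:
  "\<lbrakk>p \<in> carrier F; q \<in> carrier F\<rbrakk> \<Longrightarrow> (R +>\<^bsub>F\<^esub> p) \<oplus>\<^bsub>T\<^esub> (R +>\<^bsub>F\<^esub> q) = R +>\<^bsub>F\<^esub> (p \<oplus>\<^bsub>F\<^esub> q)"
  using R.a_rcos_sum by (simp add: tensor_def Let_def)

text \<open>\<open>tensor\<close> forms a union over all representatives of a coset. For q = h + p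
  with h in \<open>R\<close>, also ch lies in \<open>R\<close>, so the cosets in the union all
  coincide.\<close>

lemma tensor_smult:
  assumes c: "c \<in> carrier K" and p: "p \<in> carrier F"
  shows "c \<odot>\<^bsub>T\<^esub> (R +>\<^bsub>F\<^esub> p) = R +>\<^bsub>F\<^esub> (c \<odot>\<^bsub>F\<^esub> p)"
proof -
  have "R +>\<^bsub>F\<^esub> (c \<odot>\<^bsub>F\<^esub> q) = R +>\<^bsub>F\<^esub> (c \<odot>\<^bsub>F\<^esub> p)" if q: "q \<in> R +>\<^bsub>F\<^esub> p" for q
  proof -
    obtain h where h: "h \<in> R" "q = h \<oplus>\<^bsub>F\<^esub> p" using q mem_coset by blast
    have hF: "h \<in> carrier F" using h(1) R.a_subset by blast
    have ch: "c \<odot>\<^bsub>F\<^esub> h \<in> R" using submodule.smult_closed[OF tensor_rel_submodule c h(1)] .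
    have "R +>\<^bsub>F\<^esub> (c \<odot>\<^bsub>F\<^esub> q) = (R +>\<^bsub>F\<^esub> (c \<odot>\<^bsub>F\<^esub> h)) +>\<^bsub>F\<^esub> (c \<odot>\<^bsub>F\<^esub> p)"
      using c p hF R.a_subset by (simp add: h(2) F.smult_r_distr F.a_coset_add_assoc)
    also have "R +>\<^bsub>F\<^esub> (c \<odot>\<^bsub>F\<^esub> h) = R"
      using c hF ch R.a_subgroup by (intro F.a_coset_join2) auto
    finally show ?thesis .
  qed
  then have "(\<Union>q\<in>R +>\<^bsub>F\<^esub> p. R +>\<^bsub>F\<^esub> (c \<odot>\<^bsub>F\<^esub> q)) = R +>\<^bsub>F\<^esub> (c \<odot>\<^bsub>F\<^esub> p)"
    by (intro UN_constant_eq[OF R.a_rcos_self[OF p]] ballI)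
  then show ?thesis
    by (simp only: tensor_def Let_def module.simps ring.simps)
qed

lemma tensor_module: "module K T"
proof (rule moduleI)
  show "cring K" by (rule V.R.is_cring)
  show "abelian_group T"
  proof (rule abelian_groupI)
    fix x assume "x \<in> carrier T"
    then obtain p where p: "p \<in> carrier F" "x = R +>\<^bsub>F\<^esub> p" by (auto simp: tensor_carrier)
    then have "(R +>\<^bsub>F\<^esub> (\<ominus>\<^bsub>F\<^esub> p)) \<oplus>\<^bsub>T\<^esub> x = \<zero>\<^bsub>T\<^esub>"
      by (simp add: tensor_add tensor_zero F.l_neg)
    with p show "\<exists>y\<in>carrier T. y \<oplus>\<^bsub>T\<^esub> x = \<zero>\<^bsub>T\<^esub>"
      by (auto simp: tensor_carrier)
  next
    show "\<zero>\<^bsub>T\<^esub> \<in> carrier T"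
      unfolding tensor_zero tensor_carrier by blast
  next
    fix x y assume "x \<in> carrier T" "y \<in> carrier T"
    then show "x \<oplus>\<^bsub>T\<^esub> y \<in> carrier T"
      by (auto simp: tensor_carrier tensor_add)
  qed (auto simp: tensor_carrier tensor_add tensor_zero F.a_ac)
qed (auto simp: tensor_carrier tensor_add tensor_smult F.smult_l_distr F.smult_r_distr F.smult_assoc1)

lemma pure_tensor_eq: "pure_tensor K V W v w = R +>\<^bsub>F\<^esub> g v w"
  by (simp add: pure_tensor_def)

text \<open>The four families in \<open>tensor_gens\<close> are the four laws of bilinearity written
  as differences, and two cosets are equal once the difference of representatives lies in
  \<open>R\<close>.\<close>

lemma pure_tensor_bilinear: "bilinear_map K V W T (pure_tensor K V W)"
proof (intro bilinear_mapI linear_mapI)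
  fix v w assume "v \<in> carrier V" "w \<in> carrier W"
  then show "pure_tensor K V W v w \<in> carrier T" "pure_tensor K V W v w \<in> carrier T"
    by (auto simp: pure_tensor_eq tensor_carrier V.R.free_gen_closed)
next
  fix v v' w assume vw: "v \<in> carrier V" "v' \<in> carrier V" "w \<in> carrier W"
  then have "g (v \<oplus>\<^bsub>V\<^esub> v') w \<ominus>\<^bsub>F\<^esub> (g v w \<oplus>\<^bsub>F\<^esub> g v' w) \<in> tensor_gens K V W"
    unfolding tensor_gens_def Let_def by blast
  with vw tensor_gens_rel
  show "pure_tensor K V W (v \<oplus>\<^bsub>V\<^esub> v') w = pure_tensor K V W v w \<oplus>\<^bsub>T\<^esub> pure_tensor K V W v' w"
    by (auto simp: pure_tensor_eq tensor_add V.R.free_gen_closed coset_eq_iff)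
next
  fix v w w' assume vw: "v \<in> carrier V" "w \<in> carrier W" "w' \<in> carrier W"
  then have "g v (w \<oplus>\<^bsub>W\<^esub> w') \<ominus>\<^bsub>F\<^esub> (g v w \<oplus>\<^bsub>F\<^esub> g v w') \<in> tensor_gens K V W"
    unfolding tensor_gens_def Let_def by blast
  with vw tensor_gens_rel
  show "pure_tensor K V W v (w \<oplus>\<^bsub>W\<^esub> w') = pure_tensor K V W v w \<oplus>\<^bsub>T\<^esub> pure_tensor K V W v w'"
    by (auto simp: pure_tensor_eq tensor_add V.R.free_gen_closed coset_eq_iff)
next
  fix c v w assume vw: "c \<in> carrier K" "v \<in> carrier V" "w \<in> carrier W"
  have "g (c \<odot>\<^bsub>V\<^esub> v) w \<ominus>\<^bsub>F\<^esub> c \<odot>\<^bsub>F\<^esub> g v w \<in> tensor_gens K V W"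
    "g v (c \<odot>\<^bsub>W\<^esub> w) \<ominus>\<^bsub>F\<^esub> c \<odot>\<^bsub>F\<^esub> g v w \<in> tensor_gens K V W"
    using vw unfolding tensor_gens_def Let_def by blast+
  with vw tensor_gens_rel
  show "pure_tensor K V W (c \<odot>\<^bsub>V\<^esub> v) w = c \<odot>\<^bsub>T\<^esub> pure_tensor K V W v w"
    "pure_tensor K V W v (c \<odot>\<^bsub>W\<^esub> w) = c \<odot>\<^bsub>T\<^esub> pure_tensor K V W v w"
    by (auto simp: pure_tensor_eq tensor_smult V.R.free_gen_closed coset_eq_iff)
qed

text \<open>The linear extension of a bilinear map kills the relations and is therefore constant on
  cosets, so the representative that \<open>tensor_lift\<close> picks does not matter.\<close>

lemma tensor_lift_coset:
  assumes "module K U" "bilinear_map K V W U f" "p \<in> carrier F"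
  shows "tensor_lift K U f (R +>\<^bsub>F\<^esub> p) = free_eval K U (\<lambda>z. f (fst z) (snd z)) p"
proof -
  interpret U: module K U by fact
  let ?ev = "free_eval K U (\<lambda>z. f (fst z) (snd z))"
  have cl: "f (fst z) (snd z) \<in> carrier U" if "z \<in> carrier V \<times> carrier W" for z
    using that bilinear_map_closed[OF assms(2)] by auto
  have lin: "linear_map K F U ?ev"
    by (rule free_eval_linear[OF assms(1) cl])
  have gen: "?ev (g v w) = f v w" if "v \<in> carrier V" "w \<in> carrier W" for v w
    using that by (subst free_eval_gen[OF assms(1) cl, where X = "carrier V \<times> carrier W"]) auto
  note ev_simps = linear_map_minus[OF lin F.module_axioms assms(1)] linear_map_add[OF lin]
    linear_map_smult[OF lin] gen V.R.free_gen_closed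
  note f = bilinear_map_closed[OF assms(2)]
    linear_map_add[OF bilinear_map_left[OF assms(2)]] linear_map_add[OF bilinear_map_right[OF assms(2)]]
    linear_map_smult[OF bilinear_map_left[OF assms(2)]] linear_map_smult[OF bilinear_map_right[OF assms(2)]]
  \<comment> \<open>\<open>R\<close> is the least submodule containing the generators, so it
    suffices that the kernel of the extension is a submodule containing them.\<close>
  let ?N = "{p \<in> carrier F. ?ev p = \<zero>\<^bsub>U\<^esub>}"
  have "submodule ?N K F"
    using linear_map_zero[OF lin F.module_axioms assms(1)] linear_map_add[OF lin]
      linear_map_smult[OF lin] linear_map_minus[OF lin F.module_axioms assms(1) F.M.zero_closed]
    by (intro F.submoduleI) (auto simp: F.minus_eq U.minus_eq)
  moreover have "tensor_gens K V W \<subseteq> ?N"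
    unfolding tensor_gens_def Let_def
    by (auto simp: ev_simps f U.M.r_neg U.M.minus_eq)
  ultimately have N: "R \<subseteq> ?N"
    unfolding tensor_rel_def by blast
  \<comment> \<open>The chosen representative differs from \<open>p\<close> by an element of
    \<open>R\<close>, on which the extension vanishes.\<close>
  define q where "q = (SOME q. q \<in> R +>\<^bsub>F\<^esub> p)"
  have "p \<in> R +>\<^bsub>F\<^esub> p" using R.a_rcos_self[OF assms(3)] .
  then have "q \<in> R +>\<^bsub>F\<^esub> p" unfolding q_def by (rule someI[where P = "\<lambda>q. q \<in> _"])
  then obtain h where h: "h \<in> R" "q = h \<oplus>\<^bsub>F\<^esub> p" using mem_coset by blast
  have "?ev q = ?ev p"
    using h N assms(3) linear_map_closed[OF lin assms(3)]
    by (subst h(2), subst linear_map_add[OF lin]) auto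
  then show ?thesis
    by (simp add: tensor_lift_def Let_def q_def free_eval_def supp_def)
qed

lemma tensor_lift_linear:
  assumes "module K U" "bilinear_map K V W U f"
  shows "linear_map K T U (tensor_lift K U f)"
proof -
  have lin: "linear_map K F U (free_eval K U (\<lambda>z. f (fst z) (snd z)))"
    by (rule free_eval_linear[OF assms(1)]) (use bilinear_map_closed[OF assms(2)] in auto)
  show ?thesis
    by (rule linear_mapI)
      (auto simp: tensor_carrier tensor_add tensor_smult tensor_lift_coset[OF assms]
        linear_map_closed[OF lin] linear_map_add[OF lin] linear_map_smult[OF lin])
qed

lemma tensor_lift_pure:
  assumes "module K U" "bilinear_map K V W U f" "v \<in> carrier V" "w \<in> carrier W"
  shows "tensor_lift K U f (pure_tensor K V W v w) = f v w"
proof -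
  have cl: "f (fst z) (snd z) \<in> carrier U" if "z \<in> carrier V \<times> carrier W" for z
    using that bilinear_map_closed[OF assms(2)] by auto
  show ?thesis
    using free_eval_gen[OF assms(1) cl, where x = "(v, w)"] assms(3,4)
    by (simp add: pure_tensor_eq tensor_lift_coset[OF assms(1,2)] V.R.free_gen_closed)
qed

text \<open>Coefficients can be avoided: in c(v \<otimes> w) the scalar is absorbed into the first
  factor, so plain sums of pure tensors reach every element.\<close>

lemma tensor_list_sum:
  assumes "t \<in> carrier T"
  obtains xs where "set xs \<subseteq> carrier V \<times> carrier W"
    and "t = list_sum T (\<lambda>z. pure_tensor K V W (fst z) (snd z)) xs"
proof -
  interpret T: module K T by (rule tensor_module)
  obtain p where p: "p \<in> carrier F" "t = R +>\<^bsub>F\<^esub> p"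
    using assms by (auto simp: tensor_carrier)
  have "\<exists>xs. set xs \<subseteq> carrier V \<times> carrier W \<and>
      R +>\<^bsub>F\<^esub> p = list_sum T (\<lambda>z. pure_tensor K V W (fst z) (snd z)) xs"
    using V.R.is_cring p(1)
  proof (rule free_module_induct)
    show "\<exists>xs. set xs \<subseteq> carrier V \<times> carrier W \<and>
        R +>\<^bsub>F\<^esub> (\<lambda>_. \<zero>\<^bsub>K\<^esub>) = list_sum T (\<lambda>z. pure_tensor K V W (fst z) (snd z)) xs"
      by (rule exI[of _ "[]"]) (simp add: tensor_zero free_module_ops)
  next
    fix c x q
    assume c: "c \<in> carrier K" and x: "x \<in> carrier V \<times> carrier W" and q: "q \<in> carrier F"
      and "\<exists>xs. set xs \<subseteq> carrier V \<times> carrier W \<and>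
        R +>\<^bsub>F\<^esub> q = list_sum T (\<lambda>z. pure_tensor K V W (fst z) (snd z)) xs"
    then obtain xs where xs: "set xs \<subseteq> carrier V \<times> carrier W"
      "R +>\<^bsub>F\<^esub> q = list_sum T (\<lambda>z. pure_tensor K V W (fst z) (snd z)) xs" by blast
    obtain v w where vw: "x = (v, w)" "v \<in> carrier V" "w \<in> carrier W" using x by auto
    have "R +>\<^bsub>F\<^esub> (c \<odot>\<^bsub>F\<^esub> g v w) = pure_tensor K V W (c \<odot>\<^bsub>V\<^esub> v) w"
      using c vw linear_map_smult[OF bilinear_map_left[OF pure_tensor_bilinear]]
      by (simp add: tensor_smult V.R.free_gen_closed pure_tensor_eq)
    then have "R +>\<^bsub>F\<^esub> (c \<odot>\<^bsub>F\<^esub> free_gen K x \<oplus>\<^bsub>F\<^esub> q)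
        = list_sum T (\<lambda>z. pure_tensor K V W (fst z) (snd z)) ((c \<odot>\<^bsub>V\<^esub> v, w) # xs)"
      using c x q vw xs(2) by (simp add: V.R.free_gen_closed flip: tensor_add)
    then show "\<exists>xs. set xs \<subseteq> carrier V \<times> carrier W \<and>
        R +>\<^bsub>F\<^esub> (c \<odot>\<^bsub>F\<^esub> free_gen K x \<oplus>\<^bsub>F\<^esub> q)
          = list_sum T (\<lambda>z. pure_tensor K V W (fst z) (snd z)) xs"
      using xs(1) c vw by (intro exI[of _ "(c \<odot>\<^bsub>V\<^esub> v, w) # xs"]) auto
  qed
  with p(2) that show ?thesis by blast
qed

end

lemma module_pairI: "module K V \<Longrightarrow> module K W \<Longrightarrow> module_pair K V W"
  by (simp add: module_pair_def)

lemma linear_map_cong: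
  assumes "linear_map K V W f" "\<And>v. v \<in> carrier V \<Longrightarrow> f v = g v" "module K V"
  shows "linear_map K V W g"
proof -
  interpret V: module K V by fact
  have eq: "g v = f v" if "v \<in> carrier V" for v
    using assms(2)[OF that] by simp
  show ?thesis
    by (rule linear_mapI)
      (simp_all add: eq linear_map_closed[OF assms(1)] linear_map_add[OF assms(1)]
        linear_map_smult[OF assms(1)])
qed

lemma pure_tensor_closed:
  assumes "module K V" "module K W" "v \<in> carrier V" "w \<in> carrier W"
  shows "pure_tensor K V W v w \<in> carrier (tensor K V W)"
  by (rule bilinear_map_closed[OF module_pair.pure_tensor_bilinear]) (intro module_pairI assms)+

lemma tensor_lift_list_sum:
  assumes "module K V" "module K W" "module K U" "bilinear_map K V W U f"
    and "\<And>x. x \<in> set xs \<Longrightarrow> h x \<in> carrier V" "\<And>x. x \<in> set xs \<Longrightarrow> k x \<in> carrier W"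
  shows "tensor_lift K U f (list_sum (tensor K V W) (\<lambda>x. pure_tensor K V W (h x) (k x)) xs)
    = list_sum U (\<lambda>x. f (h x) (k x)) xs"
proof -
  interpret module_pair K V W by (rule module_pairI) fact+
  show ?thesis
    using assms(5,6)
    by (subst linear_map_list_sum[OF tensor_lift_linear[OF assms(3,4)] tensor_module assms(3)])
      (auto simp: tensor_lift_pure[OF assms(3,4)] pure_tensor_closed assms(1,2) cong: list_sum_cong)
qed

text \<open>The choice inside \<open>tensor_lift\<close> hides how its value varies with
  \<open>f z\<close>. For one fixed expression of \<open>x\<close> by pure tensors the value is a
  finite sum of terms linear in \<open>z\<close>. This yields bilinearity of the nested lifts in
  \<open>tensor_assoc\<close> and in the product of \<open>tensor_algebra\<close>, and linearity of
  \<open>lmul\<close> and \<open>rmul\<close> in the acting element.\<close>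

lemma tensor_lift_linear_param:
  assumes "module K V" "module K W" "module K U" "module K Z"
    and bil: "\<And>z. z \<in> carrier Z \<Longrightarrow> bilinear_map K V W U (f z)"
    and lin: "\<And>v w. \<lbrakk>v \<in> carrier V; w \<in> carrier W\<rbrakk> \<Longrightarrow> linear_map K Z U (\<lambda>z. f z v w)"
    and x: "x \<in> carrier (tensor K V W)"
  shows "linear_map K Z U (\<lambda>z. tensor_lift K U (f z) x)"
proof -
  interpret module_pair K V W by (rule module_pairI) fact+
  obtain xs where xs: "set xs \<subseteq> carrier V \<times> carrier W"
    "x = list_sum T (\<lambda>z. pure_tensor K V W (fst z) (snd z)) xs"
    using tensor_list_sum[OF x] .
  show ?thesis
  proof (rule linear_map_cong)
    show "linear_map K Z U (\<lambda>z. list_sum U (\<lambda>y. f z (fst y) (snd y)) xs)"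
      by (rule linear_map_list_sum_fun[OF assms(4,3) lin]) (use xs(1) in auto)
    show "list_sum U (\<lambda>y. f z (fst y) (snd y)) xs = tensor_lift K U (f z) x" if "z \<in> carrier Z" for z
      unfolding xs(2)
      by (rule tensor_lift_list_sum[OF assms(1-3) bil[OF that], symmetric]) (use xs(1) in auto)
  qed fact
qed

section \<open>Tensor products of linear maps and the associativity map\<close>

lemma tensor_map_bilinear:
  assumes "module K V" "module K W" "linear_map K V0 V f" "linear_map K W0 W g"
  shows "bilinear_map K V0 W0 (tensor K V W) (\<lambda>v w. pure_tensor K V W (f v) (g w))"
  by (rule bilinear_map_comp[OF module_pair.pure_tensor_bilinear assms(3,4) linear_map_id])
    (rule module_pairI, fact+)

lemma tensor_map_linear:
  assumes "module K V" "module K W" "module K V0" "module K W0"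
    and "linear_map K V0 V f" "linear_map K W0 W g"
  shows "linear_map K (tensor K V0 W0) (tensor K V W) (tensor_map K V W f g)"
  unfolding tensor_map_def
  by (intro module_pair.tensor_lift_linear module_pair.tensor_module module_pairI
      tensor_map_bilinear assms)

lemma tensor_map_list_sum:
  assumes "module K V" "module K W" "module K V0" "module K W0"
    and "linear_map K V0 V f" "linear_map K W0 W g"
    and "\<And>x. x \<in> set xs \<Longrightarrow> h x \<in> carrier V0" "\<And>x. x \<in> set xs \<Longrightarrow> k x \<in> carrier W0"
  shows "tensor_map K V W f g (list_sum (tensor K V0 W0) (\<lambda>x. pure_tensor K V0 W0 (h x) (k x)) xs)
    = list_sum (tensor K V W) (\<lambda>x. pure_tensor K V W (f (h x)) (g (k x))) xs"
  unfolding tensor_map_def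
  by (rule tensor_lift_list_sum)
    (intro module_pair.tensor_module module_pairI tensor_map_bilinear assms | simp)+

lemma tensor_map_pure:
  assumes "module K V" "module K W" "module K V0" "module K W0"
    and "linear_map K V0 V f" "linear_map K W0 W g" "v \<in> carrier V0" "w \<in> carrier W0"
  shows "tensor_map K V W f g (pure_tensor K V0 W0 v w) = pure_tensor K V W (f v) (g w)"
  unfolding tensor_map_def
  by (intro module_pair.tensor_lift_pure module_pair.tensor_module module_pairI
      tensor_map_bilinear assms)

lemma
  assumes U: "module K U" and V: "module K V" and W: "module K W"
  shows tensor_assoc_linear:
    "linear_map K (tensor K (tensor K U V) W) (tensor K U (tensor K V W)) (tensor_assoc K U V W)"
    and tensor_assoc_pure:
    "\<lbrakk>u \<in> carrier U; v \<in> carrier V; w \<in> carrier W\<rbrakk> \<Longrightarrow>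
      tensor_assoc K U V W (pure_tensor K (tensor K U V) W (pure_tensor K U V u v) w)
        = pure_tensor K U (tensor K V W) u (pure_tensor K V W v w)"
proof -
  let ?UV = "tensor K U V" and ?VW = "tensor K V W"
  let ?T = "tensor K U ?VW"
  interpret UV: module_pair K U V by (intro module_pairI U V)
  interpret VW: module_pair K V W by (intro module_pairI V W)
  interpret T: module_pair K U ?VW by (intro module_pairI U VW.tensor_module)
  interpret L: module_pair K ?UV W by (intro module_pairI UV.tensor_module W)
  let ?f = "\<lambda>w u v. pure_tensor K U ?VW u (pure_tensor K V W v w)"
  have f1: "bilinear_map K U V ?T (?f w)" if "w \<in> carrier W" for w
    by (rule bilinear_map_comp[OF T.pure_tensor_bilinear linear_map_id
        bilinear_map_left[OF VW.pure_tensor_bilinear that] linear_map_id])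
  have f2: "linear_map K W ?T (\<lambda>w. ?f w u v)" if "u \<in> carrier U" "v \<in> carrier V" for u v
    by (rule linear_map_comp[OF bilinear_map_right[OF VW.pure_tensor_bilinear that(2)]
        bilinear_map_right[OF T.pure_tensor_bilinear that(1)]])
  \<comment> \<open>The associativity map is a lift inside a lift: linear in \<open>x\<close> by
    lifting, linear in \<open>w\<close> because the inner bilinear map depends linearly on the
    parameter \<open>w\<close>.\<close>
  have bil: "bilinear_map K ?UV W ?T (\<lambda>x w. tensor_lift K ?T (?f w) x)"
  proof (rule bilinear_mapI)
    show "linear_map K ?UV ?T (\<lambda>x. tensor_lift K ?T (?f w) x)" if "w \<in> carrier W" for w
      by (rule UV.tensor_lift_linear[OF T.tensor_module f1[OF that]])
    show "linear_map K W ?T (\<lambda>w. tensor_lift K ?T (?f w) x)" if "x \<in> carrier ?UV" for x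
      by (rule tensor_lift_linear_param[OF U V T.tensor_module W f1 f2 that])
  qed
  show "linear_map K (tensor K ?UV W) ?T (tensor_assoc K U V W)"
    unfolding tensor_assoc_def Let_def by (rule L.tensor_lift_linear[OF T.tensor_module bil])
  assume uvw: "u \<in> carrier U" "v \<in> carrier V" "w \<in> carrier W"
  have uv: "pure_tensor K U V u v \<in> carrier ?UV"
    using pure_tensor_closed[OF U V] uvw by blast
  show "tensor_assoc K U V W (pure_tensor K ?UV W (pure_tensor K U V u v) w)
        = pure_tensor K U ?VW u (pure_tensor K V W v w)"
    unfolding tensor_assoc_def Let_def
    using L.tensor_lift_pure[OF T.tensor_module bil uv uvw(3)]
      UV.tensor_lift_pure[OF T.tensor_module f1[OF uvw(3)] uvw(1,2)] by simp
qed

section \<open>Tensor products of algebras\<close>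

lemma a_inv_mult_update: "\<ominus>\<^bsub>V\<lparr>mult := m\<rparr>\<^esub> x = \<ominus>\<^bsub>V\<^esub> x"
  for V :: "('k, 'v, 'y) module_scheme"
  by (simp add: a_inv_def)

text \<open>The module axioms concern addition and scalars, so \<open>tensor_algebra\<close>, which
  updates only the product of \<open>tensor\<close>, is again a module.\<close>

lemma module_mult_update:
  assumes "module K V"
  shows "module K (V\<lparr>mult := m\<rparr>)"
proof -
  interpret V: module K V by fact
  show ?thesis
  proof (rule moduleI)
    show "abelian_group (V\<lparr>mult := m\<rparr>)"
    proof (rule abelian_groupI)
      fix x assume "x \<in> carrier (V\<lparr>mult := m\<rparr>)"
      then show "\<exists>y\<in>carrier (V\<lparr>mult := m\<rparr>). y \<oplus>\<^bsub>V\<lparr>mult := m\<rparr>\<^esub> x = \<zero>\<^bsub>V\<lparr>mult := m\<rparr>\<^esub>"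
        by (intro bexI[of _ "\<ominus>\<^bsub>V\<^esub> x"]) (simp_all add: V.M.l_neg)
    qed (simp_all add: V.M.a_ac)
  qed (auto simp: V.R.is_cring V.smult_l_distr V.smult_r_distr V.smult_assoc1)
qed

text \<open>Bilinearity of the product passes from two factors to their tensor algebra, so it can be
  carried along to the threefold product B \<otimes> (B \<otimes> B).\<close>

abbreviation bilinear_mult :: "('k, 'x) ring_scheme \<Rightarrow> ('k, 'a, 'y) module_scheme \<Rightarrow> bool"
  where "bilinear_mult K A \<equiv> bilinear_map K A A A (\<otimes>\<^bsub>A\<^esub>)"

lemma
  shows tensor_algebra_carrier: "carrier (tensor_algebra K A B) = carrier (tensor K A B)"
    and tensor_algebra_add: "(\<oplus>\<^bsub>tensor_algebra K A B\<^esub>) = (\<oplus>\<^bsub>tensor K A B\<^esub>)"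
    and tensor_algebra_zero: "\<zero>\<^bsub>tensor_algebra K A B\<^esub> = \<zero>\<^bsub>tensor K A B\<^esub>"
    and tensor_algebra_smult: "(\<odot>\<^bsub>tensor_algebra K A B\<^esub>) = (\<odot>\<^bsub>tensor K A B\<^esub>)"
  by (simp_all add: tensor_algebra_def Let_def)

lemma tensor_algebra_module:
  assumes "module K A" "module K B"
  shows "module K (tensor_algebra K A B)"
  unfolding tensor_algebra_def Let_def
  by (intro module_mult_update module_pair.tensor_module module_pairI assms)

lemma list_sum_tensor_algebra: "list_sum (tensor_algebra K A B) = list_sum (tensor K A B)"
  by (simp add: list_sum_def tensor_algebra_add tensor_algebra_zero fun_eq_iff)

text \<open>\<open>tensor_algebra\<close> and \<open>tensor\<close> give different records with the
  same linear structure; these equations let one stock of linear maps serve both.\<close>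

lemma linear_map_tensor_algebra:
  "linear_map K (tensor_algebra K A B) = linear_map K (tensor K A B)"
  "linear_map K V (tensor_algebra K A B) = linear_map K V (tensor K A B)"
  by (simp_all add: linear_map_def fun_eq_iff tensor_algebra_carrier tensor_algebra_add tensor_algebra_smult)

lemma
  assumes A: "module K A" and B: "module K B"
    and bA: "bilinear_mult K A" and bB: "bilinear_mult K B"
  shows tensor_algebra_bilinear_mult: "bilinear_mult K (tensor_algebra K A B)"
    and tensor_algebra_mult_pure:
    "\<lbrakk>a \<in> carrier A; b \<in> carrier B; a' \<in> carrier A; b' \<in> carrier B\<rbrakk> \<Longrightarrow>
      pure_tensor K A B a b \<otimes>\<^bsub>tensor_algebra K A B\<^esub> pure_tensor K A B a' b'
        = pure_tensor K A B (a \<otimes>\<^bsub>A\<^esub> a') (b \<otimes>\<^bsub>B\<^esub> b')"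
proof -
  interpret module_pair K A B by (intro module_pairI A B)
  let ?p = "\<lambda>a b a' b'. pure_tensor K A B (a \<otimes>\<^bsub>A\<^esub> a') (b \<otimes>\<^bsub>B\<^esub> b')"
  note comp = bilinear_map_comp[OF pure_tensor_bilinear _ _ linear_map_id]
  have p1: "bilinear_map K A B T (?p a b)" if "a \<in> carrier A" "b \<in> carrier B" for a b
    by (rule comp[OF bilinear_map_right[OF bA that(1)] bilinear_map_right[OF bB that(2)]])
  have p2: "bilinear_map K A B T (\<lambda>a b. ?p a b a' b')" if "a' \<in> carrier A" "b' \<in> carrier B" for a' b'
    by (rule comp[OF bilinear_map_left[OF bA that(1)] bilinear_map_left[OF bB that(2)]])
  \<comment> \<open>The outer lift needs bilinearity in the left factor while the right factor
    \<open>y\<close> stays a general tensor, so \<open>a\<close> and \<open>b\<close> are treated as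
    parameters of the inner lift.\<close>
  have q1: "bilinear_map K A B T (\<lambda>a b. tensor_lift K T (?p a b) y)" if "y \<in> carrier T" for y
  proof (rule bilinear_mapI)
    show "linear_map K A T (\<lambda>a. tensor_lift K T (?p a b) y)" if "b \<in> carrier B" for b
      using that \<open>y \<in> carrier T\<close>
      by (intro tensor_lift_linear_param[OF A B tensor_module A p1] bilinear_map_left[OF p2])
    show "linear_map K B T (\<lambda>b. tensor_lift K T (?p a b) y)" if "a \<in> carrier A" for a
      using that \<open>y \<in> carrier T\<close>
      by (intro tensor_lift_linear_param[OF A B tensor_module B p1] bilinear_map_right[OF p2])
  qed
  have q2: "linear_map K T T (\<lambda>y. tensor_lift K T (?p a b) y)" if "a \<in> carrier A" "b \<in> carrier B" for a b
    by (rule tensor_lift_linear[OF tensor_module p1[OF that]])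
  have m: "(\<otimes>\<^bsub>tensor_algebra K A B\<^esub>) = (\<lambda>x y. tensor_lift K T (\<lambda>a b. tensor_lift K T (?p a b) y) x)"
    by (simp add: tensor_algebra_def Let_def)
  have "bilinear_map K T T T (\<lambda>x y. tensor_lift K T (\<lambda>a b. tensor_lift K T (?p a b) y) x)"
  proof (rule bilinear_mapI)
    show "linear_map K T T (\<lambda>x. tensor_lift K T (\<lambda>a b. tensor_lift K T (?p a b) y) x)"
      if "y \<in> carrier T" for y
      by (rule tensor_lift_linear[OF tensor_module q1[OF that]])
    show "linear_map K T T (\<lambda>y. tensor_lift K T (\<lambda>a b. tensor_lift K T (?p a b) y) x)"
      if "x \<in> carrier T" for x
      by (rule tensor_lift_linear_param[OF A B tensor_module tensor_module q1 q2 that])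
  qed
  then show "bilinear_mult K (tensor_algebra K A B)"
    by (simp add: bilinear_map_def m linear_map_tensor_algebra tensor_algebra_carrier )
  assume ab: "a \<in> carrier A" "b \<in> carrier B" "a' \<in> carrier A" "b' \<in> carrier B"
  have cl: "pure_tensor K A B a' b' \<in> carrier T"
    using pure_tensor_closed[OF A B] ab by blast
  show "pure_tensor K A B a b \<otimes>\<^bsub>tensor_algebra K A B\<^esub> pure_tensor K A B a' b' = ?p a b a' b'"
    unfolding m tensor_lift_pure[OF tensor_module q1[OF cl] ab(1,2)]
    by (rule tensor_lift_pure[OF tensor_module p1[OF ab(1,2)] ab(3,4)])
qed

text \<open>Multiplies out a product of two sums with the index of the left factor outside; this is
  the order of summation in \<open>yang_baxter_sums\<close>.\<close>

lemma bilinear_map_list_sum: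
  assumes "bilinear_map K V W U f" "module K V" "module K W" "module K U"
    and "\<And>x. x \<in> set xs \<Longrightarrow> h x \<in> carrier V" "\<And>y. y \<in> set ys \<Longrightarrow> k y \<in> carrier W"
  shows "f (list_sum V h xs) (list_sum W k ys) = list_sum U (\<lambda>x. list_sum U (\<lambda>y. f (h x) (k y)) ys) xs"
proof -
  interpret W: module K W by fact
  have "f (list_sum V h xs) (list_sum W k ys) = list_sum U (\<lambda>x. f (h x) (list_sum W k ys)) xs"
    by (rule linear_map_list_sum[OF bilinear_map_left[OF assms(1)] assms(2,4,5)])
      (simp_all add: W.M.list_sum_closed assms(6))
  also have "\<dots> = list_sum U (\<lambda>x. list_sum U (\<lambda>y. f (h x) (k y)) ys) xs"
    by (rule list_sum_cong[OF refl])
      (rule linear_map_list_sum[OF bilinear_map_right[OF assms(1)] assms(3,4,6)], rule assms(5))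
  finally show ?thesis .
qed

section \<open>Yang-Baxter pairs as finite sums\<close>

abbreviation list_tensor ::
  "('k, 'x) ring_scheme \<Rightarrow> ('k, 'v, 'y) module_scheme \<Rightarrow> ('k, 'w, 'z) module_scheme
    \<Rightarrow> ('v \<times> 'w) list \<Rightarrow> ('v \<times> 'w \<Rightarrow> 'k) set"
  where "list_tensor K V W xs \<equiv>
    list_sum (tensor K V W) (\<lambda>x. pure_tensor K V W (fst x) (snd x)) xs"

text \<open>Brackets to the right, as in \<open>yang_baxter_eqs\<close> and in the codomain of
  \<open>tensor_assoc\<close>.\<close>

abbreviation pure_tensor3 ::
  "('k, 'x) ring_scheme \<Rightarrow> ('k, 'u, 'y) module_scheme \<Rightarrow> ('k, 'v, 'z) module_scheme \<Rightarrow> ('k, 'w, 't) module_scheme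
    \<Rightarrow> 'u \<Rightarrow> 'v \<Rightarrow> 'w \<Rightarrow> ('u \<times> ('v \<times> 'w \<Rightarrow> 'k) set \<Rightarrow> 'k) set"
  where "pure_tensor3 K U V W u v w \<equiv> pure_tensor K U (tensor K V W) u (pure_tensor K V W v w)"

lemma tensor_map_list_tensor:
  assumes "module K V" "module K W" "module K V0" "module K W0"
    and "linear_map K V0 V f" "linear_map K W0 W g" "set xs \<subseteq> carrier V0 \<times> carrier W0"
  shows "tensor_map K V W f g (list_tensor K V0 W0 xs)
    = list_sum (tensor K V W) (\<lambda>x. pure_tensor K V W (f (fst x)) (g (snd x))) xs"
  by (rule tensor_map_list_sum[OF assms(1-6)]) (use assms(7) in auto)

text \<open>The equations multiplied out, where \<open>xs\<close> lists the pairs (a_i, b_i) of r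
  and \<open>ys\<close> the pairs (c_j, d_j) of s: r13 r12 is the sum of a_i a_k \<otimes> b_k
  \<otimes> b_i, r12 r23 that of a_i \<otimes> b_i a_k \<otimes> b_k, s23 r13 that of a_i \<otimes>
  c_j \<otimes> d_j b_i, and similarly for the second equation. Only products within
  \<open>A\<close> occur, so the condition makes sense without an identity.\<close>

definition yang_baxter_sums ::
  "('k, 'x) ring_scheme \<Rightarrow> ('k, 'a, 'y) module_scheme \<Rightarrow> ('a \<times> 'a) list \<Rightarrow> ('a \<times> 'a) list \<Rightarrow> bool"
  where "yang_baxter_sums K A xs ys \<longleftrightarrow>
    (let T = tensor K A (tensor K A A); S = list_sum T; P = pure_tensor3 K A A A in
      (S (\<lambda>x. S (\<lambda>x'. P (fst x \<otimes>\<^bsub>A\<^esub> fst x') (snd x') (snd x)) xs) xs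
        \<ominus>\<^bsub>T\<^esub> S (\<lambda>x. S (\<lambda>x'. P (fst x) (snd x \<otimes>\<^bsub>A\<^esub> fst x') (snd x')) xs) xs)
        \<oplus>\<^bsub>T\<^esub> S (\<lambda>y. S (\<lambda>x. P (fst x) (fst y) (snd y \<otimes>\<^bsub>A\<^esub> snd x)) xs) ys = \<zero>\<^bsub>T\<^esub> \<and>
      (S (\<lambda>y. S (\<lambda>x. P (fst y \<otimes>\<^bsub>A\<^esub> fst x) (snd x) (snd y)) xs) ys
        \<ominus>\<^bsub>T\<^esub> S (\<lambda>y. S (\<lambda>y'. P (fst y) (snd y \<otimes>\<^bsub>A\<^esub> fst y') (snd y')) ys) ys)
        \<oplus>\<^bsub>T\<^esub> S (\<lambda>y. S (\<lambda>y'. P (fst y') (fst y) (snd y \<otimes>\<^bsub>A\<^esub> snd y')) ys) ys = \<zero>\<^bsub>T\<^esub>)"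

text \<open>
  \<open>\<iota>\<close> embeds \<open>A\<close> into a unital algebra \<open>B\<close> and \<open>p\<close> is a linear retraction of \<open>\<iota>\<close>; applying
  \<open>p \<otimes> p \<otimes> p\<close> brings the Yang-Baxter equations back to \<open>A\<close> and eliminates the identity \<open>e\<close>.
\<close>
lemma yang_baxter_eqs_retract:
  fixes A :: "('k, 'a, 'y) module_scheme"
  assumes A: "module K A" and B: "module K B" and bB: "bilinear_mult K B" and e: "is_identity B e"
    and \<iota>: "linear_map K A B \<iota>" and p: "linear_map K B A p" and p\<iota>: "\<And>a. a \<in> carrier A \<Longrightarrow> p (\<iota> a) = a"
    and \<iota>_mult: "\<And>a b. \<lbrakk>a \<in> carrier A; b \<in> carrier A\<rbrakk> \<Longrightarrow> \<iota> a \<otimes>\<^bsub>B\<^esub> \<iota> b = \<iota> (a \<otimes>\<^bsub>A\<^esub> b)"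
    and A_mult: "\<And>a b. \<lbrakk>a \<in> carrier A; b \<in> carrier A\<rbrakk> \<Longrightarrow> a \<otimes>\<^bsub>A\<^esub> b \<in> carrier A"
    and xs: "set xs \<subseteq> carrier A \<times> carrier A" and ys: "set ys \<subseteq> carrier A \<times> carrier A"
    and yb: "yang_baxter_eqs K B e
      (list_sum (tensor K B B) (\<lambda>x. pure_tensor K B B (\<iota> (fst x)) (\<iota> (snd x))) xs)
      (list_sum (tensor K B B) (\<lambda>x. pure_tensor K B B (\<iota> (fst x)) (\<iota> (snd x))) ys)"
  shows "yang_baxter_sums K A xs ys"
proof -
  let ?BB = "tensor_algebra K B B"
  let ?T = "tensor_algebra K B ?BB"
  let ?AA = "tensor K A A"
  let ?U = "tensor K A ?AA"
  interpret BxB: module_pair K B B by (intro module_pairI B)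
  interpret AxA: module_pair K A A by (intro module_pairI A)
  have BB: "module K ?BB" and bBB: "bilinear_mult K ?BB"
    by (intro tensor_algebra_module tensor_algebra_bilinear_mult B bB)+
  interpret BxBB: module_pair K B ?BB by (intro module_pairI B BB)
  interpret AxAA: module_pair K A ?AA by (intro module_pairI A AxA.tensor_module)
  have T: "module K ?T" and bT: "bilinear_mult K ?T"
    by (intro tensor_algebra_module tensor_algebra_bilinear_mult B BB bB bBB)+
  interpret T: module K ?T by (rule T)
  have eB: "e \<in> carrier B" and e_id: "\<And>b. b \<in> carrier B \<Longrightarrow> e \<otimes>\<^bsub>B\<^esub> b = b \<and> b \<otimes>\<^bsub>B\<^esub> e = b"
    using e by (auto simp: is_identity_def)
  note mB = bilinear_map_closed[OF bB]
  define P where "P a b c = pure_tensor K B ?BB a (pure_tensor K B B b c)" for a b c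
  define Q where "Q = pure_tensor3 K A A A"
  have bil2: "bilinear_map K B B ?BB (pure_tensor K B B)"
    using BxB.pure_tensor_bilinear by (simp add: bilinear_map_def linear_map_tensor_algebra)
  have bil3: "bilinear_map K B ?BB ?T (pure_tensor K B ?BB)"
    using BxBB.pure_tensor_bilinear by (simp add: bilinear_map_def linear_map_tensor_algebra)
  have P2_closed: "pure_tensor K B B b c \<in> carrier ?BB" if "b \<in> carrier B" "c \<in> carrier B" for b c
    by (rule bilinear_map_closed[OF bil2 that])
  have P_closed: "P a b c \<in> carrier ?T" if "a \<in> carrier B" "b \<in> carrier B" "c \<in> carrier B" for a b c
    unfolding P_def by (rule bilinear_map_closed[OF bil3 that(1) P2_closed[OF that(2,3)]])
  have P_mult: "P a b c \<otimes>\<^bsub>?T\<^esub> P a' b' c' = P (a \<otimes>\<^bsub>B\<^esub> a') (b \<otimes>\<^bsub>B\<^esub> b') (c \<otimes>\<^bsub>B\<^esub> c')"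
    if "a \<in> carrier B" "b \<in> carrier B" "c \<in> carrier B" "a' \<in> carrier B" "b' \<in> carrier B" "c' \<in> carrier B"
    for a b c a' b' c'
    unfolding P_def using that
    by (simp add: tensor_algebra_mult_pure[OF B BB bB bBB] P2_closed tensor_algebra_mult_pure[OF B B bB bB])
  define q where "q = tensor_map K A ?AA p (tensor_map K A A p p)"
  have pp: "linear_map K ?BB ?AA (tensor_map K A A p p)"
    unfolding linear_map_tensor_algebra by (rule tensor_map_linear[OF A A B B p p])
  have q: "linear_map K ?T ?U q"
    unfolding q_def linear_map_tensor_algebra
    by (rule tensor_map_linear[OF A AxA.tensor_module B BB p pp])
  have q_P: "q (P a b c) = Q (p a) (p b) (p c)"
    if "a \<in> carrier B" "b \<in> carrier B" "c \<in> carrier B" for a b c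
    unfolding P_def q_def Q_def using that
    by (simp add: tensor_map_pure[OF A AxA.tensor_module B BB p pp] P2_closed tensor_map_pure[OF A A B B p p])
  \<comment> \<open>One computation for all three kinds of product: the legs of both factors are
    arbitrary functions of the list entries, and the constant function \<open>e\<close> in a
    suitable leg later yields \<open>t12\<close>, \<open>t13\<close> and \<open>t23\<close>.\<close>
  have prod: "list_sum ?T (\<lambda>u. P (h1 u) (h2 u) (h3 u)) us \<otimes>\<^bsub>?T\<^esub> list_sum ?T (\<lambda>v. P (k1 v) (k2 v) (k3 v)) vs
        \<in> carrier ?T \<and>
      q (list_sum ?T (\<lambda>u. P (h1 u) (h2 u) (h3 u)) us \<otimes>\<^bsub>?T\<^esub> list_sum ?T (\<lambda>v. P (k1 v) (k2 v) (k3 v)) vs)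
      = list_sum ?U (\<lambda>u. list_sum ?U (\<lambda>v.
          Q (p (h1 u \<otimes>\<^bsub>B\<^esub> k1 v)) (p (h2 u \<otimes>\<^bsub>B\<^esub> k2 v)) (p (h3 u \<otimes>\<^bsub>B\<^esub> k3 v))) vs) us"
    if h: "\<And>u. u \<in> set us \<Longrightarrow> h1 u \<in> carrier B \<and> h2 u \<in> carrier B \<and> h3 u \<in> carrier B"
      and k: "\<And>v. v \<in> set vs \<Longrightarrow> k1 v \<in> carrier B \<and> k2 v \<in> carrier B \<and> k3 v \<in> carrier B"
    for us vs :: "('a \<times> 'a) list" and h1 h2 h3 k1 k2 k3
  proof -
    have cl: "P (h1 u \<otimes>\<^bsub>B\<^esub> k1 v) (h2 u \<otimes>\<^bsub>B\<^esub> k2 v) (h3 u \<otimes>\<^bsub>B\<^esub> k3 v) \<in> carrier ?T"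
      if "u \<in> set us" "v \<in> set vs" for u v
      using h[OF that(1)] k[OF that(2)] by (simp add: P_closed mB)
    have "list_sum ?T (\<lambda>u. P (h1 u) (h2 u) (h3 u)) us \<otimes>\<^bsub>?T\<^esub> list_sum ?T (\<lambda>v. P (k1 v) (k2 v) (k3 v)) vs
        = list_sum ?T (\<lambda>u. list_sum ?T (\<lambda>v. P (h1 u) (h2 u) (h3 u) \<otimes>\<^bsub>?T\<^esub> P (k1 v) (k2 v) (k3 v)) vs) us"
      by (rule bilinear_map_list_sum[OF bT T T T]) (use h k in \<open>simp_all add: P_closed\<close>)
    also have "\<dots> = list_sum ?T (\<lambda>u. list_sum ?T (\<lambda>v.
        P (h1 u \<otimes>\<^bsub>B\<^esub> k1 v) (h2 u \<otimes>\<^bsub>B\<^esub> k2 v) (h3 u \<otimes>\<^bsub>B\<^esub> k3 v)) vs) us"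
      by (intro list_sum_cong refl P_mult) (use h k in auto)
    finally have eq: "list_sum ?T (\<lambda>u. P (h1 u) (h2 u) (h3 u)) us \<otimes>\<^bsub>?T\<^esub> list_sum ?T (\<lambda>v. P (k1 v) (k2 v) (k3 v)) vs
      = list_sum ?T (\<lambda>u. list_sum ?T (\<lambda>v.
        P (h1 u \<otimes>\<^bsub>B\<^esub> k1 v) (h2 u \<otimes>\<^bsub>B\<^esub> k2 v) (h3 u \<otimes>\<^bsub>B\<^esub> k3 v)) vs) us" .
    have inner: "list_sum ?T (\<lambda>v. P (h1 u \<otimes>\<^bsub>B\<^esub> k1 v) (h2 u \<otimes>\<^bsub>B\<^esub> k2 v) (h3 u \<otimes>\<^bsub>B\<^esub> k3 v)) vs \<in> carrier ?T"
      if "u \<in> set us" for u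
      by (rule T.M.list_sum_closed) (rule cl[OF that])
    have "q (list_sum ?T (\<lambda>u. list_sum ?T (\<lambda>v.
        P (h1 u \<otimes>\<^bsub>B\<^esub> k1 v) (h2 u \<otimes>\<^bsub>B\<^esub> k2 v) (h3 u \<otimes>\<^bsub>B\<^esub> k3 v)) vs) us)
      = list_sum ?U (\<lambda>u. list_sum ?U (\<lambda>v.
        q (P (h1 u \<otimes>\<^bsub>B\<^esub> k1 v) (h2 u \<otimes>\<^bsub>B\<^esub> k2 v) (h3 u \<otimes>\<^bsub>B\<^esub> k3 v))) vs) us"
      by (subst linear_map_list_sum[OF q T AxAA.tensor_module inner], assumption)
        (intro list_sum_cong refl linear_map_list_sum[OF q T AxAA.tensor_module] cl)
    also have "\<dots> = list_sum ?U (\<lambda>u. list_sum ?U (\<lambda>v.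
          Q (p (h1 u \<otimes>\<^bsub>B\<^esub> k1 v)) (p (h2 u \<otimes>\<^bsub>B\<^esub> k2 v)) (p (h3 u \<otimes>\<^bsub>B\<^esub> k3 v))) vs) us"
      by (intro list_sum_cong refl q_P mB) (use h k in auto)
    finally have q_eq: "q (list_sum ?T (\<lambda>u. list_sum ?T (\<lambda>v.
        P (h1 u \<otimes>\<^bsub>B\<^esub> k1 v) (h2 u \<otimes>\<^bsub>B\<^esub> k2 v) (h3 u \<otimes>\<^bsub>B\<^esub> k3 v)) vs) us)
      = list_sum ?U (\<lambda>u. list_sum ?U (\<lambda>v.
          Q (p (h1 u \<otimes>\<^bsub>B\<^esub> k1 v)) (p (h2 u \<otimes>\<^bsub>B\<^esub> k2 v)) (p (h3 u \<otimes>\<^bsub>B\<^esub> k3 v))) vs) us" .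
    show ?thesis
      unfolding eq by (rule conjI[OF T.M.list_sum_closed q_eq]) (rule inner)
  qed
  define r where "r us = list_sum (tensor K B B) (\<lambda>x. pure_tensor K B B (\<iota> (fst x)) (\<iota> (snd x))) us"
    for us
  define t12 where "t12 = tensor_lift K ?T (\<lambda>a b. pure_tensor K B ?BB a (pure_tensor K B B b e))"
  define t13 where "t13 = tensor_lift K ?T (\<lambda>a b. pure_tensor K B ?BB a (pure_tensor K B B e b))"
  define t23 where "t23 = pure_tensor K B ?BB e"
  have \<iota>_cl: "\<iota> (fst x) \<in> carrier B" "\<iota> (snd x) \<in> carrier B"
    if "x \<in> set us" "set us \<subseteq> carrier A \<times> carrier A" for x us
    using that by (auto intro!: linear_map_closed[OF \<iota>])
  have t12: "t12 (r us) = list_sum ?T (\<lambda>x. P (\<iota> (fst x)) (\<iota> (snd x)) e) us"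
    if "set us \<subseteq> carrier A \<times> carrier A" for us
    unfolding t12_def r_def P_def
    by (intro tensor_lift_list_sum[OF B B T] \<iota>_cl[OF _ that]
        bilinear_map_comp[OF bil3 linear_map_id bilinear_map_left[OF bil2 eB] linear_map_id])
  have t13: "t13 (r us) = list_sum ?T (\<lambda>x. P (\<iota> (fst x)) e (\<iota> (snd x))) us"
    if "set us \<subseteq> carrier A \<times> carrier A" for us
    unfolding t13_def r_def P_def
    by (intro tensor_lift_list_sum[OF B B T] \<iota>_cl[OF _ that]
        bilinear_map_comp[OF bil3 linear_map_id bilinear_map_right[OF bil2 eB] linear_map_id])
  have t23: "t23 (r us) = list_sum ?T (\<lambda>x. P e (\<iota> (fst x)) (\<iota> (snd x))) us"
    if "set us \<subseteq> carrier A \<times> carrier A" for us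
    unfolding t23_def r_def P_def list_sum_tensor_algebra[of K B B, symmetric]
    by (intro linear_map_list_sum[OF bilinear_map_right[OF bil3 eB] BB T] P2_closed \<iota>_cl[OF _ that])
  \<comment> \<open>Every leg of a product is \<iota>(a)e, e\<iota>(a) or \<iota>(a)\<iota>(b),
    hence lies in the image of \<open>\<iota>\<close>, where \<open>p\<close> inverts
    \<open>\<iota>\<close>. This is how a merely linear \<open>p\<close> transports the
    products.\<close>
  have simps: "p (e \<otimes>\<^bsub>B\<^esub> \<iota> a) = a" "p (\<iota> a \<otimes>\<^bsub>B\<^esub> e) = a" if "a \<in> carrier A" for a
    using that e_id linear_map_closed[OF \<iota>] p\<iota> by auto
  have simps2: "p (\<iota> a \<otimes>\<^bsub>B\<^esub> \<iota> b) = a \<otimes>\<^bsub>A\<^esub> b" if "a \<in> carrier A" "b \<in> carrier A" for a b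
    using that by (simp add: \<iota>_mult p\<iota> A_mult)
  have s1312: "t13 (r us) \<otimes>\<^bsub>?T\<^esub> t12 (r vs) \<in> carrier ?T"
      "q (t13 (r us) \<otimes>\<^bsub>?T\<^esub> t12 (r vs))
        = list_sum ?U (\<lambda>u. list_sum ?U (\<lambda>v. Q (fst u \<otimes>\<^bsub>A\<^esub> fst v) (snd v) (snd u)) vs) us"
    if "set us \<subseteq> carrier A \<times> carrier A" "set vs \<subseteq> carrier A \<times> carrier A" for us vs
  proof -
    \<comment> \<open>The legs of r13 are (a, e, b) and those of r12 are (a, b, e): the two
      identities fall into different legs.\<close>
    note pr = prod[of us "\<lambda>x. \<iota> (fst x)" "\<lambda>_. e" "\<lambda>x. \<iota> (snd x)" vs "\<lambda>x. \<iota> (fst x)" "\<lambda>x. \<iota> (snd x)" "\<lambda>_. e"]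
    show "t13 (r us) \<otimes>\<^bsub>?T\<^esub> t12 (r vs) \<in> carrier ?T"
      unfolding t12[OF that(2)] t13[OF that(1)] using pr that \<iota>_cl eB by blast
    have "q (t13 (r us) \<otimes>\<^bsub>?T\<^esub> t12 (r vs)) = list_sum ?U (\<lambda>u. list_sum ?U (\<lambda>v.
        Q (p (\<iota> (fst u) \<otimes>\<^bsub>B\<^esub> \<iota> (fst v))) (p (e \<otimes>\<^bsub>B\<^esub> \<iota> (snd v))) (p (\<iota> (snd u) \<otimes>\<^bsub>B\<^esub> e))) vs) us"
      unfolding t12[OF that(2)] t13[OF that(1)] using pr that \<iota>_cl eB by blast
    also have "\<dots> = list_sum ?U (\<lambda>u. list_sum ?U (\<lambda>v. Q (fst u \<otimes>\<^bsub>A\<^esub> fst v) (snd v) (snd u)) vs) us"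
      by (intro list_sum_cong refl arg_cong3[where f = Q] simps simps2) (use that in auto)
    finally show "q (t13 (r us) \<otimes>\<^bsub>?T\<^esub> t12 (r vs))
        = list_sum ?U (\<lambda>u. list_sum ?U (\<lambda>v. Q (fst u \<otimes>\<^bsub>A\<^esub> fst v) (snd v) (snd u)) vs) us" .
  qed
  have s1223: "t12 (r us) \<otimes>\<^bsub>?T\<^esub> t23 (r vs) \<in> carrier ?T"
      "q (t12 (r us) \<otimes>\<^bsub>?T\<^esub> t23 (r vs))
        = list_sum ?U (\<lambda>u. list_sum ?U (\<lambda>v. Q (fst u) (snd u \<otimes>\<^bsub>A\<^esub> fst v) (snd v)) vs) us"
    if "set us \<subseteq> carrier A \<times> carrier A" "set vs \<subseteq> carrier A \<times> carrier A" for us vs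
  proof -
    note pr = prod[of us "\<lambda>x. \<iota> (fst x)" "\<lambda>x. \<iota> (snd x)" "\<lambda>_. e" vs "\<lambda>_. e" "\<lambda>x. \<iota> (fst x)" "\<lambda>x. \<iota> (snd x)"]
    show "t12 (r us) \<otimes>\<^bsub>?T\<^esub> t23 (r vs) \<in> carrier ?T"
      unfolding t12[OF that(1)] t23[OF that(2)] using pr that \<iota>_cl eB by blast
    have "q (t12 (r us) \<otimes>\<^bsub>?T\<^esub> t23 (r vs)) = list_sum ?U (\<lambda>u. list_sum ?U (\<lambda>v.
        Q (p (\<iota> (fst u) \<otimes>\<^bsub>B\<^esub> e)) (p (\<iota> (snd u) \<otimes>\<^bsub>B\<^esub> \<iota> (fst v))) (p (e \<otimes>\<^bsub>B\<^esub> \<iota> (snd v)))) vs) us"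
      unfolding t12[OF that(1)] t23[OF that(2)] using pr that \<iota>_cl eB by blast
    also have "\<dots> = list_sum ?U (\<lambda>u. list_sum ?U (\<lambda>v. Q (fst u) (snd u \<otimes>\<^bsub>A\<^esub> fst v) (snd v)) vs) us"
      by (intro list_sum_cong refl arg_cong3[where f = Q] simps simps2) (use that in auto)
    finally show "q (t12 (r us) \<otimes>\<^bsub>?T\<^esub> t23 (r vs))
        = list_sum ?U (\<lambda>u. list_sum ?U (\<lambda>v. Q (fst u) (snd u \<otimes>\<^bsub>A\<^esub> fst v) (snd v)) vs) us" .
  qed
  have s2313: "t23 (r us) \<otimes>\<^bsub>?T\<^esub> t13 (r vs) \<in> carrier ?T"
      "q (t23 (r us) \<otimes>\<^bsub>?T\<^esub> t13 (r vs))
        = list_sum ?U (\<lambda>u. list_sum ?U (\<lambda>v. Q (fst v) (fst u) (snd u \<otimes>\<^bsub>A\<^esub> snd v)) vs) us"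
    if "set us \<subseteq> carrier A \<times> carrier A" "set vs \<subseteq> carrier A \<times> carrier A" for us vs
  proof -
    note pr = prod[of us "\<lambda>_. e" "\<lambda>x. \<iota> (fst x)" "\<lambda>x. \<iota> (snd x)" vs "\<lambda>x. \<iota> (fst x)" "\<lambda>_. e" "\<lambda>x. \<iota> (snd x)"]
    show "t23 (r us) \<otimes>\<^bsub>?T\<^esub> t13 (r vs) \<in> carrier ?T"
      unfolding t23[OF that(1)] t13[OF that(2)] using pr that \<iota>_cl eB by blast
    have "q (t23 (r us) \<otimes>\<^bsub>?T\<^esub> t13 (r vs)) = list_sum ?U (\<lambda>u. list_sum ?U (\<lambda>v.
        Q (p (e \<otimes>\<^bsub>B\<^esub> \<iota> (fst v))) (p (\<iota> (fst u) \<otimes>\<^bsub>B\<^esub> e)) (p (\<iota> (snd u) \<otimes>\<^bsub>B\<^esub> \<iota> (snd v)))) vs) us"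
      unfolding t23[OF that(1)] t13[OF that(2)] using pr that \<iota>_cl eB by blast
    also have "\<dots> = list_sum ?U (\<lambda>u. list_sum ?U (\<lambda>v. Q (fst v) (fst u) (snd u \<otimes>\<^bsub>A\<^esub> snd v)) vs) us"
      by (intro list_sum_cong refl arg_cong3[where f = Q] simps simps2) (use that in auto)
    finally show "q (t23 (r us) \<otimes>\<^bsub>?T\<^esub> t13 (r vs))
        = list_sum ?U (\<lambda>u. list_sum ?U (\<lambda>v. Q (fst v) (fst u) (snd u \<otimes>\<^bsub>A\<^esub> snd v)) vs) us" .
  qed
  have q3: "(q x \<ominus>\<^bsub>?U\<^esub> q y) \<oplus>\<^bsub>?U\<^esub> q z = \<zero>\<^bsub>?U\<^esub>"
    if "(x \<ominus>\<^bsub>?T\<^esub> y) \<oplus>\<^bsub>?T\<^esub> z = \<zero>\<^bsub>?T\<^esub>" "x \<in> carrier ?T" "y \<in> carrier ?T" "z \<in> carrier ?T" for x y z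
  proof -
    have "q ((x \<ominus>\<^bsub>?T\<^esub> y) \<oplus>\<^bsub>?T\<^esub> z) = (q x \<ominus>\<^bsub>?U\<^esub> q y) \<oplus>\<^bsub>?U\<^esub> q z"
      using that(2-4)
      by (simp add: linear_map_add[OF q] linear_map_minus[OF q T AxAA.tensor_module])
    then show ?thesis
      by (simp add: that(1) linear_map_zero[OF q T AxAA.tensor_module])
  qed
  have yb': "(t13 (r xs) \<otimes>\<^bsub>?T\<^esub> t12 (r xs) \<ominus>\<^bsub>?T\<^esub> t12 (r xs) \<otimes>\<^bsub>?T\<^esub> t23 (r xs))
      \<oplus>\<^bsub>?T\<^esub> t23 (r ys) \<otimes>\<^bsub>?T\<^esub> t13 (r xs) = \<zero>\<^bsub>?T\<^esub>"
    "(t13 (r ys) \<otimes>\<^bsub>?T\<^esub> t12 (r xs) \<ominus>\<^bsub>?T\<^esub> t12 (r ys) \<otimes>\<^bsub>?T\<^esub> t23 (r ys))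
      \<oplus>\<^bsub>?T\<^esub> t23 (r ys) \<otimes>\<^bsub>?T\<^esub> t13 (r ys) = \<zero>\<^bsub>?T\<^esub>"
    using yb unfolding yang_baxter_eqs_def Let_def r_def[symmetric] t12_def t13_def t23_def by blast+
  show ?thesis
    unfolding yang_baxter_sums_def Let_def Q_def[symmetric]
    using q3[OF yb'(1) s1312(1)[OF xs xs] s1223(1)[OF xs xs] s2313(1)[OF ys xs]]
      q3[OF yb'(2) s1312(1)[OF ys xs] s1223(1)[OF ys ys] s2313(1)[OF ys ys]]
    unfolding s1312(2)[OF xs xs] s1223(2)[OF xs xs] s2313(2)[OF ys xs]
      s1312(2)[OF ys xs] s1223(2)[OF ys ys] s2313(2)[OF ys ys] by blast
qed

section \<open>Reduction of a Yang-Baxter pair to an equation in A, with or without identity\<close>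

context assoc_algebra
begin

lemma algebra_module: "module K A"
  by (rule A.module_axioms)

lemma mult_bilinear: "bilinear_mult K A"
  by (intro bilinear_mapI linear_mapI)
    (simp_all add: mult_closed mult_add_left mult_add_right mult_smult_left mult_smult_right)

lemma unitization_module: "module K (unitization K A)"
proof (rule moduleI)
  show "abelian_group (unitization K A)"
  proof (rule abelian_groupI)
    fix x assume "x \<in> carrier (unitization K A)"
    then show "\<exists>y\<in>carrier (unitization K A). y \<oplus>\<^bsub>unitization K A\<^esub> x = \<zero>\<^bsub>unitization K A\<^esub>"
      by (intro bexI[of _ "(\<ominus> fst x, \<ominus>\<^bsub>A\<^esub> snd x)"]) (auto simp: unitization_def K.l_neg A.M.l_neg)
  qed (auto simp: unitization_def K.a_ac A.M.a_ac)
qed (auto simp: unitization_def K.is_cring K.l_distr K.r_distr K.m_assoc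
    A.smult_l_distr A.smult_r_distr A.smult_assoc1)

lemma unitization_bilinear: "bilinear_mult K (unitization K A)"
  by (intro bilinear_mapI linear_mapI)
    (auto simp: unitization_def mult_closed mult_add_left mult_add_right mult_smult_left mult_smult_right
      K.l_distr K.r_distr K.m_ac A.M.a_ac A.smult_l_distr A.smult_r_distr A.smult_assoc1[symmetric])

lemma unitization_identity: "is_identity (unitization K A) \<one>\<^bsub>unitization K A\<^esub>"
proof -
  \<comment> \<open>Multiplication by zero is not an axiom of \<open>assoc_algebra\<close>; it
    follows from bilinearity.\<close>
  have "\<zero>\<^bsub>A\<^esub> \<otimes>\<^bsub>A\<^esub> a = \<zero>\<^bsub>A\<^esub>" "a \<otimes>\<^bsub>A\<^esub> \<zero>\<^bsub>A\<^esub> = \<zero>\<^bsub>A\<^esub>" if "a \<in> carrier A" for a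
    using linear_map_zero[OF bilinear_map_left[OF mult_bilinear that] algebra_module algebra_module]
      linear_map_zero[OF bilinear_map_right[OF mult_bilinear that] algebra_module algebra_module] by simp_all
  then show ?thesis
    by (auto simp: is_identity_def unitization_def)
qed

text \<open>Removes the case distinction in \<open>yang_baxter_pair\<close>: in both cases a
  retraction onto \<open>A\<close> leads to the same equations in \<open>A\<close>, stated with
  lists of pairs.\<close>

lemma yang_baxter_pair_sums:
  assumes "yang_baxter_pair K A r s"
  obtains xs ys where "set xs \<subseteq> carrier A \<times> carrier A" "set ys \<subseteq> carrier A \<times> carrier A"
    and "r = list_tensor K A A xs" "s = list_tensor K A A ys" "yang_baxter_sums K A xs ys"
proof -
  interpret AxA: module_pair K A A by (intro module_pairI algebra_module)
  have "r \<in> carrier (tensor K A A)" "s \<in> carrier (tensor K A A)"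
    using assms by (auto simp: yang_baxter_pair_def)
  then obtain xs ys where xs: "set xs \<subseteq> carrier A \<times> carrier A" "r = list_tensor K A A xs"
    and ys: "set ys \<subseteq> carrier A \<times> carrier A" "s = list_tensor K A A ys"
    by (elim AxA.tensor_list_sum)
  have "yang_baxter_sums K A xs ys"
  proof (cases "\<exists>e. is_identity A e")
    case True
    then obtain e where e: "is_identity A e" by blast
    \<comment> \<open>Two identities agree because their product equals each of them, so the
      description operator returns the given \<open>e\<close>.\<close>
    have "(THE e. is_identity A e) = e"
    proof (rule the_equality)
      show "is_identity A e" by (rule e)
    next
      fix e' assume "is_identity A e'"
      then have "e \<otimes>\<^bsub>A\<^esub> e' = e'" "e \<otimes>\<^bsub>A\<^esub> e' = e"
        using e unfolding is_identity_def by blast+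
      then show "e' = e" by simp
    qed
    with assms True have yb: "yang_baxter_eqs K A e r s"
      by (simp add: yang_baxter_pair_def)
    \<comment> \<open>Here \<open>A\<close> is already unital, and embedding and retraction are both
      the identity map.\<close>
    show ?thesis
      by (rule yang_baxter_eqs_retract[OF algebra_module algebra_module mult_bilinear e
            linear_map_id linear_map_id _ _ _ xs(1) ys(1)])
        (use yb xs(2) ys(2) in \<open>simp_all add: mult_closed\<close>)
  next
    case False
    \<comment> \<open>K \<oplus> A splits as a vector space, and the second projection is the linear
      retraction of the embedding a \<mapsto> (0, a).\<close>
    let ?B = "unitization K A" and ?\<iota> = "\<lambda>a. (\<zero>\<^bsub>K\<^esub>, a)"
    have \<iota>: "linear_map K A ?B ?\<iota>"
      by (rule linear_mapI) (auto simp: unitization_def)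
    have p: "linear_map K ?B A snd"
      by (rule linear_mapI) (auto simp: unitization_def)
    have j: "tensor_map K ?B ?B ?\<iota> ?\<iota> (list_tensor K A A us)
        = list_sum (tensor K ?B ?B) (\<lambda>x. pure_tensor K ?B ?B (?\<iota> (fst x)) (?\<iota> (snd x))) us"
      if "set us \<subseteq> carrier A \<times> carrier A" for us
      by (rule tensor_map_list_tensor[OF unitization_module unitization_module
            algebra_module algebra_module \<iota> \<iota> that])
    have yb: "yang_baxter_eqs K ?B \<one>\<^bsub>?B\<^esub> (tensor_map K ?B ?B ?\<iota> ?\<iota> r) (tensor_map K ?B ?B ?\<iota> ?\<iota> s)"
      using assms False unfolding yang_baxter_pair_def Let_def by simp
    show ?thesis
      by (rule yang_baxter_eqs_retract[OF algebra_module unitization_module unitization_bilinear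
            unitization_identity \<iota> p _ _ _ xs(1) ys(1) yb[unfolded xs(2) ys(2) j[OF xs(1)] j[OF ys(1)]]])
        (simp_all add: unitization_def mult_closed)
  qed
  with that xs ys show ?thesis by blast
qed

end

section \<open>Covariant modules\<close>

lemma tensor_map_cong:
  assumes "module K V" "module K W" "module K V0" "module K W0"
    and f: "linear_map K V0 V f" and g: "linear_map K W0 W g"
    and f': "\<And>v. v \<in> carrier V0 \<Longrightarrow> f v = f' v" and g': "\<And>w. w \<in> carrier W0 \<Longrightarrow> g w = g' w"
    and t: "t \<in> carrier (tensor K V0 W0)"
  shows "tensor_map K V W f g t = tensor_map K V W f' g' t"
proof -
  interpret T0: module_pair K V0 W0 by (rule module_pairI) fact+
  \<comment> \<open>The tensor can be written with all entries in the carriers, where the two pairs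
    of maps agree; module laws such as \<open>act_mult\<close> are assumed only there.\<close>
  obtain xs where xs: "set xs \<subseteq> carrier V0 \<times> carrier W0" "t = list_tensor K V0 W0 xs"
    using T0.tensor_list_sum[OF t] .
  have l: "linear_map K V0 V f'" "linear_map K W0 W g'"
    by (rule linear_map_cong[OF f f' assms(3)], assumption)
      (rule linear_map_cong[OF g g' assms(4)], assumption)
  have "list_sum (tensor K V W) (\<lambda>x. pure_tensor K V W (f (fst x)) (g (snd x))) xs
      = list_sum (tensor K V W) (\<lambda>x. pure_tensor K V W (f' (fst x)) (g' (snd x))) xs"
    by (intro list_sum_cong refl arg_cong2[where f = "pure_tensor K V W"] f' g') (use xs(1) in auto)
  then show ?thesis
    unfolding xs(2) tensor_map_list_tensor[OF assms(1-4) f g xs(1)]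
      tensor_map_list_tensor[OF assms(1-4) l xs(1)] .
qed

lemma tensor_map_comp:
  assumes "module K V" "module K W" "module K V1" "module K W1" "module K V0" "module K W0"
    and f: "linear_map K V1 V f" and g: "linear_map K W1 W g"
    and f': "linear_map K V0 V1 f'" and g': "linear_map K W0 W1 g'"
    and t: "t \<in> carrier (tensor K V0 W0)"
  shows "tensor_map K V W f g (tensor_map K V1 W1 f' g' t)
    = tensor_map K V W (\<lambda>v. f (f' v)) (\<lambda>w. g (g' w)) t"
proof -
  interpret T0: module_pair K V0 W0 by (rule module_pairI) fact+
  obtain xs where xs: "set xs \<subseteq> carrier V0 \<times> carrier W0" "t = list_tensor K V0 W0 xs"
    using T0.tensor_list_sum[OF t] .
  show ?thesis
    unfolding xs(2) tensor_map_list_tensor[OF assms(3-6) f' g' xs(1)]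
      tensor_map_list_tensor[OF assms(1,2,5,6) linear_map_comp[OF f' f] linear_map_comp[OF g' g] xs(1)]
    by (rule tensor_map_list_sum[OF assms(1-4) f g])
      (use xs(1) in \<open>auto intro!: linear_map_closed[OF f'] linear_map_closed[OF g']\<close>)
qed

text \<open>Here \<open>t\<close> is fixed and the acting element is the parameter of the lift. With
  r for \<open>t\<close> this is linearity of the coaction m \<mapsto> mr.\<close>

lemma linear_map_lmul:
  assumes V: "module K V" and W: "module K W" and A: "module K A" and E: "module K E"
    and f: "bilinear_map K E A V f" and t: "t \<in> carrier (tensor K A W)"
  shows "linear_map K E (tensor K V W) (\<lambda>x. lmul K V W f x t)"
proof -
  interpret VxW: module_pair K V W by (intro module_pairI V W)
  show ?thesis
    unfolding lmul_def tensor_map_def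
    by (rule tensor_lift_linear_param[OF A W VxW.tensor_module E _ _ t])
      (intro tensor_map_bilinear[OF V W bilinear_map_right[OF f] linear_map_id]
        linear_map_comp[OF bilinear_map_left[OF f] bilinear_map_left[OF VxW.pure_tensor_bilinear]]; assumption)+
qed

lemma linear_map_rmul:
  assumes V: "module K V" and W: "module K W" and A: "module K A" and E: "module K E"
    and f: "bilinear_map K A E W f" and t: "t \<in> carrier (tensor K V A)"
  shows "linear_map K E (tensor K V W) (\<lambda>x. rmul K V W f t x)"
proof -
  interpret VxW: module_pair K V W by (intro module_pairI V W)
  show ?thesis
    unfolding rmul_def tensor_map_def
    by (rule tensor_lift_linear_param[OF V A VxW.tensor_module E _ _ t])
      (intro tensor_map_bilinear[OF V W linear_map_id bilinear_map_left[OF f]]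
        linear_map_comp[OF bilinear_map_right[OF f] bilinear_map_right[OF VxW.pure_tensor_bilinear]]; assumption)+
qed

lemma (in right_alg_module) right_act_bilinear: "bilinear_map K M A M act"
  by (intro bilinear_mapI linear_mapI)
    (simp_all add: act_closed act_add_left act_add_right act_smult_left act_smult_right)

lemma (in left_alg_module) left_act_bilinear: "bilinear_map K A N N act"
  by (intro bilinear_mapI linear_mapI)
    (simp_all add: act_closed act_add_left act_add_right act_smult_left act_smult_right)

context assoc_algebra
begin

text \<open>Treating \<open>A\<close> as a module over itself lets the laws of \<open>lmul\<close>
  and \<open>rmul\<close> for M and N double as the bimodule laws of A \<otimes> A.\<close>

lemma right_regular: "right_alg_module K A A (\<otimes>\<^bsub>A\<^esub>)"
  by unfold_locales
    (simp_all add: mult_closed mult_assoc mult_add_left mult_add_right mult_smult_left mult_smult_right)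

lemma left_regular: "left_alg_module K A A (\<otimes>\<^bsub>A\<^esub>)"
  by unfold_locales
    (simp_all add: mult_closed mult_assoc mult_add_left mult_add_right mult_smult_left mult_smult_right)

end

lemma lmul_closed:
  assumes "right_alg_module K A M act" "module K W" "m \<in> carrier M" "t \<in> carrier (tensor K A W)"
  shows "lmul K M W act m t \<in> carrier (tensor K M W)"
proof -
  interpret right_alg_module K A M act by fact
  show ?thesis
    by (rule linear_map_closed[OF linear_map_lmul[OF M.module_axioms assms(2) algebra_module M.module_axioms
          right_act_bilinear assms(4)] assms(3)])
qed

lemma rmul_closed:
  assumes "left_alg_module K A N act" "module K V" "n \<in> carrier N" "t \<in> carrier (tensor K V A)"
  shows "rmul K V N act t n \<in> carrier (tensor K V N)"
proof -
  interpret left_alg_module K A N act by fact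
  show ?thesis
    by (rule linear_map_closed[OF linear_map_rmul[OF assms(2) N.module_axioms algebra_module N.module_axioms
          left_act_bilinear assms(4)] assms(3)])
qed

lemma lmul_diff:
  assumes "right_alg_module K A M act" "module K W" "m \<in> carrier M"
    and "t \<in> carrier (tensor K A W)" "u \<in> carrier (tensor K A W)"
  shows "lmul K M W act m (t \<ominus>\<^bsub>tensor K A W\<^esub> u)
    = lmul K M W act m t \<ominus>\<^bsub>tensor K M W\<^esub> lmul K M W act m u"
proof -
  interpret right_alg_module K A M act by fact
  show ?thesis
    unfolding lmul_def
    by (rule linear_map_minus[OF tensor_map_linear[OF M.module_axioms assms(2) algebra_module assms(2)
          bilinear_map_right[OF right_act_bilinear assms(3)] linear_map_id]])
      (intro module_pair.tensor_module module_pairI M.module_axioms algebra_module assms)+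
qed

lemma rmul_diff:
  assumes "left_alg_module K A N act" "module K V" "n \<in> carrier N"
    and "t \<in> carrier (tensor K V A)" "u \<in> carrier (tensor K V A)"
  shows "rmul K V N act (t \<ominus>\<^bsub>tensor K V A\<^esub> u) n
    = rmul K V N act t n \<ominus>\<^bsub>tensor K V N\<^esub> rmul K V N act u n"
proof -
  interpret left_alg_module K A N act by fact
  show ?thesis
    unfolding rmul_def
    by (rule linear_map_minus[OF tensor_map_linear[OF assms(2) N.module_axioms assms(2) algebra_module
          linear_map_id bilinear_map_left[OF left_act_bilinear assms(3)]]])
      (intro module_pair.tensor_module module_pairI N.module_axioms algebra_module assms)+
qed

text \<open>Composites of tensor maps are tensor maps of composites, which reduces the claim to
  \<open>act_mult\<close> on the first factor.\<close>

lemma lmul_lmul: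
  assumes "right_alg_module K A M act" "module K W" "m \<in> carrier M" "a \<in> carrier A"
    and "t \<in> carrier (tensor K A W)"
  shows "lmul K M W act m (lmul K A W (\<otimes>\<^bsub>A\<^esub>) a t) = lmul K M W act (act m a) t"
proof -
  interpret right_alg_module K A M act by fact
  note f = bilinear_map_right[OF right_act_bilinear assms(3)] and g = bilinear_map_right[OF mult_bilinear assms(4)]
  show ?thesis
    unfolding lmul_def tensor_map_comp[OF M.module_axioms assms(2) algebra_module assms(2)
        algebra_module assms(2) f linear_map_id g linear_map_id assms(5)]
    by (rule tensor_map_cong[OF M.module_axioms assms(2) algebra_module assms(2)
          linear_map_comp[OF g f] linear_map_id _ refl assms(5)])
      (rule act_mult[OF assms(3,4)])
qed

lemma rmul_rmul:
  assumes "left_alg_module K A N act" "module K V" "n \<in> carrier N" "a \<in> carrier A"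
    and "t \<in> carrier (tensor K V A)"
  shows "rmul K V N act (rmul K V A (\<otimes>\<^bsub>A\<^esub>) t a) n = rmul K V N act t (act a n)"
proof -
  interpret left_alg_module K A N act by fact
  note f = bilinear_map_left[OF left_act_bilinear assms(3)] and g = bilinear_map_left[OF mult_bilinear assms(4)]
  show ?thesis
    unfolding rmul_def tensor_map_comp[OF assms(2) N.module_axioms assms(2) algebra_module
        assms(2) algebra_module linear_map_id f linear_map_id g assms(5)]
    by (rule tensor_map_cong[OF assms(2) N.module_axioms assms(2) algebra_module
          linear_map_id linear_map_comp[OF g f] refl _ assms(5)])
      (rule act_mult[OF _ assms(4,3)])
qed

text \<open>Actions on different factors commute: both orders compose to the tensor map of a
  \<mapsto> ma and b \<mapsto> bn.\<close>

lemma lmul_rmul: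
  assumes M: "right_alg_module K A M ract" and N: "left_alg_module K A N lact"
    and m: "m \<in> carrier M" and n: "n \<in> carrier N" and t: "t \<in> carrier (tensor K A A)"
  shows "lmul K M N ract m (rmul K A N lact t n) = rmul K M N lact (lmul K M A ract m t) n"
proof -
  interpret M: right_alg_module K A M ract by fact
  interpret N: left_alg_module K A N lact by fact
  note f = bilinear_map_right[OF M.right_act_bilinear m] and g = bilinear_map_left[OF N.left_act_bilinear n]
  note A = M.algebra_module and mM = M.M.module_axioms and mN = N.N.module_axioms
  show ?thesis
    unfolding lmul_def rmul_def
      tensor_map_comp[OF mM mN A mN A A f linear_map_id linear_map_id g t]
      tensor_map_comp[OF mM mN mM A A A linear_map_id g f linear_map_id t] ..
qed

text \<open>The telescoping behind the product rules below: abt - tab splits at atb, and abr - sab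
  splits at arb or at asb. The second form has its summands in the order of \<Delta>(ab) =
  \<Delta>(a)b + a\<delta>_r(b).\<close>

lemma a_minus_add_minus:
  assumes "abelian_group G" "x \<in> carrier G" "y \<in> carrier G" "z \<in> carrier G"
  shows "(x \<ominus>\<^bsub>G\<^esub> y) \<oplus>\<^bsub>G\<^esub> (y \<ominus>\<^bsub>G\<^esub> z) = x \<ominus>\<^bsub>G\<^esub> z"
    and "(y \<ominus>\<^bsub>G\<^esub> z) \<oplus>\<^bsub>G\<^esub> (x \<ominus>\<^bsub>G\<^esub> y) = x \<ominus>\<^bsub>G\<^esub> z"
proof -
  interpret abelian_group G by fact
  show *: "(x \<ominus>\<^bsub>G\<^esub> y) \<oplus>\<^bsub>G\<^esub> (y \<ominus>\<^bsub>G\<^esub> z) = x \<ominus>\<^bsub>G\<^esub> z"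
    using assms(2-4) by (simp add: minus_eq a_assoc r_neg1)
  show "(y \<ominus>\<^bsub>G\<^esub> z) \<oplus>\<^bsub>G\<^esub> (x \<ominus>\<^bsub>G\<^esub> y) = x \<ominus>\<^bsub>G\<^esub> z"
    using assms(2-4) by (simp add: * a_comm)
qed

section \<open>Derivations and product rules for tensors r and s, from the bimodule laws
  alone\<close>

locale tensor_pair = assoc_algebra K A
  for K :: "('k, 'x) ring_scheme" (structure) and A :: "('k, 'a, 'y) module_scheme" (structure) +
  fixes r s :: "('a \<times> 'a \<Rightarrow> 'k) set"
  assumes r_closed: "r \<in> carrier (tensor K A A)" and s_closed: "s \<in> carrier (tensor K A A)"
begin

abbreviation "lA \<equiv> lmul K A A (\<otimes>\<^bsub>A\<^esub>)"
abbreviation "rA \<equiv> rmul K A A (\<otimes>\<^bsub>A\<^esub>)"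

sublocale AA: module K "tensor K A A"
  by (intro module_pair.tensor_module module_pairI algebra_module)

text \<open>Covers three maps at once: the inner derivations of r and of s, with \<open>t\<close>
  and \<open>u\<close> equal, and the comultiplication, with r for \<open>t\<close> and s for
  \<open>u\<close>.\<close>

lemma linear_inner_difference:
  assumes "t \<in> carrier (tensor K A A)" "u \<in> carrier (tensor K A A)"
  shows "linear_map K A (tensor K A A) (\<lambda>a. lA a t \<ominus>\<^bsub>tensor K A A\<^esub> rA u a)"
  by (rule linear_map_diff[OF linear_map_lmul linear_map_rmul])
    (rule algebra_module mult_bilinear AA.module_axioms assms)+

lemmas products_closed = lmul_closed[OF right_regular algebra_module] rmul_closed[OF left_regular algebra_module]

lemma derivation_inner:
  assumes t: "t \<in> carrier (tensor K A A)"
  shows "derivation K A (inner_derivation K A t)"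
  unfolding derivation_def inner_derivation_def
proof (intro conjI ballI linear_inner_difference t)
  fix a b assume a: "a \<in> carrier A" and b: "b \<in> carrier A"
  note cl = products_closed a b t
  show "lA (a \<otimes>\<^bsub>A\<^esub> b) t \<ominus>\<^bsub>tensor K A A\<^esub> rA t (a \<otimes>\<^bsub>A\<^esub> b)
      = lA a (lA b t \<ominus>\<^bsub>tensor K A A\<^esub> rA t b)
        \<oplus>\<^bsub>tensor K A A\<^esub> rA (lA a t \<ominus>\<^bsub>tensor K A A\<^esub> rA t a) b"
    by (simp add: cl mult_closed a_minus_add_minus[OF AA.M.abelian_group_axioms]
        lmul_diff[OF right_regular algebra_module] rmul_diff[OF left_regular algebra_module]
        lmul_lmul[OF right_regular algebra_module] rmul_rmul[OF left_regular algebra_module]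
        lmul_rmul[OF right_regular left_regular])
qed

lemma comult_mult:
  assumes a: "a \<in> carrier A" and b: "b \<in> carrier A"
  shows "quasitriangular_comult K A r s (a \<otimes>\<^bsub>A\<^esub> b) = rA (quasitriangular_comult K A r s a) b
      \<oplus>\<^bsub>tensor K A A\<^esub> lA a (inner_derivation K A r b)"
    and "quasitriangular_comult K A r s (a \<otimes>\<^bsub>A\<^esub> b) = lA a (quasitriangular_comult K A r s b)
      \<oplus>\<^bsub>tensor K A A\<^esub> rA (inner_derivation K A s a) b"
  by (simp_all add: inner_derivation_def quasitriangular_comult_def a b r_closed s_closed products_closed mult_closed
      a_minus_add_minus[OF AA.M.abelian_group_axioms]
        lmul_diff[OF right_regular algebra_module] rmul_diff[OF left_regular algebra_module]
      lmul_lmul[OF right_regular algebra_module] rmul_rmul[OF left_regular algebra_module]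
      lmul_rmul[OF right_regular left_regular])

text \<open>Since m(ra) = (mr)a, the term m\<delta>_r(a) is (ma)r - (mr)a, and adding (mr)a leaves
  (ma)r.\<close>

lemma right_coaction_act:
  assumes M: "right_alg_module K A M act" and m: "m \<in> carrier M" and a: "a \<in> carrier A"
  shows "lmul K M A act (act m a) r = rmul K M A (\<otimes>\<^bsub>A\<^esub>) (lmul K M A act m r) a
    \<oplus>\<^bsub>tensor K M A\<^esub> lmul K M A act m (inner_derivation K A r a)"
proof -
  interpret M: right_alg_module K A M act by fact
  interpret MA: module K "tensor K M A"
    by (intro module_pair.tensor_module module_pairI M.M.module_axioms algebra_module)
  have "x = y \<oplus>\<^bsub>tensor K M A\<^esub> (x \<ominus>\<^bsub>tensor K M A\<^esub> y)"
    if "x \<in> carrier (tensor K M A)" "y \<in> carrier (tensor K M A)" for x y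
    using that by (simp add: MA.M.minus_eq MA.M.a_lcomm MA.M.r_neg)
  then show ?thesis
    by (simp add: inner_derivation_def lmul_diff[OF M algebra_module] lmul_lmul[OF M algebra_module]
        lmul_rmul[OF M left_regular] m a r_closed products_closed M.act_closed
        lmul_closed[OF M algebra_module] rmul_closed[OF left_regular M.M.module_axioms])
qed

text \<open>Here the sign of the coaction matters: \<delta>_s(a)n = a(sn) - s(an), whose first term
  cancels against a(-sn).\<close>

lemma left_coaction_act:
  assumes N: "left_alg_module K A N act" and n: "n \<in> carrier N" and a: "a \<in> carrier A"
  shows "\<ominus>\<^bsub>tensor K A N\<^esub> rmul K A N act s (act a n)
    = lmul K A N (\<otimes>\<^bsub>A\<^esub>) a (\<ominus>\<^bsub>tensor K A N\<^esub> rmul K A N act s n)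
      \<oplus>\<^bsub>tensor K A N\<^esub> rmul K A N act (inner_derivation K A s a) n"
proof -
  interpret N: left_alg_module K A N act by fact
  interpret AN: module K "tensor K A N"
    by (intro module_pair.tensor_module module_pairI N.N.module_axioms algebra_module)
  have uminus: "lmul K A N (\<otimes>\<^bsub>A\<^esub>) a (\<ominus>\<^bsub>tensor K A N\<^esub> t)
      = \<ominus>\<^bsub>tensor K A N\<^esub> lmul K A N (\<otimes>\<^bsub>A\<^esub>) a t" if "t \<in> carrier (tensor K A N)" for t
  proof -
    have "lmul K A N (\<otimes>\<^bsub>A\<^esub>) a \<zero>\<^bsub>tensor K A N\<^esub> = \<zero>\<^bsub>tensor K A N\<^esub>"
      unfolding lmul_def
      by (rule linear_map_zero[OF tensor_map_linear[OF algebra_module N.N.module_axioms algebra_module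
            N.N.module_axioms bilinear_map_right[OF mult_bilinear a] linear_map_id]
            AN.module_axioms AN.module_axioms])
    then show ?thesis
      using lmul_diff[OF right_regular N.N.module_axioms a AN.M.zero_closed that]
        lmul_closed[OF right_regular N.N.module_axioms a that] that
      by (simp add: AN.M.minus_eq)
  qed
  have "\<ominus>\<^bsub>tensor K A N\<^esub> x = \<ominus>\<^bsub>tensor K A N\<^esub> y \<oplus>\<^bsub>tensor K A N\<^esub> (y \<ominus>\<^bsub>tensor K A N\<^esub> x)"
    if "x \<in> carrier (tensor K A N)" "y \<in> carrier (tensor K A N)" for x y
    using that by (simp add: AN.M.minus_eq AN.M.r_neg1)
  then show ?thesis
    by (simp add: uminus inner_derivation_def rmul_diff[OF N algebra_module] rmul_rmul[OF N algebra_module]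
        lmul_rmul[OF right_regular N] n a s_closed products_closed N.act_closed
        rmul_closed[OF N algebra_module] lmul_closed[OF right_regular N.N.module_axioms])
qed

end

section \<open>Coassociativity\<close>

lemma tensor_assoc_list_sum:
  assumes U: "module K U" and V: "module K V" and W: "module K W" and w: "w \<in> carrier W"
    and "\<And>x. x \<in> set xs \<Longrightarrow> h x \<in> carrier U" "\<And>x. x \<in> set xs \<Longrightarrow> k x \<in> carrier V"
  shows "tensor_assoc K U V W (pure_tensor K (tensor K U V) W
      (list_sum (tensor K U V) (\<lambda>x. pure_tensor K U V (h x) (k x)) xs) w)
    = list_sum (tensor K U (tensor K V W)) (\<lambda>x. pure_tensor3 K U V W (h x) (k x) w) xs"
proof -
  interpret UV: module_pair K U V by (intro module_pairI U V)
  interpret VW: module_pair K V W by (intro module_pairI V W)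
  interpret T: module_pair K U "tensor K V W" by (intro module_pairI U VW.tensor_module)
  interpret L: module_pair K "tensor K U V" W by (intro module_pairI UV.tensor_module W)
  have lin: "linear_map K (tensor K U V) (tensor K U (tensor K V W))
      (\<lambda>t. tensor_assoc K U V W (pure_tensor K (tensor K U V) W t w))"
    by (rule linear_map_comp[OF bilinear_map_left[OF L.pure_tensor_bilinear w] tensor_assoc_linear[OF U V W]])
  have "list_sum (tensor K U (tensor K V W)) (\<lambda>x. tensor_assoc K U V W
        (pure_tensor K (tensor K U V) W (pure_tensor K U V (h x) (k x)) w)) xs
      = list_sum (tensor K U (tensor K V W)) (\<lambda>x. pure_tensor3 K U V W (h x) (k x) w) xs"
    by (intro list_sum_cong refl tensor_assoc_pure[OF U V W] assms)
  then show ?thesis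
    by (subst linear_map_list_sum[OF lin UV.tensor_module T.tensor_module])
      (auto intro!: pure_tensor_closed[OF U V] assms)
qed

lemma pure_tensor3_closed:
  assumes "module K U" "module K V" "module K W" "u \<in> carrier U" "v \<in> carrier V" "w \<in> carrier W"
  shows "pure_tensor3 K U V W u v w \<in> carrier (tensor K U (tensor K V W))"
  by (intro pure_tensor_closed module_pair.tensor_module module_pairI assms)

lemma pure_tensor_list_sum:
  assumes U: "module K U" and V: "module K V" and W: "module K W" and u: "u \<in> carrier U"
    and "\<And>x. x \<in> set xs \<Longrightarrow> h x \<in> carrier V" "\<And>x. x \<in> set xs \<Longrightarrow> k x \<in> carrier W"
  shows "pure_tensor K U (tensor K V W) u
      (list_sum (tensor K V W) (\<lambda>x. pure_tensor K V W (h x) (k x)) xs)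
    = list_sum (tensor K U (tensor K V W)) (\<lambda>x. pure_tensor3 K U V W u (h x) (k x)) xs"
proof -
  interpret VW: module_pair K V W by (intro module_pairI V W)
  interpret T: module_pair K U "tensor K V W" by (intro module_pairI U VW.tensor_module)
  show ?thesis
    by (rule linear_map_list_sum[OF bilinear_map_right[OF T.pure_tensor_bilinear u]
          VW.tensor_module T.tensor_module pure_tensor_closed[OF V W assms(5,6)]])
qed

section \<open>The comultiplication expanded along lists that represent r and s\<close>

locale yang_baxter_lists = assoc_algebra K A
  for K :: "('k, 'x) ring_scheme" (structure) and A :: "('k, 'a, 'y) module_scheme" (structure) +
  fixes xs ys :: "('a \<times> 'a) list"
  assumes xs: "set xs \<subseteq> carrier A \<times> carrier A" and ys: "set ys \<subseteq> carrier A \<times> carrier A"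
    and sums: "yang_baxter_sums K A xs ys"
begin

abbreviation "r \<equiv> list_tensor K A A xs"
abbreviation "s \<equiv> list_tensor K A A ys"
abbreviation "\<Delta> \<equiv> quasitriangular_comult K A r s"

lemma xs_closed: "x \<in> set xs \<Longrightarrow> fst x \<in> carrier A" "x \<in> set xs \<Longrightarrow> snd x \<in> carrier A"
  using xs by auto

lemma ys_closed: "y \<in> set ys \<Longrightarrow> fst y \<in> carrier A" "y \<in> set ys \<Longrightarrow> snd y \<in> carrier A"
  using ys by auto

sublocale tensor_pair K A r s
proof unfold_locales
  interpret AxA: module_pair K A A by (intro module_pairI algebra_module)
  interpret AA: module K "tensor K A A" by (rule AxA.tensor_module)
  show "r \<in> carrier (tensor K A A)"
    by (intro AA.M.list_sum_closed pure_tensor_closed algebra_module xs_closed)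
  show "s \<in> carrier (tensor K A A)"
    by (intro AA.M.list_sum_closed pure_tensor_closed algebra_module ys_closed)
qed

lemma comult_sums:
  assumes "a \<in> carrier A"
  shows "\<Delta> a = list_sum (tensor K A A) (\<lambda>x. pure_tensor K A A (a \<otimes>\<^bsub>A\<^esub> fst x) (snd x)) xs
    \<ominus>\<^bsub>tensor K A A\<^esub> list_sum (tensor K A A) (\<lambda>y. pure_tensor K A A (fst y) (snd y \<otimes>\<^bsub>A\<^esub> a)) ys"
  unfolding quasitriangular_comult_def lmul_def rmul_def
    tensor_map_list_tensor[OF algebra_module algebra_module algebra_module algebra_module
      bilinear_map_right[OF mult_bilinear assms] linear_map_id xs]
    tensor_map_list_tensor[OF algebra_module algebra_module algebra_module algebra_module
      linear_map_id bilinear_map_left[OF mult_bilinear assms] ys] ..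

lemma comult_linear: "linear_map K A (tensor K A A) \<Delta>"
  using linear_inner_difference[OF r_closed s_closed]
  by (simp add: quasitriangular_comult_def[abs_def])

text \<open>Inserting \<Delta>(h) = hr - sh in the first factor gives two double sums. The entries
  and the module \<open>N\<close> are kept general, so that the formula applies to ar and sa in the
  coassociativity of \<Delta> and to sn for the left coaction.\<close>

lemma assoc_comult_sum:
  assumes N: "module K N"
    and h: "\<And>z. z \<in> set zs \<Longrightarrow> h z \<in> carrier A" and k: "\<And>z. z \<in> set zs \<Longrightarrow> k z \<in> carrier N"
  shows "tensor_assoc K A A N (tensor_map K (tensor K A A) N \<Delta> (\<lambda>x. x)
      (list_sum (tensor K A N) (\<lambda>z. pure_tensor K A N (h z) (k z)) zs))
    = list_sum (tensor K A (tensor K A N))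
        (\<lambda>z. list_sum (tensor K A (tensor K A N))
          (\<lambda>x. pure_tensor3 K A A N (h z \<otimes>\<^bsub>A\<^esub> fst x) (snd x) (k z)) xs) zs
      \<ominus>\<^bsub>tensor K A (tensor K A N)\<^esub> list_sum (tensor K A (tensor K A N))
        (\<lambda>z. list_sum (tensor K A (tensor K A N))
          (\<lambda>y. pure_tensor3 K A A N (fst y) (snd y \<otimes>\<^bsub>A\<^esub> h z) (k z)) ys) zs"
    (is "_ = list_sum ?T ?f zs \<ominus>\<^bsub>?T\<^esub> list_sum ?T ?g zs")
proof -
  let ?AA = "tensor K A A"
  note A = algebra_module
  interpret AxN: module_pair K A N by (intro module_pairI A N)
  interpret T: module_pair K A "tensor K A N" by (intro module_pairI A AxN.tensor_module)
  interpret L: module_pair K ?AA N by (intro module_pairI AA.module_axioms N)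
  interpret Tm: module K ?T by (rule T.tensor_module)
  have lin: "linear_map K (tensor K ?AA N) ?T (tensor_assoc K A A N)"
    by (rule tensor_assoc_linear[OF A A N])
  have f: "?f z \<in> carrier ?T" and g: "?g z \<in> carrier ?T" if "z \<in> set zs" for z
    by (intro Tm.M.list_sum_closed pure_tensor3_closed A N mult_closed h[OF that] k[OF that]
        xs_closed ys_closed; assumption)+
  have step: "tensor_assoc K A A N (pure_tensor K ?AA N (\<Delta> (h z)) (k z)) = ?f z \<ominus>\<^bsub>?T\<^esub> ?g z"
    if z: "z \<in> set zs" for z
  proof -
    have l: "linear_map K ?AA ?T (\<lambda>t. tensor_assoc K A A N (pure_tensor K ?AA N t (k z)))"
      by (rule linear_map_comp[OF bilinear_map_left[OF L.pure_tensor_bilinear k[OF z]] lin])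
    have x: "list_sum ?AA (\<lambda>x. pure_tensor K A A (h z \<otimes>\<^bsub>A\<^esub> fst x) (snd x)) xs \<in> carrier ?AA"
      by (intro AA.M.list_sum_closed pure_tensor_closed A mult_closed h[OF z] xs_closed)
    have y: "list_sum ?AA (\<lambda>y. pure_tensor K A A (fst y) (snd y \<otimes>\<^bsub>A\<^esub> h z)) ys \<in> carrier ?AA"
      by (intro AA.M.list_sum_closed pure_tensor_closed A mult_closed h[OF z] ys_closed)
    show ?thesis
      unfolding comult_sums[OF h[OF z]] linear_map_minus[OF l AA.module_axioms Tm.module_axioms x y]
      by (intro arg_cong2[where f = "a_minus ?T"] tensor_assoc_list_sum[OF A A N k[OF z]]
          mult_closed h[OF z] xs_closed ys_closed)
  qed
  have "tensor_assoc K A A N (tensor_map K ?AA N \<Delta> (\<lambda>x. x)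
      (list_sum (tensor K A N) (\<lambda>z. pure_tensor K A N (h z) (k z)) zs))
    = tensor_assoc K A A N (list_sum (tensor K ?AA N) (\<lambda>z. pure_tensor K ?AA N (\<Delta> (h z)) (k z)) zs)"
    by (rule arg_cong[OF tensor_map_list_sum[OF AA.module_axioms N A N comult_linear linear_map_id h k]])
  also have "\<dots> = list_sum ?T (\<lambda>z. tensor_assoc K A A N (pure_tensor K ?AA N (\<Delta> (h z)) (k z))) zs"
    by (rule linear_map_list_sum[OF lin L.tensor_module T.tensor_module])
      (intro pure_tensor_closed AA.module_axioms N linear_map_closed[OF comult_linear] h k; assumption)
  also have "\<dots> = list_sum ?T (\<lambda>z. ?f z \<ominus>\<^bsub>?T\<^esub> ?g z) zs"
    by (intro list_sum_cong refl step)
  also have "\<dots> = list_sum ?T ?f zs \<ominus>\<^bsub>?T\<^esub> list_sum ?T ?g zs"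
    by (rule Tm.M.list_sum_diff[OF f g])
  finally show ?thesis .
qed

text \<open>The mirror image of \<open>assoc_comult_sum\<close>, with \<Delta> in the second factor,
  where the bracketing is already the desired one. It serves ar and sa in the coassociativity of
  \<Delta> and mr for the right coaction.\<close>

lemma comult_sum_right:
  assumes M: "module K M"
    and h: "\<And>z. z \<in> set zs \<Longrightarrow> h z \<in> carrier M" and k: "\<And>z. z \<in> set zs \<Longrightarrow> k z \<in> carrier A"
  shows "tensor_map K M (tensor K A A) (\<lambda>x. x) \<Delta>
      (list_sum (tensor K M A) (\<lambda>z. pure_tensor K M A (h z) (k z)) zs)
    = list_sum (tensor K M (tensor K A A))
        (\<lambda>z. list_sum (tensor K M (tensor K A A))
          (\<lambda>x. pure_tensor3 K M A A (h z) (k z \<otimes>\<^bsub>A\<^esub> fst x) (snd x)) xs) zs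
      \<ominus>\<^bsub>tensor K M (tensor K A A)\<^esub> list_sum (tensor K M (tensor K A A))
        (\<lambda>z. list_sum (tensor K M (tensor K A A))
          (\<lambda>y. pure_tensor3 K M A A (h z) (fst y) (snd y \<otimes>\<^bsub>A\<^esub> k z)) ys) zs"
    (is "_ = list_sum ?T ?f zs \<ominus>\<^bsub>?T\<^esub> list_sum ?T ?g zs")
proof -
  let ?AA = "tensor K A A"
  note A = algebra_module
  interpret T: module_pair K M ?AA by (intro module_pairI M AA.module_axioms)
  interpret Tm: module K ?T by (rule T.tensor_module)
  have f: "?f z \<in> carrier ?T" and g: "?g z \<in> carrier ?T" if "z \<in> set zs" for z
    by (intro Tm.M.list_sum_closed pure_tensor3_closed A M mult_closed h[OF that] k[OF that]
        xs_closed ys_closed; assumption)+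
  have step: "pure_tensor K M ?AA (h z) (\<Delta> (k z)) = ?f z \<ominus>\<^bsub>?T\<^esub> ?g z"
    if z: "z \<in> set zs" for z
  proof -
    note l = bilinear_map_right[OF T.pure_tensor_bilinear h[OF z]]
    have x: "list_sum ?AA (\<lambda>x. pure_tensor K A A (k z \<otimes>\<^bsub>A\<^esub> fst x) (snd x)) xs \<in> carrier ?AA"
      by (intro AA.M.list_sum_closed pure_tensor_closed A mult_closed k[OF z] xs_closed)
    have y: "list_sum ?AA (\<lambda>y. pure_tensor K A A (fst y) (snd y \<otimes>\<^bsub>A\<^esub> k z)) ys \<in> carrier ?AA"
      by (intro AA.M.list_sum_closed pure_tensor_closed A mult_closed k[OF z] ys_closed)
    show ?thesis
      unfolding comult_sums[OF k[OF z]] linear_map_minus[OF l AA.module_axioms Tm.module_axioms x y]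
      by (intro arg_cong2[where f = "a_minus ?T"] pure_tensor_list_sum[OF M A A h[OF z]]
          mult_closed k[OF z] xs_closed ys_closed)
  qed
  have "tensor_map K M ?AA (\<lambda>x. x) \<Delta> (list_sum (tensor K M A) (\<lambda>z. pure_tensor K M A (h z) (k z)) zs)
    = list_sum ?T (\<lambda>z. pure_tensor K M ?AA (h z) (\<Delta> (k z))) zs"
    by (rule tensor_map_list_sum[OF M AA.module_axioms M A linear_map_id comult_linear h k])
  also have "\<dots> = list_sum ?T (\<lambda>z. ?f z \<ominus>\<^bsub>?T\<^esub> ?g z) zs"
    by (intro list_sum_cong refl step)
  also have "\<dots> = list_sum ?T ?f zs \<ominus>\<^bsub>?T\<^esub> list_sum ?T ?g zs"
    by (rule Tm.M.list_sum_diff[OF f g])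
  finally show ?thesis .
qed

section \<open>The Yang-Baxter equations transported to modules\<close>

abbreviation "P \<equiv> pure_tensor3 K A A A"
abbreviation "U \<equiv> tensor K A (tensor K A A)"

sublocale U: module K U
  by (intro module_pair.tensor_module module_pairI algebra_module)

lemmas P_closed = pure_tensor3_closed[OF algebra_module algebra_module algebra_module]

text \<open>The first equation, solved for r13 r12, under a \<mapsto> ma on its first leg. The left
  side is the coaction applied twice to m; the right side has the shape that
  \<open>comult_sum_right\<close> produces.\<close>

lemma right_yang_baxter:
  assumes M: "right_alg_module K A M act" and m: "m \<in> carrier M"
  shows "list_sum (tensor K M (tensor K A A)) (\<lambda>x. list_sum (tensor K M (tensor K A A)) (\<lambda>x'.
        pure_tensor3 K M A A (act (act m (fst x)) (fst x')) (snd x') (snd x)) xs) xs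
    = list_sum (tensor K M (tensor K A A)) (\<lambda>x. list_sum (tensor K M (tensor K A A)) (\<lambda>x'.
        pure_tensor3 K M A A (act m (fst x)) (snd x \<otimes>\<^bsub>A\<^esub> fst x') (snd x')) xs) xs
      \<ominus>\<^bsub>tensor K M (tensor K A A)\<^esub>
      list_sum (tensor K M (tensor K A A)) (\<lambda>x. list_sum (tensor K M (tensor K A A)) (\<lambda>y.
        pure_tensor3 K M A A (act m (fst x)) (fst y) (snd y \<otimes>\<^bsub>A\<^esub> snd x)) ys) xs"
    (is "list_sum ?T _ _ = _")
proof -
  interpret M: right_alg_module K A M act by fact
  note A = algebra_module and mM = M.M.module_axioms
  interpret T: module K ?T
    by (intro module_pair.tensor_module module_pairI A mM)
  define L where "L = tensor_map K M (tensor K A A) (act m) (\<lambda>x. x)"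
  note act = bilinear_map_right[OF M.right_act_bilinear m]
  have L: "linear_map K U ?T L"
    unfolding L_def by (rule tensor_map_linear[OF mM AA.module_axioms A AA.module_axioms act linear_map_id])
  have L_P: "L (P a b c) = pure_tensor3 K M A A (act m a) b c"
    if "a \<in> carrier A" "b \<in> carrier A" "c \<in> carrier A" for a b c
    unfolding L_def
    by (intro tensor_map_pure[OF mM AA.module_axioms A AA.module_axioms act linear_map_id]
        pure_tensor_closed A that)
  note L2 = linear_map_list_sum2[OF L U.module_axioms T.module_axioms]
  note cl = xs_closed ys_closed
  note eq = sums[unfolded yang_baxter_sums_def Let_def, THEN conjunct1]
  have "L (list_sum U (\<lambda>x. list_sum U (\<lambda>x'. P (fst x \<otimes>\<^bsub>A\<^esub> fst x') (snd x') (snd x)) xs) xs)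
      = L (list_sum U (\<lambda>x. list_sum U (\<lambda>x'. P (fst x) (snd x \<otimes>\<^bsub>A\<^esub> fst x') (snd x')) xs) xs)
        \<ominus>\<^bsub>?T\<^esub> L (list_sum U (\<lambda>y. list_sum U (\<lambda>x. P (fst x) (fst y) (snd y \<otimes>\<^bsub>A\<^esub> snd x)) xs) ys)"
    by (rule linear_map_solve[OF L U.module_axioms T.module_axioms _ _ _ eq])
      (intro U.M.list_sum_closed P_closed mult_closed cl; assumption)+
  \<comment> \<open>In s23 r13 the sum over s stands outside; the swap brings the sum over r out, as
    in the expansion of the comultiplication.\<close>
  also have "list_sum U (\<lambda>y. list_sum U (\<lambda>x. P (fst x) (fst y) (snd y \<otimes>\<^bsub>A\<^esub> snd x)) xs) ys
      = list_sum U (\<lambda>x. list_sum U (\<lambda>y. P (fst x) (fst y) (snd y \<otimes>\<^bsub>A\<^esub> snd x)) ys) xs"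
    by (intro U.M.list_sum_swap P_closed mult_closed cl)
  also have "L (list_sum U (\<lambda>x. list_sum U (\<lambda>x'. P (fst x \<otimes>\<^bsub>A\<^esub> fst x') (snd x') (snd x)) xs) xs)
      = list_sum ?T (\<lambda>x. list_sum ?T (\<lambda>x'. L (P (fst x \<otimes>\<^bsub>A\<^esub> fst x') (snd x') (snd x))) xs) xs"
    by (intro L2 P_closed mult_closed cl)
  \<comment> \<open>The product in the first leg becomes two successive actions, as in the iterated
    coaction.\<close>
  also have "\<dots> = list_sum ?T (\<lambda>x. list_sum ?T (\<lambda>x'.
      pure_tensor3 K M A A (act (act m (fst x)) (fst x')) (snd x') (snd x)) xs) xs"
    by (intro list_sum_cong refl) (simp add: L_P mult_closed cl M.act_mult m)
  also have "L (list_sum U (\<lambda>x. list_sum U (\<lambda>x'. P (fst x) (snd x \<otimes>\<^bsub>A\<^esub> fst x') (snd x')) xs) xs)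
      = list_sum ?T (\<lambda>x. list_sum ?T (\<lambda>x'. L (P (fst x) (snd x \<otimes>\<^bsub>A\<^esub> fst x') (snd x'))) xs) xs"
    by (intro L2 P_closed mult_closed cl)
  also have "\<dots> = list_sum ?T (\<lambda>x. list_sum ?T (\<lambda>x'.
      pure_tensor3 K M A A (act m (fst x)) (snd x \<otimes>\<^bsub>A\<^esub> fst x') (snd x')) xs) xs"
    by (intro list_sum_cong refl L_P mult_closed cl)
  also have "L (list_sum U (\<lambda>x. list_sum U (\<lambda>y. P (fst x) (fst y) (snd y \<otimes>\<^bsub>A\<^esub> snd x)) ys) xs)
      = list_sum ?T (\<lambda>x. list_sum ?T (\<lambda>y. L (P (fst x) (fst y) (snd y \<otimes>\<^bsub>A\<^esub> snd x))) ys) xs"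
    by (intro L2 P_closed mult_closed cl)
  also have "\<dots> = list_sum ?T (\<lambda>x. list_sum ?T (\<lambda>y.
      pure_tensor3 K M A A (act m (fst x)) (fst y) (snd y \<otimes>\<^bsub>A\<^esub> snd x)) ys) xs"
    by (intro list_sum_cong refl L_P mult_closed cl)
  finally show ?thesis .
qed

text \<open>The second equation, solved for s13 r12, under c \<mapsto> cn on its last leg. The left
  side and the first term on the right are the two double sums of \<open>assoc_comult_sum\<close> at
  sn; the last term is the map n \<mapsto> sn applied twice.\<close>

lemma left_yang_baxter:
  assumes N: "left_alg_module K A N act" and n: "n \<in> carrier N"
  shows "list_sum (tensor K A (tensor K A N)) (\<lambda>y. list_sum (tensor K A (tensor K A N)) (\<lambda>x.
        pure_tensor3 K A A N (fst y \<otimes>\<^bsub>A\<^esub> fst x) (snd x) (act (snd y) n)) xs) ys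
    = list_sum (tensor K A (tensor K A N)) (\<lambda>y'. list_sum (tensor K A (tensor K A N)) (\<lambda>y.
        pure_tensor3 K A A N (fst y) (snd y \<otimes>\<^bsub>A\<^esub> fst y') (act (snd y') n)) ys) ys
      \<ominus>\<^bsub>tensor K A (tensor K A N)\<^esub>
      list_sum (tensor K A (tensor K A N)) (\<lambda>y'. list_sum (tensor K A (tensor K A N)) (\<lambda>y.
        pure_tensor3 K A A N (fst y') (fst y) (act (snd y) (act (snd y') n))) ys) ys"
    (is "list_sum ?T _ _ = _")
proof -
  interpret N: left_alg_module K A N act by fact
  note A = algebra_module and mN = N.N.module_axioms
  interpret AN: module K "tensor K A N"
    by (intro module_pair.tensor_module module_pairI A mN)
  interpret T: module K ?T
    by (intro module_pair.tensor_module module_pairI A mN)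
  \<comment> \<open>The last leg sits inside the inner tensor product, hence two levels:
    \<open>L'\<close> acts there and \<open>L\<close> extends it by the identity.\<close>
  define L' where "L' = tensor_map K A N (\<lambda>x. x) (\<lambda>a. act a n)"
  define L where "L = tensor_map K A (tensor K A N) (\<lambda>x. x) L'"
  note act = bilinear_map_left[OF N.left_act_bilinear n]
  have L': "linear_map K (tensor K A A) (tensor K A N) L'"
    unfolding L'_def by (rule tensor_map_linear[OF A mN A A linear_map_id act])
  have L: "linear_map K U ?T L"
    unfolding L_def by (rule tensor_map_linear[OF A AN.module_axioms A AA.module_axioms linear_map_id L'])
  have L_P: "L (P a b c) = pure_tensor3 K A A N a b (act c n)"
    if "a \<in> carrier A" "b \<in> carrier A" "c \<in> carrier A" for a b c
    using that pure_tensor_closed[OF A A that(2,3)] unfolding L_def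
    by (simp add: tensor_map_pure[OF A AN.module_axioms A AA.module_axioms linear_map_id L'])
      (simp add: L'_def tensor_map_pure[OF A mN A A linear_map_id act])
  note L2 = linear_map_list_sum2[OF L U.module_axioms T.module_axioms]
  note cl = xs_closed ys_closed
  note eq = sums[unfolded yang_baxter_sums_def Let_def, THEN conjunct2]
  have "L (list_sum U (\<lambda>y. list_sum U (\<lambda>x. P (fst y \<otimes>\<^bsub>A\<^esub> fst x) (snd x) (snd y)) xs) ys)
      = L (list_sum U (\<lambda>y. list_sum U (\<lambda>y'. P (fst y) (snd y \<otimes>\<^bsub>A\<^esub> fst y') (snd y')) ys) ys)
        \<ominus>\<^bsub>?T\<^esub> L (list_sum U (\<lambda>y. list_sum U (\<lambda>y'. P (fst y') (fst y) (snd y \<otimes>\<^bsub>A\<^esub> snd y')) ys) ys)"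
    by (rule linear_map_solve[OF L U.module_axioms T.module_axioms _ _ _ eq])
      (intro U.M.list_sum_closed P_closed mult_closed cl; assumption)+
  \<comment> \<open>This swap and the next make the outer index the pair whose second entry acts on
    n first.\<close>
  also have "list_sum U (\<lambda>y. list_sum U (\<lambda>y'. P (fst y) (snd y \<otimes>\<^bsub>A\<^esub> fst y') (snd y')) ys) ys
      = list_sum U (\<lambda>y'. list_sum U (\<lambda>y. P (fst y) (snd y \<otimes>\<^bsub>A\<^esub> fst y') (snd y')) ys) ys"
    by (intro U.M.list_sum_swap P_closed mult_closed cl)
  also have "list_sum U (\<lambda>y. list_sum U (\<lambda>y'. P (fst y') (fst y) (snd y \<otimes>\<^bsub>A\<^esub> snd y')) ys) ys
      = list_sum U (\<lambda>y'. list_sum U (\<lambda>y. P (fst y') (fst y) (snd y \<otimes>\<^bsub>A\<^esub> snd y')) ys) ys"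
    by (intro U.M.list_sum_swap P_closed mult_closed cl)
  also have "L (list_sum U (\<lambda>y. list_sum U (\<lambda>x. P (fst y \<otimes>\<^bsub>A\<^esub> fst x) (snd x) (snd y)) xs) ys)
      = list_sum ?T (\<lambda>y. list_sum ?T (\<lambda>x. L (P (fst y \<otimes>\<^bsub>A\<^esub> fst x) (snd x) (snd y))) xs) ys"
    by (intro L2 P_closed mult_closed cl)
  also have "\<dots> = list_sum ?T (\<lambda>y. list_sum ?T (\<lambda>x.
      pure_tensor3 K A A N (fst y \<otimes>\<^bsub>A\<^esub> fst x) (snd x) (act (snd y) n)) xs) ys"
    by (intro list_sum_cong refl L_P mult_closed cl)
  also have "L (list_sum U (\<lambda>y'. list_sum U (\<lambda>y. P (fst y) (snd y \<otimes>\<^bsub>A\<^esub> fst y') (snd y')) ys) ys)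
      = list_sum ?T (\<lambda>y'. list_sum ?T (\<lambda>y. L (P (fst y) (snd y \<otimes>\<^bsub>A\<^esub> fst y') (snd y'))) ys) ys"
    by (intro L2 P_closed mult_closed cl)
  also have "\<dots> = list_sum ?T (\<lambda>y'. list_sum ?T (\<lambda>y.
      pure_tensor3 K A A N (fst y) (snd y \<otimes>\<^bsub>A\<^esub> fst y') (act (snd y') n)) ys) ys"
    by (intro list_sum_cong refl L_P mult_closed cl)
  also have "L (list_sum U (\<lambda>y'. list_sum U (\<lambda>y. P (fst y') (fst y) (snd y \<otimes>\<^bsub>A\<^esub> snd y')) ys) ys)
      = list_sum ?T (\<lambda>y'. list_sum ?T (\<lambda>y. L (P (fst y') (fst y) (snd y \<otimes>\<^bsub>A\<^esub> snd y'))) ys) ys"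
    by (intro L2 P_closed mult_closed cl)
  also have "\<dots> = list_sum ?T (\<lambda>y'. list_sum ?T (\<lambda>y.
      pure_tensor3 K A A N (fst y') (fst y) (act (snd y) (act (snd y') n))) ys) ys"
    by (intro list_sum_cong refl) (simp add: L_P mult_closed cl N.act_mult n)
  finally show ?thesis .
qed

text \<open>The first equation turns (\<Delta> \<otimes> id)(ar) into \<open>a2\<close> -
  \<open>a3\<close> - \<open>c\<close>, the second turns (\<Delta> \<otimes> id)(sa) into
  -\<open>b3\<close>. Plain expansion of (id \<otimes> \<Delta>) gives \<open>a2\<close> -
  \<open>a3\<close> on ar and \<open>c\<close> - \<open>b3\<close> on sa, so the differences
  agree.\<close>

lemma comult_coassoc:
  assumes a: "a \<in> carrier A"
  shows "tensor_assoc K A A A (tensor_map K (tensor K A A) A \<Delta> (\<lambda>x. x) (\<Delta> a)) =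
      tensor_map K A (tensor K A A) (\<lambda>x. x) \<Delta> (\<Delta> a)"
proof -
  let ?AA = "tensor K A A"
  note A = algebra_module and AA = AA.module_axioms
  note cl = xs_closed ys_closed
  interpret L: module_pair K ?AA A by (intro module_pairI A AA)
  let ?r = "list_sum ?AA (\<lambda>x. pure_tensor K A A (a \<otimes>\<^bsub>A\<^esub> fst x) (snd x)) xs"
  let ?s = "list_sum ?AA (\<lambda>y. pure_tensor K A A (fst y) (snd y \<otimes>\<^bsub>A\<^esub> a)) ys"
  have r: "?r \<in> carrier ?AA" and s: "?s \<in> carrier ?AA"
    by (intro AA.M.list_sum_closed pure_tensor_closed A mult_closed a cl; assumption)+
  have l: "linear_map K ?AA U (\<lambda>t. tensor_assoc K A A A (tensor_map K ?AA A \<Delta> (\<lambda>x. x) t))"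
    by (rule linear_map_comp[OF tensor_map_linear[OF AA A A A comult_linear linear_map_id]
          tensor_assoc_linear[OF A A A]])
  have l': "linear_map K ?AA U (tensor_map K A ?AA (\<lambda>x. x) \<Delta>)"
    by (rule tensor_map_linear[OF A AA A A linear_map_id comult_linear])
  \<comment> \<open>In this order: a(r12 r23), a(s23 r13), (s12 s23)a, (s23 s13)a, and the mixed
    term as it appears in (id \<otimes> \<Delta>)(sa).\<close>
  define a2 where "a2 = list_sum U (\<lambda>x. list_sum U (\<lambda>x'.
      P (a \<otimes>\<^bsub>A\<^esub> fst x) (snd x \<otimes>\<^bsub>A\<^esub> fst x') (snd x')) xs) xs"
  define a3 where "a3 = list_sum U (\<lambda>x. list_sum U (\<lambda>y.
      P (a \<otimes>\<^bsub>A\<^esub> fst x) (fst y) (snd y \<otimes>\<^bsub>A\<^esub> snd x)) ys) xs"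
  define b2 where "b2 = list_sum U (\<lambda>y'. list_sum U (\<lambda>y.
      P (fst y) (snd y \<otimes>\<^bsub>A\<^esub> fst y') (snd y' \<otimes>\<^bsub>A\<^esub> a)) ys) ys"
  define b3 where "b3 = list_sum U (\<lambda>y'. list_sum U (\<lambda>y.
      P (fst y') (fst y) (snd y \<otimes>\<^bsub>A\<^esub> (snd y' \<otimes>\<^bsub>A\<^esub> a))) ys) ys"
  define c where "c = list_sum U (\<lambda>y. list_sum U (\<lambda>x.
      P (fst y) ((snd y \<otimes>\<^bsub>A\<^esub> a) \<otimes>\<^bsub>A\<^esub> fst x) (snd x)) xs) ys"
  have abc: "a2 \<in> carrier U" "a3 \<in> carrier U" "b2 \<in> carrier U" "b3 \<in> carrier U" "c \<in> carrier U"
    unfolding a2_def a3_def b2_def b3_def c_def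
    by (intro U.M.list_sum_closed P_closed mult_closed a cl; assumption)+
  \<comment> \<open>From (\<Delta> \<otimes> id)(ar) the mixed term arrives with the other
    bracketing and with the sum over r outside; associativity and a swap identify it with
    \<open>c\<close>.\<close>
  have c_eq: "list_sum U (\<lambda>x. list_sum U (\<lambda>y. P (fst y) (snd y \<otimes>\<^bsub>A\<^esub> (a \<otimes>\<^bsub>A\<^esub> fst x)) (snd x)) ys) xs = c"
  proof -
    have "list_sum U (\<lambda>x. list_sum U (\<lambda>y. P (fst y) (snd y \<otimes>\<^bsub>A\<^esub> (a \<otimes>\<^bsub>A\<^esub> fst x)) (snd x)) ys) xs
        = list_sum U (\<lambda>x. list_sum U (\<lambda>y. P (fst y) ((snd y \<otimes>\<^bsub>A\<^esub> a) \<otimes>\<^bsub>A\<^esub> fst x) (snd x)) ys) xs"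
      by (intro list_sum_cong refl) (simp add: mult_assoc a cl)
    also have "\<dots> = c"
      unfolding c_def by (intro U.M.list_sum_swap P_closed mult_closed a cl)
    finally show ?thesis .
  qed
  have "tensor_assoc K A A A (tensor_map K ?AA A \<Delta> (\<lambda>x. x) (\<Delta> a))
      = tensor_assoc K A A A (tensor_map K ?AA A \<Delta> (\<lambda>x. x) ?r)
        \<ominus>\<^bsub>U\<^esub> tensor_assoc K A A A (tensor_map K ?AA A \<Delta> (\<lambda>x. x) ?s)"
    unfolding comult_sums[OF a] by (rule linear_map_minus[OF l AA U.module_axioms r s])
  also have "tensor_assoc K A A A (tensor_map K ?AA A \<Delta> (\<lambda>x. x) ?r) = (a2 \<ominus>\<^bsub>U\<^esub> a3) \<ominus>\<^bsub>U\<^esub> c"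
    unfolding a2_def a3_def right_yang_baxter[OF right_regular a, symmetric] c_eq[symmetric]
    by (rule assoc_comult_sum[OF A]) (intro mult_closed a cl; assumption)+
  \<comment> \<open>The term (s12 s23)a occurs with opposite signs, once from the second equation
    and once from the expansion of \<Delta>.\<close>
  also have "tensor_assoc K A A A (tensor_map K ?AA A \<Delta> (\<lambda>x. x) ?s) = (b2 \<ominus>\<^bsub>U\<^esub> b3) \<ominus>\<^bsub>U\<^esub> b2"
    unfolding b3_def b2_def left_yang_baxter[OF left_regular a, symmetric]
    by (rule assoc_comult_sum[OF A]) (intro mult_closed a cl; assumption)+
  also have "((a2 \<ominus>\<^bsub>U\<^esub> a3) \<ominus>\<^bsub>U\<^esub> c) \<ominus>\<^bsub>U\<^esub> ((b2 \<ominus>\<^bsub>U\<^esub> b3) \<ominus>\<^bsub>U\<^esub> b2) = (a2 \<ominus>\<^bsub>U\<^esub> a3) \<ominus>\<^bsub>U\<^esub> (c \<ominus>\<^bsub>U\<^esub> b3)"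
    using abc by (simp add: U.M.minus_eq U.M.minus_add U.M.a_ac U.M.r_neg1 U.M.r_neg2 U.M.r_neg)
  also have "a2 \<ominus>\<^bsub>U\<^esub> a3 = tensor_map K A ?AA (\<lambda>x. x) \<Delta> ?r"
    unfolding a2_def a3_def
    by (rule comult_sum_right[OF A, symmetric]) (intro mult_closed a cl; assumption)+
  also have "c \<ominus>\<^bsub>U\<^esub> b3 = tensor_map K A ?AA (\<lambda>x. x) \<Delta> ?s"
    unfolding c_def b3_def
    by (rule comult_sum_right[OF A, symmetric]) (intro mult_closed a cl; assumption)+
  also have "tensor_map K A ?AA (\<lambda>x. x) \<Delta> ?r \<ominus>\<^bsub>U\<^esub> tensor_map K A ?AA (\<lambda>x. x) \<Delta> ?s
      = tensor_map K A ?AA (\<lambda>x. x) \<Delta> (\<Delta> a)"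
    unfolding comult_sums[OF a] by (rule linear_map_minus[OF l' AA U.module_axioms r s, symmetric])
  finally show ?thesis .
qed

section \<open>The covariant bialgebra and the two covariant module structures\<close>

lemma covariant_bialgebra:
  "covariant_bialgebra K A (inner_derivation K A r) (inner_derivation K A s) \<Delta>"
  by (intro covariant_bialgebra.intro covariant_bialgebra_axioms.intro assoc_algebra_axioms
      derivation_inner r_closed s_closed comult_linear comult_coassoc comult_mult)

lemma right_covariant:
  assumes M: "right_alg_module K A M act"
  shows "right_covariant_module K A (inner_derivation K A r) (inner_derivation K A s) \<Delta>
    M act (\<lambda>m. lmul K M A act m r)"
proof (intro right_covariant_module.intro right_covariant_module_axioms.intro covariant_bialgebra M
    right_coaction_act)
  interpret M: right_alg_module K A M act by fact
  let ?MA = "tensor K M A" and ?AA = "tensor K A A" and ?\<rho> = "\<lambda>m. lmul K M A act m r"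
  let ?T = "tensor K M ?AA"
  note A = algebra_module and mM = M.M.module_axioms and AA = AA.module_axioms
  note cl = xs_closed ys_closed
  interpret MA: module_pair K M A by (intro module_pairI A mM)
  interpret L: module_pair K ?MA A by (intro module_pairI MA.tensor_module A)
  interpret T: module_pair K M ?AA by (intro module_pairI mM AA)
  show \<rho>: "linear_map K M ?MA ?\<rho>"
    by (rule linear_map_lmul[OF mM A A mM M.right_act_bilinear r_closed])
  have \<rho>_sum: "?\<rho> m = list_sum ?MA (\<lambda>x. pure_tensor K M A (act m (fst x)) (snd x)) xs"
    if "m \<in> carrier M" for m
    unfolding lmul_def
    by (rule tensor_map_list_tensor[OF mM A A A bilinear_map_right[OF M.right_act_bilinear that] linear_map_id xs])
  fix m assume m: "m \<in> carrier M"
  note act = M.act_closed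
  have "tensor_assoc K M A A (tensor_map K ?MA A ?\<rho> (\<lambda>x. x) (?\<rho> m))
      = tensor_assoc K M A A (list_sum (tensor K ?MA A)
          (\<lambda>x. pure_tensor K ?MA A (?\<rho> (act m (fst x))) (snd x)) xs)"
    unfolding \<rho>_sum[OF m]
    by (rule arg_cong[OF tensor_map_list_sum[OF MA.tensor_module A mM A \<rho> linear_map_id]])
      (intro act m cl; assumption)+
  also have "\<dots> = list_sum ?T (\<lambda>x. tensor_assoc K M A A
          (pure_tensor K ?MA A (?\<rho> (act m (fst x))) (snd x))) xs"
    by (rule linear_map_list_sum[OF tensor_assoc_linear[OF mM A A] L.tensor_module T.tensor_module])
      (intro pure_tensor_closed MA.tensor_module A linear_map_closed[OF \<rho>] act m cl; assumption)
  also have "\<dots> = list_sum ?T (\<lambda>x. list_sum ?T (\<lambda>x'.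
        pure_tensor3 K M A A (act (act m (fst x)) (fst x')) (snd x') (snd x)) xs) xs"
  proof (rule list_sum_cong[OF refl])
    fix x assume x: "x \<in> set xs"
    show "tensor_assoc K M A A (pure_tensor K ?MA A (?\<rho> (act m (fst x))) (snd x))
        = list_sum ?T (\<lambda>x'. pure_tensor3 K M A A (act (act m (fst x)) (fst x')) (snd x') (snd x)) xs"
      unfolding \<rho>_sum[OF act[OF m cl(1)[OF x]]]
      by (rule tensor_assoc_list_sum[OF mM A A cl(2)[OF x]]) (intro act m cl x; assumption)+
  qed
  also have "\<dots> = tensor_map K M ?AA (\<lambda>x. x) \<Delta> (?\<rho> m)"
    unfolding right_yang_baxter[OF M m] \<rho>_sum[OF m]
    by (rule comult_sum_right[OF mM, symmetric]) (intro act m cl; assumption)+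
  finally show "tensor_assoc K M A A (tensor_map K ?MA A ?\<rho> (\<lambda>x. x) (?\<rho> m))
      = tensor_map K M ?AA (\<lambda>x. x) \<Delta> (?\<rho> m)" .
qed

text \<open>Signs are handled through n \<mapsto> sn: both sides of coassociativity are linear in
  the inserted tensor, so they are compared at sn and negated at the end.\<close>

lemma left_covariant:
  assumes N: "left_alg_module K A N act"
  shows "left_covariant_module K A (inner_derivation K A r) (inner_derivation K A s) \<Delta>
    N act (\<lambda>n. \<ominus>\<^bsub>tensor K A N\<^esub> rmul K A N act s n)"
proof (intro left_covariant_module.intro left_covariant_module_axioms.intro covariant_bialgebra N
    left_coaction_act)
  interpret N: left_alg_module K A N act by fact
  let ?AN = "tensor K A N" and ?AA = "tensor K A A" and ?\<sigma> = "rmul K A N act s"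
  let ?T = "tensor K A ?AN" and ?\<rho> = "\<lambda>n. \<ominus>\<^bsub>?AN\<^esub> ?\<sigma> n"
  note A = algebra_module and mN = N.N.module_axioms and AA = AA.module_axioms
  note cl = xs_closed ys_closed
  interpret AN: module_pair K A N by (intro module_pairI A mN)
  interpret T: module_pair K A ?AN by (intro module_pairI A AN.tensor_module)
  interpret Tm: module K ?T by (rule T.tensor_module)
  have \<sigma>: "linear_map K N ?AN ?\<sigma>"
    by (rule linear_map_rmul[OF A mN A mN N.left_act_bilinear s_closed])
  show \<rho>: "linear_map K N ?AN ?\<rho>"
    by (rule linear_map_uminus[OF \<sigma> mN AN.tensor_module])
  have \<sigma>_sum: "?\<sigma> n = list_sum ?AN (\<lambda>y. pure_tensor K A N (fst y) (act (snd y) n)) ys"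
    if "n \<in> carrier N" for n
    unfolding rmul_def
    by (rule tensor_map_list_tensor[OF A mN A A linear_map_id bilinear_map_left[OF N.left_act_bilinear that] ys])
  fix n assume n: "n \<in> carrier N"
  note act = N.act_closed
  note \<sigma>n = linear_map_closed[OF \<sigma> n]
  let ?f = "\<lambda>y'. list_sum ?T (\<lambda>y. pure_tensor3 K A A N (fst y') (fst y) (act (snd y) (act (snd y') n))) ys"
  let ?b = "list_sum ?T (\<lambda>y'. list_sum ?T (\<lambda>y.
      pure_tensor3 K A A N (fst y) (snd y \<otimes>\<^bsub>A\<^esub> fst y') (act (snd y') n)) ys) ys"
  have f: "?f y' \<in> carrier ?T" if "y' \<in> set ys" for y'
    by (intro Tm.M.list_sum_closed pure_tensor3_closed A mN act n cl that)
  have b: "?b \<in> carrier ?T"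
    by (intro Tm.M.list_sum_closed pure_tensor3_closed A mN mult_closed act n cl)
  have fs: "list_sum ?T ?f ys \<in> carrier ?T"
    by (rule Tm.M.list_sum_closed) (rule f)
  have l: "linear_map K ?AN ?T (tensor_map K A ?AN (\<lambda>x. x) ?\<rho>)"
    by (rule tensor_map_linear[OF A AN.tensor_module A mN linear_map_id \<rho>])
  have l': "linear_map K ?AN ?T (\<lambda>t. tensor_assoc K A A N (tensor_map K ?AA N \<Delta> (\<lambda>x. x) t))"
    by (rule linear_map_comp[OF tensor_map_linear[OF AA mN A mN comult_linear linear_map_id]
          tensor_assoc_linear[OF A A mN]])
  \<comment> \<open>Only the inner coaction carries its sign here, whence a single minus in front of
    (s23 s13)n.\<close>
  have "tensor_map K A ?AN (\<lambda>x. x) ?\<rho> (?\<sigma> n)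
      = list_sum ?T (\<lambda>y'. pure_tensor K A ?AN (fst y') (?\<rho> (act (snd y') n))) ys"
    unfolding \<sigma>_sum[OF n]
    by (rule tensor_map_list_sum[OF A AN.tensor_module A mN linear_map_id \<rho>]) (intro act n cl; assumption)+
  also have "\<dots> = list_sum ?T (\<lambda>y'. \<ominus>\<^bsub>?T\<^esub> ?f y') ys"
  proof (rule list_sum_cong[OF refl])
    fix y' assume y': "y' \<in> set ys"
    have an: "act (snd y') n \<in> carrier N" by (intro act n cl y')
    have "pure_tensor K A ?AN (fst y') (?\<rho> (act (snd y') n))
        = \<ominus>\<^bsub>?T\<^esub> pure_tensor K A ?AN (fst y') (?\<sigma> (act (snd y') n))"
      by (rule linear_map_a_inv[OF bilinear_map_right[OF T.pure_tensor_bilinear cl(3)[OF y']]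
            AN.tensor_module T.tensor_module linear_map_closed[OF \<sigma> an]])
    also have "pure_tensor K A ?AN (fst y') (?\<sigma> (act (snd y') n)) = ?f y'"
      unfolding \<sigma>_sum[OF an]
      by (rule pure_tensor_list_sum[OF A A mN cl(3)[OF y']]) (intro act an cl; assumption)+
    finally show "pure_tensor K A ?AN (fst y') (?\<rho> (act (snd y') n)) = \<ominus>\<^bsub>?T\<^esub> ?f y'" .
  qed
  also have "\<dots> = \<ominus>\<^bsub>?T\<^esub> list_sum ?T ?f ys"
    by (rule linear_map_list_sum[OF linear_map_uminus[OF linear_map_id] _ _ f, symmetric])
      (rule T.tensor_module)+
  finally have left: "tensor_map K A ?AN (\<lambda>x. x) ?\<rho> (?\<sigma> n) = \<ominus>\<^bsub>?T\<^esub> list_sum ?T ?f ys" .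
  \<comment> \<open>The two occurrences of \<open>?b\<close>, which is (s12 s23)n, come from the
    second equation and from \<Delta>; they cancel and leave the same single minus.\<close>
  have "tensor_assoc K A A N (tensor_map K ?AA N \<Delta> (\<lambda>x. x) (?\<sigma> n)) = (?b \<ominus>\<^bsub>?T\<^esub> list_sum ?T ?f ys) \<ominus>\<^bsub>?T\<^esub> ?b"
    unfolding left_yang_baxter[OF N n, symmetric] \<sigma>_sum[OF n]
    by (rule assoc_comult_sum[OF mN]) (intro act n cl; assumption)+
  also have "\<dots> = \<ominus>\<^bsub>?T\<^esub> list_sum ?T ?f ys"
    using b fs by (simp add: Tm.M.minus_eq Tm.M.a_comm[of ?b "\<ominus>\<^bsub>?T\<^esub> list_sum ?T ?f ys"] Tm.M.a_assoc Tm.M.r_neg)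
  finally have right: "tensor_assoc K A A N (tensor_map K ?AA N \<Delta> (\<lambda>x. x) (?\<sigma> n)) = \<ominus>\<^bsub>?T\<^esub> list_sum ?T ?f ys" .
  show "tensor_map K A ?AN (\<lambda>x. x) ?\<rho> (?\<rho> n) = tensor_assoc K A A N (tensor_map K ?AA N \<Delta> (\<lambda>x. x) (?\<rho> n))"
    unfolding linear_map_a_inv[OF l AN.tensor_module T.tensor_module \<sigma>n]
      linear_map_a_inv[OF l' AN.tensor_module T.tensor_module \<sigma>n] left right ..
qed

end

theorem proposition3p26:
  fixes K :: "('k, 'kx) ring_scheme"
    and A :: "('k, 'a, 'ax) module_scheme"
    and M :: "('k, 'm, 'mx) module_scheme"
    and N :: "('k, 'n, 'nx) module_scheme"
    and r s :: "('a \<times> 'a \<Rightarrow> 'k) set"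
    and ract :: "'m \<Rightarrow> 'a \<Rightarrow> 'm"
    and lact :: "'a \<Rightarrow> 'n \<Rightarrow> 'n"
  assumes "assoc_algebra K A"
    and "yang_baxter_pair K A r s"
  shows "(right_alg_module K A M ract \<longrightarrow>
           right_covariant_module K A
             (inner_derivation K A r) (inner_derivation K A s) (quasitriangular_comult K A r s)
             M ract (\<lambda>m. lmul K M A ract m r)) \<and>
         (left_alg_module K A N lact \<longrightarrow>
           left_covariant_module K A
             (inner_derivation K A r) (inner_derivation K A s) (quasitriangular_comult K A r s)
             N lact (\<lambda>n. \<ominus>\<^bsub>tensor K A N\<^esub> rmul K A N lact s n))"
proof (intro conjI impI)
  interpret assoc_algebra K A by fact
  \<comment> \<open>From here the pair enters only through lists; \<open>rs\<close> identifies the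
    given tensors with the list sums of the locale.\<close>
  obtain xs ys where "set xs \<subseteq> carrier A \<times> carrier A" "set ys \<subseteq> carrier A \<times> carrier A"
    and rs: "r = list_tensor K A A xs" "s = list_tensor K A A ys" and "yang_baxter_sums K A xs ys"
    using yang_baxter_pair_sums[OF assms(2)] .
  then interpret yang_baxter_lists K A xs ys
    by unfold_locales
  show "right_covariant_module K A (inner_derivation K A r) (inner_derivation K A s)
      (quasitriangular_comult K A r s) M ract (\<lambda>m. lmul K M A ract m r)"
    if "right_alg_module K A M ract"
    using right_covariant[OF that] by (simp add: rs)
  show "left_covariant_module K A (inner_derivation K A r) (inner_derivation K A s)
      (quasitriangular_comult K A r s) N lact (\<lambda>n. \<ominus>\<^bsub>tensor K A N\<^esub> rmul K A N lact s n)"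
    if "left_alg_module K A N lact"
    using left_covariant[OF that] by (simp add: rs)
qed

end
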